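(* Let $X\subset\mathbb{G}_m^d$ be a hypersurface defined over $\mathbb{F}$. Assume that $\mathbf{0}\notin\mathscr{A}_p(X)$ for at least one $p\in S$. Then for any nonzero vector $\mathbf{v}\in\mathbb{R}^d$ the open half-line $(0,\infty)\cdot\mathbf{v}=\{t\mathbf{v}:t>0\}$ meets the adelic amoeba $\mathscr{A}_{\mathbb{A}}(X)$.
   Context: $\mathbb{F}$ is a field of one of the following two types: (a) a number field, i.e. a finite extension of $\mathbb{Q}$; (b) a function field $\mathbb{F}=\mathbb{K}(C)$, the field of rational functions on a smooth projective algebraic curve $C$ over a field $\mathbb{K}$. A norm on $\mathbb{F}$ is a function $|\cdot|\colon\mathbb{F}\to\mathbb{R}_{\ge0}$ with $|a|=0$ iff $a=0$, $|ab|=|a||b|$, $|a+b|\le|a|+|b|$. Two norms are equivalent if they define the same topology. $S$ is the set of equivalence classes of nontrivial norms on $\mathbb{F}$ (inducing the trivial norm on $\mathbb{K}$ in case (b)). For each $p\in S$ a representative $|\cdot|_p$ is chosen so that for every $a\in\mathbb{F}^\times$ one has $|a|_p=1$ for all but finitely many $p\in S$, and $\prod_{p\in S}|a|_p=1$. For $p\in S$, $\mathbb{F}_p$ is the completion of $\mathbb{F}$ with respect to $|\cdot|_p$, $\overline{\mathbb{F}}_p$ is an algebraic closure of $\mathbb{F}_p$, and $|\cdot|_p$ is extended to it. $\mathbb{G}_m^d=\operatorname{Spec}\mathbb{F}[x_1^{\pm1},\dots,x_d^{\pm1}]$. A hypersurface defined over $\mathbb{F}$ is $X=\{f=0\}\subset\mathbb{G}_m^d$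 for a Laurent polynomial $f\in\mathbb{F}[x_1^{\pm1},\dots,x_d^{\pm1}]$. The $p$-adic amoeba of $X$ is $$\mathscr{A}_p(X)=\text{closure in }\mathbb{R}^d\text{ of }\{(\log|a_1|_p,\dots,\log|a_d|_p):(a_1,\dots,a_d)\in X(\overline{\mathbb{F}}_p)\},$$ and the adelic amoeba is $\mathscr{A}_{\mathbb{A}}(X)=\bigcup_{p\in S}\mathscr{A}_p(X)$.
   Formalization: The Laurent polynomial f defining X is assumed to be nonzero and not a unit (not a single monomial); for a monomial f, X and all its amoebas are empty and the claim fails, while for f = 0 the origin lies in every amoeba. *)

theory Defs
  imports
    "HOL-Analysis.Analysis"
    "HOL-Algebra.Algebraic_Closure_Type"
    "HOL-Algebra.Generated_Fields"
    "HOL-Library.Poly_Mapping"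
    "HOL-Library.Function_Algebras"
begin

section \<open>Norms, places and completions\<close>

definition field_norm :: "('a, 'm) ring_scheme \<Rightarrow> ('a \<Rightarrow> real) \<Rightarrow> bool" where
  "field_norm R N \<longleftrightarrow>
     (\<forall>x\<in>carrier R. 0 \<le> N x \<and> (N x = 0 \<longleftrightarrow> x = \<zero>\<^bsub>R\<^esub>)) \<and>
     (\<forall>x\<in>carrier R. \<forall>y\<in>carrier R.
        N (x \<otimes>\<^bsub>R\<^esub> y) = N x * N y \<and> N (x \<oplus>\<^bsub>R\<^esub> y) \<le> N x + N y)"

text \<open>The distance is set to zero off the carrier because \<^locale>\<open>Metric_space\<close> demands
  nonnegativity and symmetry for all elements of the type.\<close>

definition norm_metric ::
  "('a, 'm) ring_scheme \<Rightarrow> 'a set \<Rightarrow> ('a \<Rightarrow> real) \<Rightarrow> 'a metric" where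
  "norm_metric R A N =
     metric (A, \<lambda>x y. if x \<in> carrier R \<and> y \<in> carrier R then N (x \<ominus>\<^bsub>R\<^esub> y) else 0)"

lemma norm_metric_Metric_space:
  assumes "field R" "field_norm R N" "A \<subseteq> carrier R"
  shows "Metric_space A (\<lambda>x y. if x \<in> carrier R \<and> y \<in> carrier R then N (x \<ominus>\<^bsub>R\<^esub> y) else 0)"
proof -
  interpret field R by fact
  have nonneg: "0 \<le> N x" if "x \<in> carrier R" for x
    using assms(2) that by (auto simp: field_norm_def)
  have zero: "N x = 0 \<longleftrightarrow> x = \<zero>\<^bsub>R\<^esub>" if "x \<in> carrier R" for x
    using assms(2) that by (auto simp: field_norm_def)
  have mult: "N (x \<otimes>\<^bsub>R\<^esub> y) = N x * N y" if "x \<in> carrier R" "y \<in> carrier R" for x y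
    using assms(2) that by (auto simp: field_norm_def)
  have tri: "N (x \<oplus>\<^bsub>R\<^esub> y) \<le> N x + N y" if "x \<in> carrier R" "y \<in> carrier R" for x y
    using assms(2) that by (auto simp: field_norm_def)
  have minus: "N (\<ominus>\<^bsub>R\<^esub> x) = N x" if "x \<in> carrier R" for x
  proof -
    have "N (\<ominus>\<^bsub>R\<^esub> x) * N (\<ominus>\<^bsub>R\<^esub> x) = N x * N x"
      using that mult[of "\<ominus>\<^bsub>R\<^esub> x" "\<ominus>\<^bsub>R\<^esub> x"] mult[of x x] by (simp add: l_minus r_minus)
    then show ?thesis
      using nonneg[of x] nonneg[of "\<ominus>\<^bsub>R\<^esub> x"] that by (simp add: square_eq_iff) (use that in force)
  qed
  show ?thesis
  proof
    fix x y z
    show "0 \<le> (if x \<in> carrier R \<and> y \<in> carrier R then N (x \<ominus>\<^bsub>R\<^esub> y) else 0)"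
      using nonneg by auto
    have "N (x \<ominus>\<^bsub>R\<^esub> y) = N (y \<ominus>\<^bsub>R\<^esub> x)" if "x \<in> carrier R" "y \<in> carrier R"
      using minus[of "y \<ominus>\<^bsub>R\<^esub> x"] that by (simp add: a_minus_def minus_add a_comm)
    then show "(if x \<in> carrier R \<and> y \<in> carrier R then N (x \<ominus>\<^bsub>R\<^esub> y) else 0) =
          (if y \<in> carrier R \<and> x \<in> carrier R then N (y \<ominus>\<^bsub>R\<^esub> x) else 0)"
      by auto
    assume x: "x \<in> A" and y: "y \<in> A"
    then have c: "x \<in> carrier R" "y \<in> carrier R" using assms(3) by auto
    then show "((if x \<in> carrier R \<and> y \<in> carrier R then N (x \<ominus>\<^bsub>R\<^esub> y) else 0) = 0) = (x = y)"
      using zero[of "x \<ominus>\<^bsub>R\<^esub> y"] by (simp add: r_right_minus_eq)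
    assume "z \<in> A"
    then have z: "z \<in> carrier R" using assms(3) by auto
    have "x \<ominus>\<^bsub>R\<^esub> z = (x \<ominus>\<^bsub>R\<^esub> y) \<oplus>\<^bsub>R\<^esub> (y \<ominus>\<^bsub>R\<^esub> z)"
      using c z by algebra
    then have "N (x \<ominus>\<^bsub>R\<^esub> z) \<le> N (x \<ominus>\<^bsub>R\<^esub> y) + N (y \<ominus>\<^bsub>R\<^esub> z)"
      using tri[of "x \<ominus>\<^bsub>R\<^esub> y" "y \<ominus>\<^bsub>R\<^esub> z"] c z by simp
    then show "(if x \<in> carrier R \<and> z \<in> carrier R then N (x \<ominus>\<^bsub>R\<^esub> z) else 0)
        \<le> (if x \<in> carrier R \<and> y \<in> carrier R then N (x \<ominus>\<^bsub>R\<^esub> y) else 0) +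
          (if y \<in> carrier R \<and> z \<in> carrier R then N (y \<ominus>\<^bsub>R\<^esub> z) else 0)"
      using c z by simp
  qed
qed

definition norm_equiv :: "(('f::field \<Rightarrow> real) \<times> ('f \<Rightarrow> real)) set" where
  "norm_equiv = {(N, M). field_norm ring_of_type_algebra N \<and> field_norm ring_of_type_algebra M \<and>
     mtopology_of (norm_metric ring_of_type_algebra UNIV N) =
     mtopology_of (norm_metric ring_of_type_algebra UNIV M)}"

text \<open>Equivalence classes of nontrivial norms that are trivial on the set \<open>K\<close> (no condition
  is imposed when \<open>K\<close> is empty).\<close>

definition places :: "'f::field set \<Rightarrow> ('f \<Rightarrow> real) set set" where
  "places K = {N. field_norm ring_of_type_algebra N \<and> (\<exists>x. x \<noteq> 0 \<and> N x \<noteq> 1) \<and>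
                  (\<forall>x\<in>K. x \<noteq> 0 \<longrightarrow> N x = 1)} // norm_equiv"

definition product_formula ::
  "('f::field \<Rightarrow> real) set set \<Rightarrow> (('f \<Rightarrow> real) set \<Rightarrow> 'f \<Rightarrow> real) \<Rightarrow> bool" where
  "product_formula S rep \<longleftrightarrow>
     (\<forall>x. x \<noteq> 0 \<longrightarrow> finite {p\<in>S. rep p x \<noteq> 1} \<and> (\<Prod>p\<in>{p\<in>S. rep p x \<noteq> 1}. rep p x) = 1)"

text \<open>The subfield \<open>k\<close> of \<open>L\<close>, normed by the restriction of \<open>nrm\<close>, is the completion of the
  field \<open>'f\<close> with respect to \<open>N\<close> via the embedding \<open>emb\<close>; \<open>L\<close> is an algebraic closure
  of \<open>k\<close>, and \<open>nrm\<close> is a norm on all of \<open>L\<close>.\<close>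

definition completed_closure ::
  "('f::field \<Rightarrow> real) \<Rightarrow> ('l, 'm) ring_scheme \<Rightarrow> 'l set \<Rightarrow> ('l \<Rightarrow> real) \<Rightarrow> ('f \<Rightarrow> 'l) \<Rightarrow> bool" where
  "completed_closure N L k nrm emb \<longleftrightarrow>
     algebraic_closure L k \<and> field_norm L nrm \<and>
     emb \<in> ring_hom ring_of_type_algebra L \<and> range emb \<subseteq> k \<and>
     (\<forall>x. nrm (emb x) = N x) \<and>
     mcomplete_of (norm_metric L k nrm) \<and>
     mtopology_of (norm_metric L k nrm) closure_of range emb = k"



section \<open>The global fields\<close>

text \<open>The subfield generated by the empty set is the prime field, which is the field of
  rational numbers when the characteristic is zero.\<close>

definition number_field :: "'f::field itself \<Rightarrow> bool" where
  "number_field T \<longleftrightarrow> CHAR('f) = 0 \<and>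
     ring.finite_dimension (ring_of_type_algebra :: 'f ring)
       (generate_field ring_of_type_algebra {}) UNIV"

subsection \<open>Projective curves\<close>

type_synonym 'a mpoly = "(nat \<Rightarrow>\<^sub>0 nat) \<Rightarrow>\<^sub>0 'a"

definition mpoly_eval :: "('a::zero \<Rightarrow> 'b::comm_ring_1) \<Rightarrow> 'a mpoly \<Rightarrow> (nat \<Rightarrow> 'b) \<Rightarrow> 'b" where
  "mpoly_eval h f a =
     (\<Sum>m\<in>Poly_Mapping.keys f. h (Poly_Mapping.lookup f m) *
        (\<Prod>i\<in>Poly_Mapping.keys m. a i ^ Poly_Mapping.lookup m i))"

definition mpoly_deriv :: "nat \<Rightarrow> 'a::comm_ring_1 mpoly \<Rightarrow> 'a mpoly" where
  "mpoly_deriv i f =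
     (\<Sum>m\<in>Poly_Mapping.keys f. Poly_Mapping.single (m - Poly_Mapping.single i 1)
        (of_nat (Poly_Mapping.lookup m i) * Poly_Mapping.lookup f m))"

definition monom_degree :: "(nat \<Rightarrow>\<^sub>0 nat) \<Rightarrow> nat" where
  "monom_degree m = (\<Sum>i\<in>Poly_Mapping.keys m. Poly_Mapping.lookup m i)"

definition homogeneous :: "nat \<Rightarrow> 'a::zero mpoly \<Rightarrow> bool" where
  "homogeneous e f \<longleftrightarrow> (\<forall>m\<in>Poly_Mapping.keys f. monom_degree m = e)"

definition homogeneous_part :: "nat \<Rightarrow> 'a::comm_monoid_add mpoly \<Rightarrow> 'a mpoly" where
  "homogeneous_part e f =
     (\<Sum>m\<in>{m\<in>Poly_Mapping.keys f. monom_degree m = e}.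
        Poly_Mapping.single m (Poly_Mapping.lookup f m))"

text \<open>The polynomials in \<open>x\<^sub>0, \<dots>, x\<^sub>n\<close> with coefficients in \<open>K\<close>.\<close>

definition mpolys :: "'a::zero set \<Rightarrow> nat \<Rightarrow> 'a mpoly set" where
  "mpolys K n = {f. (\<forall>m. Poly_Mapping.lookup f m \<in> K) \<and>
                    (\<forall>m\<in>Poly_Mapping.keys f. Poly_Mapping.keys m \<subseteq> {..n})}"

text \<open>An integral closed subscheme of projective \<open>n\<close>-space over \<open>K\<close>, given by its
  homogeneous prime ideal, which must not contain all the variables.\<close>

definition projective_variety :: "'a::field set \<Rightarrow> nat \<Rightarrow> 'a mpoly set \<Rightarrow> bool" where
  "projective_variety K n I \<longleftrightarrow>
     primeideal I (ring_of_type_algebra\<lparr>carrier := mpolys K n\<rparr>) \<and>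
     (\<forall>f\<in>I. \<forall>e. homogeneous_part e f \<in> I) \<and>
     (\<exists>i\<le>n. Poly_Mapping.single (Poly_Mapping.single i 1) 1 \<notin> I)"

text \<open>The function field of the variety of \<open>I\<close> consists of the fractions \<open>g / h\<close> of homogeneous
  polynomials over \<open>K\<close> of equal degree with \<open>h \<notin> I\<close>. A \<open>K\<close>-isomorphism from it onto the
  ambient field is the same as a point \<open>\<xi>\<close> (the generic point) with values in that field such that
  \<open>I\<close> is the vanishing ideal of \<open>\<xi>\<close> and every element has the form \<open>g(\<xi>) / h(\<xi>)\<close>.\<close>

definition is_function_field_of :: "'f::field set \<Rightarrow> nat \<Rightarrow> 'f mpoly set \<Rightarrow> bool" where
  "is_function_field_of K n I \<longleftrightarrow>
     (\<exists>\<xi> :: nat \<Rightarrow> 'f.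
        (\<forall>e. \<forall>g\<in>mpolys K n. homogeneous e g \<longrightarrow> (g \<in> I \<longleftrightarrow> mpoly_eval id g \<xi> = 0)) \<and>
        (\<forall>z. \<exists>e. \<exists>g\<in>mpolys K n. \<exists>h\<in>mpolys K n.
           homogeneous e g \<and> homogeneous e h \<and> h \<notin> I \<and>
           z = mpoly_eval id g \<xi> / mpoly_eval id h \<xi>))"

text \<open>Transcendence degree one over \<open>K\<close>; for the function field of a variety this says that
  the variety has dimension one.\<close>

definition transcendence_degree_one :: "'f::field set \<Rightarrow> bool" where
  "transcendence_degree_one K \<longleftrightarrow>
     (\<exists>t. ring.transcendental (ring_of_type_algebra :: 'f ring) K t \<and>
        (\<forall>x. \<not> ring.transcendental (ring_of_type_algebra :: 'f ring)
                 (generate_field ring_of_type_algebra (insert t K)) x))"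

text \<open>The Jacobian criterion for a curve: at every geometric point the Jacobian matrix of the
  elements of \<open>I\<close> has rank \<open>n - 1\<close>. Geometric points are taken in the algebraic closure of the
  ambient field, an algebraically closed extension of \<open>K\<close>. The homogeneous coordinates of a point
  are \<open>P 0, \<dots>, P n\<close>; the gradients vanish in all positions above \<open>n\<close>.\<close>

definition smooth_curve :: "nat \<Rightarrow> 'f::field mpoly set \<Rightarrow> bool" where
  "smooth_curve n I \<longleftrightarrow>
     (\<forall>P :: nat \<Rightarrow> 'f alg_closure.
        (\<exists>i\<le>n. P i \<noteq> 0) \<and> (\<forall>f\<in>I. mpoly_eval to_ac f P = 0) \<longrightarrow>
        vector_space.dim (\<lambda>c w i. c * w i)
          ((\<lambda>f i. mpoly_eval to_ac (mpoly_deriv i f) P) ` I) + 1 = n)"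

definition smooth_projective_curve_field :: "'f::field set \<Rightarrow> bool" where
  "smooth_projective_curve_field K \<longleftrightarrow>
     subfield K (ring_of_type_algebra :: 'f ring) \<and>
     (\<exists>n I. projective_variety K n I \<and> is_function_field_of K n I \<and>
        transcendence_degree_one K \<and> smooth_curve n I)"


section \<open>Hypersurfaces in the torus and their amoebas\<close>

text \<open>A Laurent polynomial in \<open>d\<close> variables is an element of the group algebra of the lattice
  \<open>int ^ 'd\<close>, where \<open>d = CARD('d)\<close>; multiplication is convolution.\<close>

type_synonym ('f, 'd) laurent_poly = "(int ^ 'd) \<Rightarrow>\<^sub>0 'f"

text \<open>A hypersurface has codimension one, so that its equation is neither zero nor a unit
  (that is, a monomial, which has no zeros in the torus).\<close>

definition hypersurface_eq :: "('f::field, 'd::finite) laurent_poly \<Rightarrow> bool" where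
  "hypersurface_eq f \<longleftrightarrow> f \<noteq> 0 \<and> \<not> f dvd 1"

definition laurent_eval ::
  "('l, 'm) ring_scheme \<Rightarrow> ('f::field \<Rightarrow> 'l) \<Rightarrow> ('f, 'd::finite) laurent_poly \<Rightarrow> ('d \<Rightarrow> 'l) \<Rightarrow> 'l" where
  "laurent_eval L emb f a =
     (\<Oplus>\<^bsub>L\<^esub>\<alpha>\<in>Poly_Mapping.keys f. emb (Poly_Mapping.lookup f \<alpha>) \<otimes>\<^bsub>L\<^esub>
        (\<Otimes>\<^bsub>L\<^esub>i\<in>UNIV. a i [^]\<^bsub>L\<^esub> (\<alpha> $ i)))"

definition hypersurface_points ::
  "('l, 'm) ring_scheme \<Rightarrow> ('f::field \<Rightarrow> 'l) \<Rightarrow> ('f, 'd::finite) laurent_poly \<Rightarrow> ('d \<Rightarrow> 'l) set" where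
  "hypersurface_points L emb f =
     {a. (\<forall>i. a i \<in> carrier L - {\<zero>\<^bsub>L\<^esub>}) \<and> laurent_eval L emb f a = \<zero>\<^bsub>L\<^esub>}"

definition amoeba ::
  "('l, 'm) ring_scheme \<Rightarrow> ('l \<Rightarrow> real) \<Rightarrow> ('f::field \<Rightarrow> 'l) \<Rightarrow>
   ('f, 'd::finite) laurent_poly \<Rightarrow> (real ^ 'd) set" where
  "amoeba L nrm emb f = closure ((\<lambda>a. \<chi> i. ln (nrm (a i))) ` hypersurface_points L emb f)"

definition adelic_amoeba ::
  "'p set \<Rightarrow> ('p \<Rightarrow> ('l, 'm) ring_scheme) \<Rightarrow> ('p \<Rightarrow> 'l \<Rightarrow> real) \<Rightarrow> ('p \<Rightarrow> 'f::field \<Rightarrow> 'l) \<Rightarrow>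
   ('f, 'd::finite) laurent_poly \<Rightarrow> (real ^ 'd) set" where
  "adelic_amoeba S L nrm emb f = (\<Union>p\<in>S. amoeba (L p) (nrm p) (emb p) f)"

end

theory Submission
  imports Defs
begin

text \<open>
  The theorem is reduced to the location of the roots of polynomials in one variable. Suppose that the
  half-line misses the amoeba at every place, and let \<open>f\<close> have the terms \<open>c\<^sub>\<alpha> x^\<alpha>\<close>.

  First, some exponent \<open>\<gamma>\<close> is the only one at which \<open>\<alpha> \<bullet> v\<close> is maximal. Indeed there is an
  ultrametric place at which all coefficients \<open>c\<^sub>\<alpha>\<close> have norm one
  (\<open>exists_place_equal_one_on\<close>). If two exponents were tied there, restricting \<open>f\<close> to a curve
  \<open>a z^W\<close> with \<open>Log a\<close> near \<open>v\<close> would give a polynomial in \<open>z\<close> with two coefficients of almost maximal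
  norm. By the Newton polygon it would have a root of norm almost one, and \<open>v\<close> would lie in the
  amoeba (\<open>tie_in_amoeba\<close>).

  Next, consider any place, ultrametric or not, and a closed half-line from \<open>u\<close> in the direction
  \<open>v\<close> that misses the amoeba. Half-lines that start near \<open>u\<close> in rational directions near \<open>v\<close>
  miss the hypersurface as well: for bounded parameters by compactness, and far out because the term of
  \<open>\<gamma>\<close> dominates. Hence the restriction of \<open>f\<close> to such a curve has only roots of norm at
  most one, and its constant coefficient is at most its leading coefficient. For the exponent
  \<open>\<beta>\<close> that is minimal in the chosen rational directions this means
  \<open>|c\<^sub>\<beta>| exp (\<beta> \<bullet> u) \<le> |c\<^sub>\<gamma>| exp (\<gamma> \<bullet> u)\<close>
  (\<open>generically_minimal_term_le\<close>).

  Taking \<open>u = s v\<close> with \<open>s > 0\<close> tending to zero yields \<open>|c\<^sub>\<beta>| \<le> |c\<^sub>\<gamma>|\<close> at every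
  place, and by the product formula equality holds everywhere. At a place whose amoeba does not contain
  the origin one may also take \<open>u = - s v\<close> with a small \<open>s > 0\<close>, and obtains
  \<open>exp (- s (\<beta> \<bullet> v)) \<le> exp (- s (\<gamma> \<bullet> v))\<close>. This contradicts
  \<open>\<beta> \<bullet> v < \<gamma> \<bullet> v\<close>.

  The place with coefficients of norm one is constructed by valuation theory. The global field is
  algebraic over the fractions of a Euclidean ring \<open>R\<close>, namely the integers or \<open>K[t]\<close>. By Zorn's
  lemma, \<open>R\<close> is contained in a largest subring that avoids the inverse of a given non-unit \<open>\<omega>\<close> of \<open>R\<close>. It is a valuation ring
  (\<open>valuation_ring\<close>) and, by algebraicity, its valuation is a real-valued norm. If \<open>\<omega>\<close> is
  coprime to the numerators and denominators in algebraic equations for the \<open>c\<^sub>\<alpha>\<close>, then these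
  have norm one (\<open>exists_norm_equal_one_on\<close>).
\<close>

section \<open>Roots and coefficients over an algebraically closed field\<close>

text \<open>A polynomial of degree \<open>n\<close> is handled through its coefficient function, extended by zero:
  the arguments below compare individual coefficients, and dividing by a linear factor is then a
  recursion on functions.\<close>

definition (in ring) poly_coeffs :: "nat \<Rightarrow> (nat \<Rightarrow> 'a) \<Rightarrow> bool" where
  "poly_coeffs n c \<longleftrightarrow> (\<forall>i. c i \<in> carrier R) \<and> c n \<noteq> \<zero> \<and> (\<forall>i>n. c i = \<zero>)"

definition (in ring) poly_value :: "nat \<Rightarrow> (nat \<Rightarrow> 'a) \<Rightarrow> 'a \<Rightarrow> 'a" where
  "poly_value n c z = (\<Oplus>i\<in>{..n}. c i \<otimes> z [^] i)"

lemma (in cring) poly_value_Suc: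
  assumes "\<And>i. c i \<in> carrier R" "z \<in> carrier R"
  shows "poly_value (Suc n) c z = poly_value n c z \<oplus> c (Suc n) \<otimes> z [^] Suc n"
proof -
  have "poly_value (Suc n) c z = c (Suc n) \<otimes> z [^] Suc n \<oplus> poly_value n c z"
    unfolding poly_value_def using assms by (subst finsum_Suc) auto
  then show ?thesis
    using assms by (simp add: poly_value_def a_comm)
qed

lemma (in cring) poly_value_closed:
  assumes "\<And>i. c i \<in> carrier R" "z \<in> carrier R"
  shows "poly_value n c z \<in> carrier R"
  using assms by (simp add: poly_value_def)

lemma (in cring) poly_value_0:
  assumes "\<And>i. c i \<in> carrier R" "z \<in> carrier R"
  shows "poly_value 0 c z = c 0"
  using assms by (simp add: poly_value_def)

lemma (in cring) eval_coeff_list: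
  assumes "\<And>i. c i \<in> carrier R" "z \<in> carrier R"
  shows "eval (map c (rev [0..<Suc n])) z = poly_value n c z"
proof (induction n)
  case 0
  then show ?case using assms by (simp add: poly_value_0)
next
  case (Suc n)
  have "eval (map c (rev [0..<Suc (Suc n)])) z
      = c (Suc n) \<otimes> z [^] Suc n \<oplus> eval (map c (rev [0..<Suc n])) z"
    by simp
  then show ?case
    using assms by (simp only: Suc.IH poly_value_Suc) (simp add: a_comm poly_value_closed)
qed

lemma (in algebraically_closed) exists_poly_root:
  assumes "poly_coeffs n c" "n > 0"
  shows "\<exists>r\<in>carrier L. poly_value n c r = \<zero>"
proof -
  let ?p = "map c (rev [0..<Suc n])"
  have "polynomial (carrier L) ?p"
    using assms by (auto simp: polynomial_def poly_coeffs_def)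
  then have p: "?p \<in> carrier (poly_ring L)"
    by (simp add: univ_poly_carrier)
  then have "size (roots ?p) = n"
    using roots_over_carrier[OF p] by (simp add: splitted_def)
  then obtain r where "r \<in># roots ?p"
    using assms(2) by (metis gr_implies_not0 multiset_nonemptyE size_empty)
  then have "is_root ?p r"
    using roots_mem_iff_is_root[OF p] by blast
  then show ?thesis
    using assms(1) eval_coeff_list[of c r n] by (auto simp: is_root_def poly_coeffs_def)
qed

text \<open>These ring identities are separated out so that the ring normalisation sees variables only,
  and no sums or coefficient functions.\<close>

lemma (in cring) times_root_step:
  assumes "r \<in> carrier R" "z \<in> carrier R" "p \<in> carrier R" "a \<in> carrier R" "b \<in> carrier R" "w \<in> carrier R"
  shows "(z \<ominus> r) \<otimes> p \<ominus> r \<otimes> a \<otimes> w \<oplus> (a \<ominus> r \<otimes> b) \<otimes> (w \<otimes> z)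
      = (z \<ominus> r) \<otimes> (p \<oplus> a \<otimes> w) \<ominus> r \<otimes> b \<otimes> (w \<otimes> z)"
  using assms by algebra

lemma (in cring) times_root_start:
  assumes "r \<in> carrier R" "z \<in> carrier R" "a \<in> carrier R" "b \<in> carrier R"
  shows "(\<zero> \<ominus> r \<otimes> a) \<oplus> (a \<ominus> r \<otimes> b) \<otimes> z = (z \<ominus> r) \<otimes> a \<ominus> r \<otimes> b \<otimes> z"
  using assms by algebra

lemma (in cring) horner_step:
  assumes "r \<in> carrier R" "x \<in> carrier R" "a \<in> carrier R" "p \<in> carrier R" "s \<in> carrier R"
  shows "(a \<oplus> r \<otimes> x) \<otimes> p \<oplus> s = x \<otimes> (p \<otimes> r) \<oplus> (a \<otimes> p \<oplus> s)"
  using assms by algebra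

lemma (in cring) add_minus_self:
  assumes "a \<in> carrier R" "b \<in> carrier R"
  shows "(a \<oplus> b) \<ominus> b = a"
  using assms by algebra

text \<open>The coefficients of \<open>(z - r) h(z)\<close>.\<close>

definition (in ring) times_root :: "'a \<Rightarrow> (nat \<Rightarrow> 'a) \<Rightarrow> nat \<Rightarrow> 'a" where
  "times_root r h = (\<lambda>i. (case i of 0 \<Rightarrow> \<zero> | Suc j \<Rightarrow> h j) \<ominus> r \<otimes> h i)"

text \<open>The sums of the first terms of \<open>(z - r) h(z)\<close> telescope. The correction term vanishes as soon as
  \<open>m\<close> reaches the degree of \<open>h\<close>.\<close>

lemma (in cring) poly_value_times_root:
  assumes h: "\<And>i. h i \<in> carrier R" and r: "r \<in> carrier R" and z: "z \<in> carrier R"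
  shows "poly_value (Suc m) (times_root r h) z
      = (z \<ominus> r) \<otimes> poly_value m h z \<ominus> r \<otimes> h (Suc m) \<otimes> z [^] Suc m"
proof (induction m)
  have c: "times_root r h i \<in> carrier R" for i
    using h r by (auto simp: times_root_def split: nat.split)
  case 0
  have "poly_value (Suc 0) (times_root r h) z = (\<zero> \<ominus> r \<otimes> h 0) \<oplus> (h 0 \<ominus> r \<otimes> h 1) \<otimes> z"
    using c z by (simp add: poly_value_Suc poly_value_0) (simp add: times_root_def z)
  then show ?case
    using times_root_start[OF r z h h, of 0 1] by (simp add: poly_value_0 h z)
next
  have c: "times_root r h i \<in> carrier R" for i
    using h r by (auto simp: times_root_def split: nat.split)
  case (Suc m)
  define w where "w = z [^] Suc m"
  have w: "w \<in> carrier R" "z [^] Suc (Suc m) = w \<otimes> z"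
    using z by (auto simp: w_def)
  have t: "times_root r h (Suc (Suc m)) = h (Suc m) \<ominus> r \<otimes> h (Suc (Suc m))"
    by (simp add: times_root_def)
  have "poly_value (Suc (Suc m)) (times_root r h) z
     = (z \<ominus> r) \<otimes> poly_value m h z \<ominus> r \<otimes> h (Suc m) \<otimes> w
       \<oplus> (h (Suc m) \<ominus> r \<otimes> h (Suc (Suc m))) \<otimes> (w \<otimes> z)"
    by (subst poly_value_Suc[OF c z]) (simp only: Suc.IH t w(2) flip: w_def)
  also have "\<dots> = (z \<ominus> r) \<otimes> (poly_value m h z \<oplus> h (Suc m) \<otimes> w) \<ominus> r \<otimes> h (Suc (Suc m)) \<otimes> (w \<otimes> z)"
    by (rule times_root_step[OF r z poly_value_closed[OF h z] h h w(1)])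
  also have "poly_value m h z \<oplus> h (Suc m) \<otimes> w = poly_value (Suc m) h z"
    by (subst poly_value_Suc[OF h z]) (simp add: w_def)
  finally show ?case
    by (simp only: w(2))
qed

text \<open>The coefficients of the quotient are the intermediate values of the Horner scheme at \<open>r\<close>,
  read from the top degree down; its last value is the value of the polynomial at \<open>r\<close>, that is, zero.\<close>

lemma (in cring) exists_root_quotient:
  assumes c: "poly_coeffs (Suc n) c" and r: "r \<in> carrier R" and root: "poly_value (Suc n) c r = \<zero>"
  shows "\<exists>h. poly_coeffs n h \<and> c = times_root r h"
proof -
  have cc: "c i \<in> carrier R" for i
    using c by (simp add: poly_coeffs_def)
  define H where "H = rec_nat (c (Suc n)) (\<lambda>k b. c (n - k) \<oplus> r \<otimes> b)"
  have H0: "H 0 = c (Suc n)" and HS: "H (Suc k) = c (n - k) \<oplus> r \<otimes> H k" for k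
    by (simp_all add: H_def)
  have Hc: "H k \<in> carrier R" for k
    by (induction k) (use cc r in \<open>auto simp: H0 HS\<close>)
  have Hsum: "k \<le> Suc n \<Longrightarrow> H k \<otimes> r [^] (Suc n - k) \<oplus> (\<Oplus>i\<in>{..<Suc n - k}. c i \<otimes> r [^] i)
      = poly_value (Suc n) c r" for k
  proof (induction k)
    case 0
    have "poly_value (Suc n) c r = poly_value n c r \<oplus> H 0 \<otimes> r [^] Suc n"
      by (subst poly_value_Suc[OF cc r]) (simp add: H0)
    then show ?case
      using cc r Hc by (simp add: poly_value_def lessThan_Suc_atMost a_comm del: nat_pow_Suc)
  next
    case (Suc k)
    define j where "j = n - k"
    have j: "Suc n - k = Suc j" "Suc n - Suc k = j" "k \<le> n"
      using Suc.prems by (auto simp: j_def)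
    have "(\<Oplus>i\<in>{..<Suc j}. c i \<otimes> r [^] i) = c j \<otimes> r [^] j \<oplus> (\<Oplus>i\<in>{..<j}. c i \<otimes> r [^] i)"
      unfolding lessThan_Suc using cc r by (subst finsum_insert) auto
    moreover have s: "(\<Oplus>i\<in>{..<j}. c i \<otimes> r [^] i) \<in> carrier R"
      using cc r by auto
    moreover have "H k \<otimes> r [^] Suc j \<oplus> (\<Oplus>i\<in>{..<Suc j}. c i \<otimes> r [^] i) = poly_value (Suc n) c r"
      using Suc.IH j by simp
    ultimately show ?case
      using horner_step[OF r Hc cc _ s, of "r [^] j" j k] r
      unfolding j HS j_def[symmetric] by simp
  qed
  have "H (Suc n) = \<zero>"
    using Hsum[of "Suc n"] root Hc[of "Suc n"] by simp
  then have last: "c 0 \<oplus> r \<otimes> H n = \<zero>"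
    by (simp add: HS)
  define h where "h = (\<lambda>i. if i \<le> n then H (n - i) else \<zero>)"
  have hc: "poly_coeffs n h"
    using c Hc H0 by (auto simp: poly_coeffs_def h_def)
  have "c i = times_root r h i" for i
  proof (cases i)
    case 0
    have "c 0 = \<zero> \<ominus> r \<otimes> H n"
      using minus_equality[OF last] cc[of 0] r Hc[of n] by (simp add: a_minus_def)
    then show ?thesis using 0 by (simp add: times_root_def h_def)
  next
    case (Suc j)
    consider "j < n" | "j = n" | "j > n" by linarith
    then show ?thesis
    proof cases
      case 1
      have "H (n - j) = c (Suc j) \<oplus> r \<otimes> H (n - Suc j)"
        using HS[of "n - Suc j"] 1 by (simp add: Suc_diff_Suc)
      then show ?thesis
        using 1 Suc add_minus_self[OF cc, of "r \<otimes> H (n - Suc j)" "Suc j"] r Hc[of "n - Suc j"]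
        by (simp add: times_root_def h_def)
    next
      case 2
      then show ?thesis
        using Suc H0 cc[of "Suc n"] r by (simp add: times_root_def h_def a_minus_def)
    next
      case 3
      then show ?thesis
        using Suc c r by (simp add: times_root_def h_def poly_coeffs_def a_minus_def)
    qed
  qed
  then show ?thesis
    using hc by blast
qed

text \<open>Splitting off the roots one at a time. The predicate \<open>Q\<close> records what is known about all the
  roots, and this knowledge is inherited by the quotient polynomials.\<close>

lemma (in algebraically_closed) roots_induct:
  assumes "poly_coeffs n c" "\<And>z. z \<in> carrier L \<Longrightarrow> poly_value n c z = \<zero> \<Longrightarrow> Q z"
    and const: "\<And>c. poly_coeffs 0 c \<Longrightarrow> P 0 c"
    and step: "\<And>n h r. poly_coeffs n h \<Longrightarrow> r \<in> carrier L \<Longrightarrow> Q r \<Longrightarrow> P n h \<Longrightarrow> P (Suc n) (times_root r h)"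
  shows "P n c"
  using assms(1,2)
proof (induction n arbitrary: c)
  case 0
  then show ?case by (simp add: const)
next
  case (Suc n)
  obtain r where r: "r \<in> carrier L" "poly_value (Suc n) c r = \<zero>"
    using exists_poly_root[OF Suc.prems(1)] by auto
  then obtain h where h: "poly_coeffs n h" "c = times_root r h"
    using exists_root_quotient[OF Suc.prems(1)] by blast
  have hc: "h i \<in> carrier L" "h (Suc n) = \<zero>" for i
    using h(1) by (auto simp: poly_coeffs_def)
  have "Q z" if z: "z \<in> carrier L" "poly_value n h z = \<zero>" for z
  proof (rule Suc.prems(2)[OF z(1)])
    show "poly_value (Suc n) c z = \<zero>"
      unfolding h(2) using z r(1) hc by (subst poly_value_times_root) auto
  qed
  then have "P n h"
    using Suc.IH[OF h(1)] by blast
  then show ?case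
    using step[OF h(1) r(1) Suc.prems(2)[OF r]] h(2) by simp
qed

section \<open>Norms of roots and coefficients\<close>

locale normed_carrier_field = field L for L (structure) +
  fixes nrm :: "'a \<Rightarrow> real"
  assumes norm: "field_norm L nrm"
begin

lemma nrm_nonneg: "x \<in> carrier L \<Longrightarrow> 0 \<le> nrm x"
  and nrm_eq_0: "x \<in> carrier L \<Longrightarrow> nrm x = 0 \<longleftrightarrow> x = \<zero>"
  and nrm_mult: "x \<in> carrier L \<Longrightarrow> y \<in> carrier L \<Longrightarrow> nrm (x \<otimes> y) = nrm x * nrm y"
  and nrm_add: "x \<in> carrier L \<Longrightarrow> y \<in> carrier L \<Longrightarrow> nrm (x \<oplus> y) \<le> nrm x + nrm y"
  using norm by (auto simp: field_norm_def)

lemma nrm_zero: "nrm \<zero> = 0"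
  by (simp add: nrm_eq_0)

lemma nrm_pos: "x \<in> carrier L \<Longrightarrow> x \<noteq> \<zero> \<Longrightarrow> 0 < nrm x"
  using nrm_nonneg[of x] nrm_eq_0[of x] by linarith

lemma nrm_one: "nrm \<one> = 1"
  using nrm_mult[of \<one> \<one>] nrm_pos[of \<one>] by simp

lemma nrm_minus: "x \<in> carrier L \<Longrightarrow> nrm (\<ominus> x) = nrm x"
proof -
  assume x: "x \<in> carrier L"
  have "nrm (\<ominus> x) * nrm (\<ominus> x) = nrm x * nrm x"
    using x nrm_mult[of "\<ominus> x" "\<ominus> x"] nrm_mult[of x x] by (simp add: l_minus r_minus)
  then show ?thesis
    using nrm_nonneg[of x] nrm_nonneg[of "\<ominus> x"] x by (simp add: square_eq_iff) force
qed

lemma nrm_nat_pow: "x \<in> carrier L \<Longrightarrow> nrm (x [^] (n::nat)) = nrm x ^ n"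
  by (induction n) (auto simp: nrm_one nrm_mult)

lemma nrm_inv: "x \<in> carrier L \<Longrightarrow> x \<noteq> \<zero> \<Longrightarrow> nrm (inv x) = inverse (nrm x)"
proof -
  assume x: "x \<in> carrier L" "x \<noteq> \<zero>"
  then have u: "x \<in> Units L" by (simp add: field_Units)
  have "nrm x * nrm (inv x) = 1"
    using x u nrm_mult[of x "inv x"] by (simp add: nrm_one)
  then show ?thesis
    by (metis inverse_unique)
qed

lemma nat_pow_nonzero: "x \<in> carrier L \<Longrightarrow> x \<noteq> \<zero> \<Longrightarrow> x [^] (n::nat) \<noteq> \<zero>"
  using nrm_nat_pow[of x n] nrm_pos[of x] by (metis nrm_zero power_not_zero less_irrefl)

lemma nrm_int_pow:
  assumes x: "x \<in> carrier L" "x \<noteq> \<zero>"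
  shows "nrm (x [^] (k::int)) = nrm x powi k"
proof (cases k rule: int_cases)
  case (nonneg n)
  then show ?thesis
    using x by (simp add: int_pow_int nrm_nat_pow)
next
  case (neg n)
  have "x [^] k = inv (x [^] Suc n)"
    unfolding neg int_pow_def2 by (simp del: of_nat_Suc nat_pow_Suc)
  then have "nrm (x [^] k) = inverse (nrm x ^ Suc n)"
    using nrm_inv[OF nat_pow_closed[OF x(1)] nat_pow_nonzero[OF x]] nrm_nat_pow[OF x(1)] by presburger
  then show ?thesis
    unfolding neg by (simp only: power_int_minus power_int_of_nat)
qed

lemma nrm_finsum_le:
  assumes "finite A" "g \<in> A \<rightarrow> carrier L"
  shows "nrm (\<Oplus>i\<in>A. g i) \<le> (\<Sum>i\<in>A. nrm (g i))"
  using assms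
proof (induction A rule: finite_induct)
  case empty
  then show ?case by (simp add: nrm_zero)
next
  case (insert a A)
  have "nrm (\<Oplus>i\<in>insert a A. g i) = nrm (g a \<oplus> (\<Oplus>i\<in>A. g i))"
    using insert by (subst finsum_insert) auto
  also have "\<dots> \<le> nrm (g a) + nrm (\<Oplus>i\<in>A. g i)"
    using insert.prems by (intro nrm_add) auto
  also have "\<dots> \<le> nrm (g a) + (\<Sum>i\<in>A. nrm (g i))"
    using insert by auto
  finally show ?case
    using insert.hyps by simp
qed

lemma nrm_finprod:
  assumes "finite A" "g \<in> A \<rightarrow> carrier L"
  shows "nrm (\<Otimes>i\<in>A. g i) = (\<Prod>i\<in>A. nrm (g i))"
  using assms
proof (induction A rule: finite_induct)
  case empty
  then show ?case by (simp add: nrm_one)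
next
  case (insert a A)
  have "nrm (\<Otimes>i\<in>insert a A. g i) = nrm (g a \<otimes> (\<Otimes>i\<in>A. g i))"
    using insert by (subst finprod_insert) auto
  then show ?case
    using insert by (simp add: nrm_mult finprod_closed)
qed

end

locale closed_normed_field = normed_carrier_field + algebraically_closed
begin

text \<open>Up to sign the constant coefficient is the leading one times the product of the roots.\<close>

lemma constant_le_leading:
  assumes "poly_coeffs n c"
    and "\<And>z. z \<in> carrier L \<Longrightarrow> poly_value n c z = \<zero> \<Longrightarrow> nrm z \<le> 1"
  shows "nrm (c 0) \<le> nrm (c n)"
proof (rule roots_induct[OF assms, where P = "\<lambda>n c. nrm (c 0) \<le> nrm (c n)"])
  fix n h r
  assume times_root: "poly_coeffs n h" "r \<in> carrier L" "nrm r \<le> 1" "nrm (h 0) \<le> nrm (h n)"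
  have h: "h i \<in> carrier L" "h (Suc n) = \<zero>" for i
    using times_root(1) by (auto simp: poly_coeffs_def)
  have "nrm (times_root r h 0) = nrm r * nrm (h 0)"
    using times_root(2) h by (simp add: times_root_def a_minus_def nrm_minus nrm_mult)
  also have "\<dots> \<le> 1 * nrm (h 0)"
    using times_root(3) h by (intro mult_right_mono nrm_nonneg)
  also have "\<dots> \<le> nrm (times_root r h (Suc n))"
    using times_root(2,4) h by (simp add: times_root_def a_minus_def)
  finally show "nrm (times_root r h 0) \<le> nrm (times_root r h (Suc n))" .
qed auto

definition ultrametric :: bool where
  "ultrametric \<longleftrightarrow> (\<forall>x\<in>carrier L. \<forall>y\<in>carrier L. nrm (x \<oplus> y) \<le> max (nrm x) (nrm y))"

text \<open>The binomial theorem; multiplication by \<open>y + 1\<close> is multiplication by \<open>z - r\<close> at \<open>z = y\<close>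
  for the root \<open>r = -1\<close>, and on coefficients this is the recursion of Pascal's triangle.\<close>

lemma one_plus_power:
  assumes y: "y \<in> carrier L"
  shows "(y \<oplus> \<one>) [^] n = poly_value n (\<lambda>i. [(n choose i)] \<cdot> \<one>) y"
proof (induction n)
  case 0
  then show ?case using y by (simp add: poly_value_0)
next
  case (Suc n)
  let ?h = "\<lambda>n i. [(n choose i)] \<cdot> \<one>"
  have h: "?h n i \<in> carrier L" for n i
    by simp
  have shift: "times_root (\<ominus> \<one>) (?h n) = ?h (Suc n)"
  proof
    fix i show "times_root (\<ominus> \<one>) (?h n) i = ?h (Suc n) i"
      by (cases i) (auto simp: times_root_def a_minus_def l_minus add.nat_pow_mult add.commute)
  qed
  have "poly_value (Suc n) (times_root (\<ominus> \<one>) (?h n)) y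
      = (y \<ominus> (\<ominus> \<one>)) \<otimes> poly_value n (?h n) y"
    using y h poly_value_closed[of "?h n" y n]
    by (subst poly_value_times_root) (auto simp: a_minus_def binomial_eq_0)
  then have "poly_value (Suc n) (?h (Suc n)) y = (y \<oplus> \<one>) \<otimes> (y \<oplus> \<one>) [^] n"
    using y by (simp add: shift Suc.IH a_minus_def)
  then show ?case
    using y by (simp add: m_comm)
qed

lemma le_one_if_powers_le_linear:
  fixes a :: real
  assumes "\<And>n::nat. a ^ n \<le> real n + 1"
  shows "a \<le> 1"
proof (rule ccontr)
  assume "\<not> a \<le> 1"
  then have a: "a > 1" by simp
  have "(\<lambda>n. real n * (1/a) ^ n) \<longlonglongrightarrow> 0"
    using powser_times_n_limit_0[of "1/a"] a by simp
  moreover have "(\<lambda>n. (1/a) ^ n) \<longlonglongrightarrow> 0"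
    using a by (intro LIMSEQ_power_zero) auto
  ultimately have "(\<lambda>n. real n * (1/a) ^ n + (1/a) ^ n) \<longlonglongrightarrow> 0 + 0"
    by (rule tendsto_add)
  moreover have "real n * (1/a) ^ n + (1/a) ^ n \<ge> 1" for n
  proof -
    have "a ^ n * (1/a) ^ n \<le> (real n + 1) * (1/a) ^ n"
      using a by (intro mult_right_mono assms) auto
    moreover have "a ^ n * (1/a) ^ n = 1"
      using a by (simp add: power_divide)
    ultimately show ?thesis
      by (simp add: algebra_simps)
  qed
  ultimately have "1 \<le> 0 + (0::real)"
    using LIMSEQ_le_const by blast
  then show False by simp
qed

text \<open>For \<open>|y| \<le> 1\<close> the binomial theorem bounds \<open>|y + 1|^n\<close> by \<open>n + 1\<close>. Since this grows only
  linearly in \<open>n\<close>, already \<open>|y + 1| \<le> 1\<close>, which is the ultrametric inequality up to scaling.\<close>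

lemma ultrametric_if_integers_bounded:
  assumes int: "\<And>m::nat. nrm ([m] \<cdot> \<one>) \<le> 1"
  shows ultrametric
proof -
  have one: "nrm (y \<oplus> \<one>) \<le> 1" if y: "y \<in> carrier L" "nrm y \<le> 1" for y
  proof (rule le_one_if_powers_le_linear)
    fix n
    have "nrm (y \<oplus> \<one>) ^ n = nrm ((y \<oplus> \<one>) [^] n)"
      using y by (simp add: nrm_nat_pow)
    also have "\<dots> \<le> (\<Sum>i\<le>n. nrm ([(n choose i)] \<cdot> \<one> \<otimes> y [^] i))"
      unfolding one_plus_power[OF y(1)] poly_value_def using y by (intro nrm_finsum_le) auto
    also have "\<dots> \<le> (\<Sum>i\<le>n. 1)"
    proof (rule sum_mono)
      fix i
      have "nrm ([(n choose i)] \<cdot> \<one>) * nrm y ^ i \<le> 1 * 1"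
        using y nrm_nonneg[of y] by (intro mult_mono int power_le_one) auto
      then show "nrm ([(n choose i)] \<cdot> \<one> \<otimes> y [^] i) \<le> 1"
        using y by (simp add: nrm_mult nrm_nat_pow)
    qed
    finally show "nrm (y \<oplus> \<one>) ^ n \<le> real n + 1"
      by simp
  qed
  have le: "nrm (x \<oplus> y) \<le> nrm y" if xy: "x \<in> carrier L" "y \<in> carrier L" "nrm x \<le> nrm y" for x y
  proof (cases "y = \<zero>")
    case True
    then show ?thesis
      using xy nrm_eq_0[of x] nrm_nonneg[of x] by (auto simp: nrm_zero)
  next
    case False
    have i: "inv y \<in> carrier L" "inv y \<otimes> y = \<one>"
      using False xy by (auto simp: field_Units)
    have "x \<otimes> inv y \<otimes> y = x"
      using i xy by (simp add: m_assoc)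
    then have "x \<oplus> y = (x \<otimes> inv y \<oplus> \<one>) \<otimes> y"
      using i xy by (simp add: l_distr)
    moreover have "nrm (x \<otimes> inv y) \<le> 1"
      using False xy i nrm_pos[of y] by (simp add: nrm_mult nrm_inv field_simps)
    ultimately show ?thesis
      using one[of "x \<otimes> inv y"] i xy nrm_nonneg[of y]
      by (simp add: nrm_mult mult_left_le_one_le nrm_nonneg)
  qed
  show ?thesis
    unfolding ultrametric_def
  proof (intro ballI)
    fix x y assume "x \<in> carrier L" "y \<in> carrier L"
    then show "nrm (x \<oplus> y) \<le> max (nrm x) (nrm y)"
      using le[of x y] le[of y x] by (cases "nrm x \<le> nrm y") (auto simp: a_comm)
  qed
qed

lemma ultrametric_minus_le:
  assumes ultrametric "x \<in> carrier L" "y \<in> carrier L" "nrm x \<le> B" "nrm y \<le> B"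
  shows "nrm (x \<ominus> y) \<le> B"
  using assms unfolding ultrametric_def a_minus_def
  by (smt (verit) a_inv_closed nrm_minus)

lemma ultrametric_minus_eq:
  assumes u: ultrametric and xy: "x \<in> carrier L" "y \<in> carrier L" "nrm y < nrm x"
  shows "nrm (x \<ominus> y) = nrm x"
proof (rule antisym)
  show "nrm (x \<ominus> y) \<le> nrm x"
    using u xy by (intro ultrametric_minus_le) auto
  have "nrm ((x \<ominus> y) \<oplus> y) \<le> max (nrm (x \<ominus> y)) (nrm y)"
    using u xy by (auto simp: ultrametric_def)
  moreover have "(x \<ominus> y) \<oplus> y = x"
    using xy by algebra
  ultimately show "nrm x \<le> nrm (x \<ominus> y)"
    using xy(3) by auto
qed

text \<open>This is the Newton polygon in the quantitative form needed later: if no root has norm near one, then the polygon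
  has no break near slope zero, so a single coefficient dominates. A factor \<open>z - r\<close> with
  \<open>|r|\<close> small moves the dominant coefficient up by one degree, and one with \<open>|r|\<close> large keeps
  its position; the dominance factor \<open>exp (-\<delta>)\<close> is preserved in both cases.\<close>

lemma ultrametric_dominant_coefficient:
  assumes u: ultrametric and c: "poly_coeffs n c" and d: "\<delta> > 0"
    and roots: "\<And>z. z \<in> carrier L \<Longrightarrow> poly_value n c z = \<zero> \<Longrightarrow> nrm z < exp (-\<delta>) \<or> exp \<delta> < nrm z"
  shows "\<exists>j. c j \<noteq> \<zero> \<and> (\<forall>i. i \<noteq> j \<longrightarrow> nrm (c i) \<le> exp (-\<delta>) * nrm (c j))" (is "?D c")
proof (rule roots_induct[OF c roots, where P = "\<lambda>n. ?D"])
  fix c assume "poly_coeffs 0 c"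
  then show "?D c"
    by (intro exI[of _ 0]) (auto simp: poly_coeffs_def nrm_zero nrm_nonneg)
next
  fix n h r
  assume times_root: "poly_coeffs n h" "r \<in> carrier L" "nrm r < exp (-\<delta>) \<or> exp \<delta> < nrm r" "?D h"
  have h: "h i \<in> carrier L" for i
    using times_root(1) by (auto simp: poly_coeffs_def)
  obtain j where j: "h j \<noteq> \<zero>" "\<And>i. i \<noteq> j \<Longrightarrow> nrm (h i) \<le> exp (-\<delta>) * nrm (h j)"
    using times_root(4) by blast
  let ?s = "\<lambda>i. case i of 0 \<Rightarrow> \<zero> | Suc k \<Rightarrow> h k"
  have s: "?s i \<in> carrier L" for i
    using h by (auto split: nat.split)
  have pos: "nrm (h j) > 0"
    using j h by (intro nrm_pos) auto
  have e1: "exp (-\<delta>) < 1"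
    using d by simp
  have rc: "r \<in> carrier L" by (fact times_root(2))
  have rh: "nrm (r \<otimes> h i) = nrm r * nrm (h i)" for i
    using rc h by (simp add: nrm_mult)
  have rn: "0 \<le> nrm r" using rc by (rule nrm_nonneg)
  from times_root(3) show "?D (times_root r h)"
  proof
    assume small: "nrm r < exp (-\<delta>)"
    have rj: "nrm r * nrm (h i) \<le> exp (-\<delta>) * nrm (h j)" for i
    proof (cases "i = j")
      case False
      have "nrm r \<le> 1"
        using small e1 by linarith
      then have "nrm r * nrm (h i) \<le> 1 * (exp (-\<delta>) * nrm (h j))"
        using False j(2)[of i] rn h by (intro mult_mono) (auto simp: nrm_nonneg)
      then show ?thesis by simp
    qed (use small pos in auto)
    have "nrm (r \<otimes> h (Suc j)) < nrm (h j)"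
      using rj[of "Suc j"] e1 pos unfolding rh by (smt (verit) mult_less_cancel_right2)
    then have top: "nrm (times_root r h (Suc j)) = nrm (h j)"
      using rc h by (simp add: times_root_def ultrametric_minus_eq[OF u])
    show "?D (times_root r h)"
    proof (intro exI[of _ "Suc j"] conjI allI impI)
      show "times_root r h (Suc j) \<noteq> \<zero>"
        using top pos by (auto simp: nrm_zero)
      fix i assume "i \<noteq> Suc j"
      then have "nrm (?s i) \<le> exp (-\<delta>) * nrm (h j)"
        using j(2)[of "i - 1"] pos by (cases i) (auto simp: nrm_zero)
      then show "nrm (times_root r h i) \<le> exp (-\<delta>) * nrm (times_root r h (Suc j))"
        unfolding top using rj[of i] rc h s
        by (simp add: times_root_def ultrametric_minus_le[OF u] rh)
    qed
  next
    assume large: "exp \<delta> < nrm r"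
    have inv: "exp (-\<delta>) * nrm r > 1"
      using large by (simp add: exp_minus field_simps)
    have sj: "nrm (?s i) \<le> nrm (h j)" for i
    proof (cases i)
      case (Suc k)
      have "exp (-\<delta>) * nrm (h j) \<le> nrm (h j)"
        using e1 pos by (smt (verit) mult_less_cancel_right2)
      then show ?thesis
        using Suc j(2)[of k] by (cases "k = j") auto
    qed (use pos in \<open>auto simp: nrm_zero\<close>)
    have r1: "nrm r > 1"
      using large d by (smt (verit) one_less_exp_iff)
    then have lt: "nrm (h j) < nrm r * nrm (h j)"
      using pos by simp
    have "nrm (?s j) < nrm (r \<otimes> h j)"
      unfolding rh using sj[of j] lt by linarith
    then have "nrm (r \<otimes> h j \<ominus> ?s j) = nrm r * nrm (h j)"
      using ultrametric_minus_eq[OF u, of "r \<otimes> h j" "?s j"] rc h s by (simp add: rh)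
    moreover have "r \<otimes> h j \<ominus> ?s j = \<ominus> (?s j \<ominus> r \<otimes> h j)"
      using rc h s[of j] by (simp add: a_minus_def minus_add a_comm)
    ultimately have top: "nrm (times_root r h j) = nrm r * nrm (h j)"
      using rc h s[of j] by (simp add: times_root_def nrm_minus)
    show "?D (times_root r h)"
    proof (intro exI[of _ j] conjI allI impI)
      show "times_root r h j \<noteq> \<zero>"
        using top pos r1 by (auto simp: nrm_zero)
      fix i assume i: "i \<noteq> j"
      have "nrm (?s i) \<le> exp (-\<delta>) * (nrm r * nrm (h j))"
      proof -
        have "1 * nrm (h j) \<le> (exp (-\<delta>) * nrm r) * nrm (h j)"
          using inv pos by (intro mult_right_mono) auto
        then show ?thesis using sj[of i] by (simp add: mult.assoc)
      qed
      moreover have "nrm r * nrm (h i) \<le> nrm r * (exp (-\<delta>) * nrm (h j))"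
        using j(2)[OF i] rn by (rule mult_left_mono)
      then have "nrm r * nrm (h i) \<le> exp (-\<delta>) * (nrm r * nrm (h j))"
        by (simp add: mult.left_commute)
      ultimately show "nrm (times_root r h i) \<le> exp (-\<delta>) * nrm (times_root r h j)"
        unfolding top using rc h s
        by (simp add: times_root_def ultrametric_minus_le[OF u] rh)
    qed
  qed
qed auto

lemma exists_square_root:
  assumes "x \<in> carrier L"
  shows "\<exists>y\<in>carrier L. nrm y ^ 2 = nrm x"
proof -
  define c where "c = (\<lambda>i::nat. if i = 0 then \<ominus> x else if i = 2 then \<one> else \<zero>)"
  have c: "poly_coeffs 2 c"
    using assms by (auto simp: c_def poly_coeffs_def)
  obtain y where y: "y \<in> carrier L" "poly_value 2 c y = \<zero>"
    using exists_poly_root[OF c] by auto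
  have cc: "c i \<in> carrier L" for i
    using c by (simp add: poly_coeffs_def)
  have "poly_value (Suc 1) c y = c 0 \<oplus> c 1 \<otimes> y [^] (1::nat) \<oplus> c 2 \<otimes> y [^] (2::nat)"
    unfolding One_nat_def poly_value_Suc[OF cc y(1)] poly_value_0[OF cc y(1)] by (simp only: numeral_2_eq_2)
  then have "poly_value 2 c y = \<ominus> x \<oplus> y [^] (2::nat)"
    using y(1) assms by (simp add: c_def numeral_2_eq_2)
  then have "x = y [^] (2::nat)"
    using y assms by (metis a_inv_closed add.inv_equality add.inv_inv add.m_comm nat_pow_closed minus_equality)
  then show ?thesis
    using y(1) by (auto simp: nrm_nat_pow intro!: bexI[of _ y])
qed

text \<open>Iterated square roots bring the norm of an element arbitrarily close to one. Hence the values of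
  \<open>ln |x|\<close> are dense in the real line.\<close>

lemma exists_small_log:
  assumes "x \<in> carrier L" "nrm x > 1" "\<epsilon> > 0"
  shows "\<exists>y\<in>carrier L. nrm y > 1 \<and> ln (nrm y) < \<epsilon>"
proof -
  have *: "\<exists>y\<in>carrier L. nrm y > 1 \<and> ln (nrm y) = ln (nrm x) / 2 ^ m" for m
  proof (induction m)
    case 0
    then show ?case using assms by auto
  next
    case (Suc m)
    then obtain y where y: "y \<in> carrier L" "nrm y > 1" "ln (nrm y) = ln (nrm x) / 2 ^ m" by blast
    obtain z where z: "z \<in> carrier L" "nrm z ^ 2 = nrm y"
      using exists_square_root[OF y(1)] by blast
    have z1: "nrm z > 1"
      using z y(2) nrm_nonneg[OF z(1)] by (smt (verit) power_le_one)
    then have "2 * ln (nrm z) = ln (nrm y)"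
      using z(2) by (metis ln_realpow of_nat_numeral less_trans zero_less_one)
    then show ?case
      using z z1 y(3) by (intro bexI[of _ z]) auto
  qed
  have "(\<lambda>m. ln (nrm x) * (1/2) ^ m) \<longlonglongrightarrow> ln (nrm x) * 0"
    by (intro tendsto_intros LIMSEQ_power_zero) auto
  then have "\<forall>\<^sub>F m in sequentially. ln (nrm x) * (1/2) ^ m < \<epsilon>"
    using assms(3) by (intro order_tendstoD) auto
  then obtain m where "ln (nrm x) * (1/2) ^ m < \<epsilon>"
    using eventually_happens'[OF sequentially_bot] by blast
  then have "ln (nrm x) / 2 ^ m < \<epsilon>"
    by (simp add: power_divide)
  then show ?thesis
    using *[of m] by metis
qed

end

section \<open>Laurent monomials\<close>

lemma (in field) int_pow_mult_of:
  "x \<in> carrier R \<Longrightarrow> x \<noteq> \<zero> \<Longrightarrow> x [^]\<^bsub>Multiplicative_Group.mult_of R\<^esub> (k::int) = x [^] k"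
proof -
  assume x: "x \<in> carrier R" "x \<noteq> \<zero>"
  interpret M: group "Multiplicative_Group.mult_of R" by (rule field_mult_group)
  have n: "x [^] n \<in> carrier (Multiplicative_Group.mult_of R)" for n :: nat
    using M.nat_pow_closed[of x n] x by (simp add: Multiplicative_Group.nat_pow_mult_of)
  show ?thesis
    unfolding int_pow_def2 Multiplicative_Group.nat_pow_mult_of m_inv_mult_of[OF n] ..
qed

lemma (in field) int_pow_in_torus:
  assumes "x \<in> carrier R - {\<zero>}"
  shows "x [^] (k::int) \<in> carrier R - {\<zero>}"
proof -
  interpret M: group "Multiplicative_Group.mult_of R" by (rule field_mult_group)
  have "x [^]\<^bsub>Multiplicative_Group.mult_of R\<^esub> k \<in> carrier (Multiplicative_Group.mult_of R)"
    using assms by (intro M.int_pow_closed) simp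
  then show ?thesis
    using assms by (simp add: int_pow_mult_of)
qed

lemma (in field) int_pow_add:
  assumes "x \<in> carrier R - {\<zero>}"
  shows "x [^] (k + l :: int) = x [^] k \<otimes> x [^] l"
proof -
  interpret M: group "Multiplicative_Group.mult_of R" by (rule field_mult_group)
  show ?thesis
    using M.int_pow_mult[of x k l] assms by (simp add: int_pow_mult_of)
qed

lemma (in field) int_pow_int_pow:
  assumes "x \<in> carrier R - {\<zero>}"
  shows "(x [^] (k :: int)) [^] (l :: int) = x [^] (k * l)"
proof -
  interpret M: group "Multiplicative_Group.mult_of R" by (rule field_mult_group)
  show ?thesis
    using M.int_pow_pow[of x k l] int_pow_in_torus[OF assms, of k] assms by (simp add: int_pow_mult_of)
qed

lemma (in field) int_pow_mult_distrib_torus: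
  assumes "x \<in> carrier R - {\<zero>}" "y \<in> carrier R - {\<zero>}"
  shows "(x \<otimes> y) [^] (k :: int) = x [^] k \<otimes> y [^] k"
proof -
  interpret M: group "Multiplicative_Group.mult_of R" by (rule field_mult_group)
  show ?thesis
    using M.int_pow_mult_distrib[of x y k] assms integral_iff[of x y]
    by (simp add: int_pow_mult_of m_comm)
qed

lemma (in field) finprod_int_pow:
  assumes "x \<in> carrier R - {\<zero>}" "finite A"
  shows "(\<Otimes>i\<in>A. x [^] (k i :: int)) = x [^] (\<Sum>i\<in>A. k i)"
  using assms(2)
proof (induction A rule: finite_induct)
  case (insert a A)
  then show ?case
    using int_pow_in_torus[OF assms(1)] int_pow_add[OF assms(1)] by (subst finprod_insert) auto
qed simp

definition torus :: "('l, 'm) ring_scheme \<Rightarrow> ('d \<Rightarrow> 'l) set" where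
  "torus L = {a. \<forall>i. a i \<in> carrier L - {\<zero>\<^bsub>L\<^esub>}}"

definition torus_monomial :: "('l, 'm) ring_scheme \<Rightarrow> ('d::finite \<Rightarrow> 'l) \<Rightarrow> int ^ 'd \<Rightarrow> 'l" where
  "torus_monomial L a \<alpha> = (\<Otimes>\<^bsub>L\<^esub>i\<in>UNIV. a i [^]\<^bsub>L\<^esub> (\<alpha> $ i))"

definition int_dot :: "int ^ 'd::finite \<Rightarrow> int ^ 'd \<Rightarrow> int" where
  "int_dot \<alpha> W = (\<Sum>i\<in>UNIV. \<alpha> $ i * W $ i)"

definition real_vec :: "int ^ 'd::finite \<Rightarrow> real ^ 'd" where
  "real_vec \<alpha> = (\<chi> i. of_int (\<alpha> $ i))"

lemma inner_real_vec: "real_vec \<alpha> \<bullet> real_vec W = of_int (int_dot \<alpha> W)"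
  by (simp add: real_vec_def int_dot_def inner_vec_def)

text \<open>The point with parameter \<open>r\<close> on the translate by \<open>a\<close> of the one-parameter subgroup with
  direction \<open>W\<close>.\<close>

definition move_along :: "('l, 'm) ring_scheme \<Rightarrow> ('d::finite \<Rightarrow> 'l) \<Rightarrow> int ^ 'd \<Rightarrow> 'l \<Rightarrow> 'd \<Rightarrow> 'l" where
  "move_along L a W r = (\<lambda>i. a i \<otimes>\<^bsub>L\<^esub> r [^]\<^bsub>L\<^esub> (W $ i))"

lemma (in field) move_along_in_torus:
  assumes "a \<in> torus R" "r \<in> carrier R - {\<zero>}"
  shows "move_along R a W r \<in> torus R"
  using assms(1) int_pow_in_torus[OF assms(2)] integral by (fastforce simp: torus_def move_along_def)

lemma (in field) torus_monomial_closed: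
  "a \<in> torus R \<Longrightarrow> torus_monomial R a \<alpha> \<in> carrier R"
  unfolding torus_monomial_def torus_def using int_pow_in_torus by (intro finprod_closed) auto

lemma (in field) torus_monomial_move_along:
  assumes a: "a \<in> torus R" and r: "r \<in> carrier R - {\<zero>}"
  shows "torus_monomial R (move_along R a W r) \<alpha> = torus_monomial R a \<alpha> \<otimes> r [^] int_dot \<alpha> W"
proof -
  have ai: "a i \<in> carrier R - {\<zero>}" for i
    using a by (simp add: torus_def)
  have p: "a i [^] k \<in> carrier R" "r [^] k \<in> carrier R" for i and k :: int
    using int_pow_in_torus[OF ai] int_pow_in_torus[OF r] by auto
  have "torus_monomial R (move_along R a W r) \<alpha>
      = (\<Otimes>i\<in>UNIV. a i [^] (\<alpha> $ i) \<otimes> r [^] (\<alpha> $ i * W $ i))"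
    unfolding torus_monomial_def move_along_def
    using p by (intro finprod_cong')
      (auto simp: int_pow_mult_distrib_torus[OF ai int_pow_in_torus[OF r]] int_pow_int_pow[OF r] mult.commute)
  also have "\<dots> = (\<Otimes>i\<in>UNIV. a i [^] (\<alpha> $ i)) \<otimes> (\<Otimes>i\<in>UNIV. r [^] (\<alpha> $ i * W $ i))"
    using p by (intro finprod_multf) auto
  also have "(\<Otimes>i\<in>UNIV. r [^] (\<alpha> $ i * W $ i)) = r [^] int_dot \<alpha> W"
    using r by (simp add: finprod_int_pow int_dot_def)
  finally show ?thesis
    by (simp add: torus_monomial_def)
qed

definition log_abs :: "('l \<Rightarrow> real) \<Rightarrow> ('d::finite \<Rightarrow> 'l) \<Rightarrow> real ^ 'd" where
  "log_abs nrm a = (\<chi> i. ln (nrm (a i)))"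

context normed_carrier_field
begin

lemma nrm_torus_monomial:
  assumes a: "a \<in> torus L"
  shows "nrm (torus_monomial L a \<alpha>) = exp (real_vec \<alpha> \<bullet> log_abs nrm a)"
proof -
  have ai: "a i \<in> carrier L - {\<zero>}" for i
    using a by (simp add: torus_def)
  have pos: "nrm (a i) > 0" for i
    using ai[of i] nrm_pos[of "a i"] by auto
  have "nrm (torus_monomial L a \<alpha>) = (\<Prod>i\<in>UNIV. nrm (a i [^] (\<alpha> $ i)))"
    unfolding torus_monomial_def using int_pow_in_torus[OF ai] by (intro nrm_finprod) auto
  also have "\<dots> = (\<Prod>i\<in>UNIV. exp (of_int (\<alpha> $ i) * ln (nrm (a i))))"
  proof (rule prod.cong)
    fix i
    have "nrm (a i [^] (\<alpha> $ i)) = nrm (a i) powi (\<alpha> $ i)"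
      using ai[of i] by (intro nrm_int_pow) auto
    also have "\<dots> = nrm (a i) powr of_int (\<alpha> $ i)"
      using pos[of i] by (simp add: powr_real_of_int')
    also have "\<dots> = exp (of_int (\<alpha> $ i) * ln (nrm (a i)))"
      using pos[of i] by (simp add: powr_def)
    finally show "nrm (a i [^] (\<alpha> $ i)) = exp (of_int (\<alpha> $ i) * ln (nrm (a i)))" .
  qed simp
  also have "\<dots> = exp (real_vec \<alpha> \<bullet> log_abs nrm a)"
    by (simp add: exp_sum inner_vec_def real_vec_def log_abs_def)
  finally show ?thesis .
qed

lemma log_abs_move_along:
  assumes a: "a \<in> torus L" and r: "r \<in> carrier L - {\<zero>}"
  shows "log_abs nrm (move_along L a W r) = log_abs nrm a + ln (nrm r) *\<^sub>R real_vec W"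
proof -
  have ai: "a i \<in> carrier L - {\<zero>}" for i
    using a by (simp add: torus_def)
  have pos: "nrm (a i) > 0" "nrm r > 0" for i
    using ai[of i] r nrm_pos by auto
  have "ln (nrm (a i \<otimes> r [^] (W $ i))) = ln (nrm (a i)) + of_int (W $ i) * ln (nrm r)" for i
  proof -
    have "nrm (a i \<otimes> r [^] (W $ i)) = nrm (a i) * nrm r powi (W $ i)"
      using ai[of i] r int_pow_in_torus[OF r] by (simp add: nrm_mult nrm_int_pow)
    also have "nrm r powi (W $ i) = nrm r powr of_int (W $ i)"
      using pos(2) by (simp add: powr_real_of_int')
    finally show ?thesis
      using pos(1)[of i] pos(2) by (simp add: ln_mult ln_powr)
  qed
  then show ?thesis
    by (simp add: vec_eq_iff log_abs_def move_along_def real_vec_def mult.commute)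
qed

end

context closed_normed_field
begin

text \<open>Each coordinate of \<open>u\<close> is approximated by an integral multiple of one small number
  \<open>ln |y|\<close>, and the corresponding power of \<open>y\<close> realises it.\<close>

lemma exists_log_abs_near:
  fixes u :: "real ^ 'd::finite"
  assumes nontrivial: "\<exists>x\<in>carrier L. nrm x > 1" and e: "\<epsilon> > 0"
  shows "\<exists>a\<in>torus L. norm (log_abs nrm a - u) < \<epsilon>"
proof -
  have "\<epsilon> / CARD('d) > 0" using e by simp
  then obtain y where y: "y \<in> carrier L" "nrm y > 1" "ln (nrm y) < \<epsilon> / CARD('d)"
    using nontrivial exists_small_log by blast
  define h where "h = ln (nrm y)"
  have h: "h > 0" "h < \<epsilon> / CARD('d)" using y by (auto simp: h_def)
  have yt: "y \<in> carrier L - {\<zero>}"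
    using y nrm_zero by auto
  define a :: "'d \<Rightarrow> 'a" where "a = (\<lambda>i. y [^] \<lfloor>u $ i / h\<rfloor>)"
  have a: "a \<in> torus L"
    using int_pow_in_torus[OF yt] by (auto simp: torus_def a_def)
  have comp: "\<bar>(log_abs nrm a - u) $ i\<bar> \<le> h" for i
  proof -
    have "nrm (a i) = nrm y powr of_int \<lfloor>u $ i / h\<rfloor>"
      using yt y(2) by (simp add: a_def nrm_int_pow powr_real_of_int')
    then have "ln (nrm (a i)) = of_int \<lfloor>u $ i / h\<rfloor> * h"
      using y(2) by (simp add: ln_powr h_def)
    moreover have "of_int \<lfloor>u $ i / h\<rfloor> * h \<le> u $ i / h * h" "(u $ i / h - 1) * h \<le> of_int \<lfloor>u $ i / h\<rfloor> * h"
      using h by (intro mult_right_mono; linarith)+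
    ultimately show ?thesis
      using h by (simp add: log_abs_def field_simps)
  qed
  have "norm (log_abs nrm a - u) \<le> (\<Sum>i\<in>UNIV. \<bar>(log_abs nrm a - u) $ i\<bar>)"
    by (rule norm_le_l1_cart)
  also have "\<dots> \<le> (\<Sum>i\<in>(UNIV::'d set). h)"
    by (intro sum_mono comp)
  also have "\<dots> < \<epsilon>"
    using h by (simp add: field_simps)
  finally show ?thesis
    using a by blast
qed

end

section \<open>Restricting a Laurent polynomial to a one-parameter coset\<close>

text \<open>This collects what the geometric part uses of a place: the norm on the algebraic closure of the
  completion, and the embedding of the global field.\<close>

locale place_extension = closed_normed_field L nrm for L (structure) and nrm +
  fixes emb :: "'f::field \<Rightarrow> 'a"
  assumes emb: "emb \<in> ring_hom ring_of_type_algebra L"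
    and nontrivial: "\<exists>x\<in>carrier L. nrm x > 1"
begin

lemma emb_closed: "emb x \<in> carrier L"
  and emb_mult: "emb (x * y) = emb x \<otimes> emb y"
  and emb_add: "emb (x + y) = emb x \<oplus> emb y"
  and emb_one: "emb 1 = \<one>"
  using emb by (auto simp: ring_hom_def ring_of_type_algebra_def)

lemma emb_zero: "emb 0 = \<zero>"
  using emb_add[of 0 0] emb_closed[of 0] by (metis add.l_cancel_one' add_0)

lemma emb_nonzero: "x \<noteq> 0 \<Longrightarrow> emb x \<noteq> \<zero>"
  using emb_mult[of x "1 / x"] emb_closed[of "1 / x"] by (auto simp: emb_one)

definition term_at :: "('f, 'd::finite) laurent_poly \<Rightarrow> ('d \<Rightarrow> 'a) \<Rightarrow> int ^ 'd \<Rightarrow> 'a" where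
  "term_at f a \<alpha> = emb (Poly_Mapping.lookup f \<alpha>) \<otimes> torus_monomial L a \<alpha>"

lemma term_at_closed: "a \<in> torus L \<Longrightarrow> term_at f a \<alpha> \<in> carrier L"
  by (simp add: term_at_def emb_closed torus_monomial_closed)

lemma nrm_term_at:
  "a \<in> torus L \<Longrightarrow> nrm (term_at f a \<alpha>)
    = nrm (emb (Poly_Mapping.lookup f \<alpha>)) * exp (real_vec \<alpha> \<bullet> log_abs nrm a)"
  by (simp add: term_at_def nrm_mult emb_closed torus_monomial_closed nrm_torus_monomial)

lemma term_at_nonzero:
  assumes "a \<in> torus L" "\<alpha> \<in> Poly_Mapping.keys f"
  shows "term_at f a \<alpha> \<noteq> \<zero>"
proof -
  have "nrm (emb (Poly_Mapping.lookup f \<alpha>)) > 0"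
    using assms(2) by (intro nrm_pos emb_closed emb_nonzero) (simp add: in_keys_iff)
  then have "nrm (term_at f a \<alpha>) \<noteq> 0"
    using assms(1) by (simp add: nrm_term_at)
  then show ?thesis
    by (auto simp: nrm_zero)
qed

lemma laurent_eval_eq: "laurent_eval L emb f a = (\<Oplus>\<alpha>\<in>Poly_Mapping.keys f. term_at f a \<alpha>)"
  by (simp add: laurent_eval_def term_at_def torus_monomial_def)

lemma hypersurface_points_eq:
  "hypersurface_points L emb f = {a \<in> torus L. (\<Oplus>\<alpha>\<in>Poly_Mapping.keys f. term_at f a \<alpha>) = \<zero>}"
  by (simp add: hypersurface_points_def torus_def laurent_eval_eq)

lemma amoeba_eq: "amoeba L nrm emb f = closure (log_abs nrm ` hypersurface_points L emb f)"
  by (simp add: amoeba_def log_abs_def)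

text \<open>Along the curve \<open>z \<mapsto> a z^W\<close> the Laurent polynomial \<open>f\<close> becomes, up to a power of
  \<open>z\<close>, an ordinary polynomial in \<open>z\<close>. When \<open>W\<close> separates the exponents of \<open>f\<close>, no two
  terms are merged, so the coefficients are the terms of \<open>f\<close> at \<open>a\<close>. Nonzero roots
  give points of the hypersurface whose logarithms lie on the line through \<open>Log a\<close> with
  direction \<open>W\<close>.\<close>

lemma restriction_to_coset:
  fixes f :: "('f, 'd::finite) laurent_poly"
  assumes a: "a \<in> torus L"
    and inj: "inj_on (\<lambda>\<alpha>. int_dot \<alpha> W) (Poly_Mapping.keys f)"
    and \<beta>: "\<beta> \<in> Poly_Mapping.keys f" "\<And>\<alpha>. \<alpha> \<in> Poly_Mapping.keys f \<Longrightarrow> int_dot \<beta> W \<le> int_dot \<alpha> W"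
    and \<gamma>: "\<gamma> \<in> Poly_Mapping.keys f" "\<And>\<alpha>. \<alpha> \<in> Poly_Mapping.keys f \<Longrightarrow> int_dot \<alpha> W \<le> int_dot \<gamma> W"
  defines "e \<equiv> \<lambda>\<alpha>. nat (int_dot \<alpha> W - int_dot \<beta> W)"
  shows "\<exists>c. poly_coeffs (e \<gamma>) c
     \<and> (\<forall>\<alpha>\<in>Poly_Mapping.keys f. c (e \<alpha>) = term_at f a \<alpha>)
     \<and> (\<forall>i. c i \<noteq> \<zero> \<longrightarrow> i \<in> e ` Poly_Mapping.keys f)
     \<and> (\<forall>r\<in>carrier L. r \<noteq> \<zero> \<longrightarrow> poly_value (e \<gamma>) c r = \<zero> \<longrightarrow>
          move_along L a W r \<in> hypersurface_points L emb f)"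
proof -
  let ?A = "Poly_Mapping.keys f"
  have inj_e: "inj_on e ?A"
  proof (rule inj_onI)
    fix \<alpha> \<alpha>' assume *: "\<alpha> \<in> ?A" "\<alpha>' \<in> ?A" "e \<alpha> = e \<alpha>'"
    then have "int_dot \<alpha> W = int_dot \<alpha>' W"
      using \<beta>(2)[of \<alpha>] \<beta>(2)[of \<alpha>'] by (simp add: e_def)
    then show "\<alpha> = \<alpha>'"
      using inj * by (simp add: inj_on_def)
  qed
  have e_le: "e \<alpha> \<le> e \<gamma>" if "\<alpha> \<in> ?A" for \<alpha>
    using \<gamma>(2)[OF that] by (simp add: e_def)
  define c where "c = (\<lambda>i. if i \<in> e ` ?A then term_at f a (the_inv_into ?A e i) else \<zero>)"
  have c_e: "c (e \<alpha>) = term_at f a \<alpha>" if "\<alpha> \<in> ?A" for \<alpha>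
    using that by (simp add: c_def the_inv_into_f_f[OF inj_e])
  have c: "c i \<in> carrier L" for i
    by (simp add: c_def term_at_closed[OF a])
  have pc: "poly_coeffs (e \<gamma>) c"
    unfolding poly_coeffs_def
  proof (intro conjI allI impI)
    show "c (e \<gamma>) \<noteq> \<zero>"
      using c_e[OF \<gamma>(1)] term_at_nonzero[OF a \<gamma>(1)] by simp
    fix i assume "e \<gamma> < i"
    then show "c i = \<zero>"
      using e_le by (fastforce simp: c_def)
  qed (rule c)
  have "move_along L a W r \<in> hypersurface_points L emb f"
    if r: "r \<in> carrier L" "r \<noteq> \<zero>" and root: "poly_value (e \<gamma>) c r = \<zero>" for r
  proof -
    have rt: "r \<in> carrier L - {\<zero>}" using r by simp
    have ip: "r [^] k \<in> carrier L" for k :: int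
      using int_pow_in_torus[OF rt] by simp
    let ?s = "int_dot \<beta> W"
    have "(\<Oplus>\<alpha>\<in>?A. term_at f (move_along L a W r) \<alpha>)
        = (\<Oplus>\<alpha>\<in>?A. r [^] ?s \<otimes> (c (e \<alpha>) \<otimes> r [^] e \<alpha>))"
    proof (rule finsum_cong')
      fix \<alpha> assume \<alpha>: "\<alpha> \<in> ?A"
      have "int_dot \<alpha> W = ?s + int (e \<alpha>)"
        using \<beta>(2)[OF \<alpha>] by (simp add: e_def)
      then have "r [^] int_dot \<alpha> W = r [^] ?s \<otimes> r [^] e \<alpha>"
        by (simp add: int_pow_add[OF rt] int_pow_int)
      then show "term_at f (move_along L a W r) \<alpha> = r [^] ?s \<otimes> (c (e \<alpha>) \<otimes> r [^] e \<alpha>)"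
        using ip[of ?s] r c_e[OF \<alpha>] torus_monomial_closed[OF a, of \<alpha>] emb_closed
        by (simp add: term_at_def torus_monomial_move_along[OF a rt] m_assoc m_lcomm)
    qed (use c r ip in auto)
    also have "\<dots> = r [^] ?s \<otimes> (\<Oplus>\<alpha>\<in>?A. c (e \<alpha>) \<otimes> r [^] e \<alpha>)"
      using c r ip by (intro finsum_rdistr[symmetric]) auto
    also have "(\<Oplus>\<alpha>\<in>?A. c (e \<alpha>) \<otimes> r [^] e \<alpha>) = (\<Oplus>i\<in>e ` ?A. c i \<otimes> r [^] i)"
      using c r inj_e by (intro finsum_reindex[symmetric]) auto
    also have "\<dots> = poly_value (e \<gamma>) c r"
      unfolding poly_value_def
      using c r e_le by (intro add.finprod_mono_neutral_cong_left) (auto simp: c_def)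
    finally show ?thesis
      using root ip move_along_in_torus[OF a rt] by (simp add: hypersurface_points_eq)
  qed
  moreover have "i \<in> e ` ?A" if "c i \<noteq> \<zero>" for i
    using that by (auto simp: c_def split: if_splits)
  ultimately show ?thesis
    using pc c_e by blast
qed

end

section \<open>Generic rational directions\<close>

lemma real_vec_inject: "real_vec \<alpha> = real_vec \<alpha>' \<longleftrightarrow> \<alpha> = \<alpha>'"
  by (simp add: real_vec_def vec_eq_iff)

lemma rational_vector_in_open:
  fixes U :: "(real ^ 'd::finite) set"
  assumes "open U" "x \<in> U"
  shows "\<exists>W q. q > 0 \<and> (1 / real q) *\<^sub>R real_vec W \<in> U"
proof -
  obtain \<epsilon> where e: "\<epsilon> > 0" "ball x \<epsilon> \<subseteq> U"
    using assms by (meson open_contains_ball)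
  obtain q :: nat where q: "CARD('d) / \<epsilon> < real q"
    using reals_Archimedean2 by blast
  have q0: "q > 0"
    using q e by (metis divide_nonneg_pos gr0I less_le_not_le of_nat_0 of_nat_0_le_iff)
  define W :: "int ^ 'd" where "W = (\<chi> i. \<lfloor>real q * x $ i\<rfloor>)"
  let ?w = "(1 / real q) *\<^sub>R real_vec W"
  have comp: "\<bar>(x - ?w) $ i\<bar> \<le> 1 / real q" for i
  proof -
    have "\<bar>real q * x $ i - of_int \<lfloor>real q * x $ i\<rfloor>\<bar> \<le> 1"
      by linarith
    then have "\<bar>real q * x $ i - of_int \<lfloor>real q * x $ i\<rfloor>\<bar> / real q \<le> 1 / real q"
      by (intro divide_right_mono) auto
    moreover have "(x - ?w) $ i = (real q * x $ i - of_int \<lfloor>real q * x $ i\<rfloor>) / real q"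
      using q0 by (simp add: real_vec_def W_def field_simps)
    ultimately show ?thesis by (simp add: abs_divide)
  qed
  have "norm (x - ?w) \<le> (\<Sum>i\<in>UNIV. \<bar>(x - ?w) $ i\<bar>)"
    by (rule norm_le_l1_cart)
  also have "\<dots> \<le> (\<Sum>i\<in>(UNIV::'d set). 1 / real q)"
    by (intro sum_mono comp)
  also have "\<dots> < \<epsilon>"
    using q q0 e by (simp add: field_simps)
  finally have "?w \<in> U"
    using e by (auto simp: dist_norm)
  then show ?thesis
    using q0 by blast
qed

text \<open>If \<open>x\<close> lies on the hyperplane orthogonal to \<open>d\<close>, a small step in the direction \<open>d\<close>
  leaves it.\<close>

lemma open_avoiding_hyperplanes:
  fixes U :: "'v::euclidean_space set"
  assumes "finite D" "0 \<notin> D" "open U" "U \<noteq> {}"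
  shows "\<exists>V\<subseteq>U. open V \<and> V \<noteq> {} \<and> (\<forall>x\<in>V. \<forall>d\<in>D. d \<bullet> x \<noteq> 0)"
  using assms(1,2)
proof (induction D rule: finite_induct)
  case empty
  then show ?case using assms by blast
next
  case (insert d D)
  then obtain V where V: "V \<subseteq> U" "open V" "V \<noteq> {}" "\<forall>x\<in>V. \<forall>d\<in>D. d \<bullet> x \<noteq> 0"
    by auto
  let ?V = "V \<inter> {x. d \<bullet> x \<noteq> 0}"
  have "open {x. d \<bullet> x \<noteq> 0}"
    by (intro open_Collect_neq continuous_intros)
  moreover have "?V \<noteq> {}"
  proof -
    obtain x where x: "x \<in> V" using V by blast
    show ?thesis
    proof (cases "d \<bullet> x = 0")
      case True
      obtain \<epsilon> where e: "\<epsilon> > 0" "ball x \<epsilon> \<subseteq> V"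
        using V x by (meson open_contains_ball)
      have d: "norm d > 0" using insert.prems by auto
      let ?y = "x + (\<epsilon> / (2 * norm d)) *\<^sub>R d"
      have "dist x ?y < \<epsilon>"
        using e d by (simp add: dist_norm)
      then have "?y \<in> V" using e by auto
      moreover have "d \<bullet> ?y \<noteq> 0"
        using True d e by (simp add: inner_add_right)
      ultimately show ?thesis by blast
    qed (use x in blast)
  qed
  ultimately show ?case
    using V by (intro exI[of _ ?V]) auto
qed

text \<open>Two exponents have the same product with \<open>W\<close> exactly if their difference is
  orthogonal to \<open>W\<close>, so it suffices to avoid finitely many hyperplanes.\<close>

lemma generic_direction_in_open:
  fixes U :: "(real ^ 'd::finite) set"
  assumes "finite A" "open U" "U \<noteq> {}"
  shows "\<exists>W q. q > 0 \<and> (1 / real q) *\<^sub>R real_vec W \<in> U \<and> inj_on (\<lambda>\<alpha>. int_dot \<alpha> W) A"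
proof -
  define D where "D = (\<lambda>(\<alpha>, \<alpha>'). real_vec \<alpha> - real_vec \<alpha>') ` {(\<alpha>, \<alpha>'). \<alpha> \<in> A \<and> \<alpha>' \<in> A \<and> \<alpha> \<noteq> \<alpha>'}"
  have "finite {(\<alpha>, \<alpha>'). \<alpha> \<in> A \<and> \<alpha>' \<in> A \<and> \<alpha> \<noteq> \<alpha>'}"
    by (rule finite_subset[of _ "A \<times> A"]) (use assms in auto)
  then have fin: "finite D" by (simp add: D_def)
  have no_zero: "0 \<notin> D"
  proof
    assume "0 \<in> D"
    then obtain \<alpha> \<alpha>' :: "int ^ 'd" where "\<alpha> \<noteq> \<alpha>'" "real_vec \<alpha> - real_vec \<alpha>' = 0"
      unfolding D_def by force
    then show False by (simp add: real_vec_inject)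
  qed
  obtain V where V: "V \<subseteq> U" "open V" "V \<noteq> {}" "\<forall>x\<in>V. \<forall>d\<in>D. d \<bullet> x \<noteq> 0"
    using open_avoiding_hyperplanes[OF fin no_zero assms(2,3)] by blast
  then obtain W q where W: "q > 0" "(1 / real q) *\<^sub>R real_vec W \<in> V"
    using rational_vector_in_open by blast
  have "inj_on (\<lambda>\<alpha>. int_dot \<alpha> W) A"
  proof (rule inj_onI, rule ccontr)
    fix \<alpha> \<alpha>' assume *: "\<alpha> \<in> A" "\<alpha>' \<in> A" "int_dot \<alpha> W = int_dot \<alpha>' W" "\<alpha> \<noteq> \<alpha>'"
    then have "real_vec \<alpha> - real_vec \<alpha>' \<in> D" by (auto simp: D_def)
    then have "(real_vec \<alpha> - real_vec \<alpha>') \<bullet> ((1 / real q) *\<^sub>R real_vec W) \<noteq> 0"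
      using V(4) W(2) by blast
    then show False
      using * by (simp add: inner_diff_left inner_real_vec)
  qed
  then show ?thesis using W V(1) by blast
qed

text \<open>The exponent \<open>\<beta>\<close> is the unique minimum along rational directions arbitrarily close to
  \<open>v\<close>. When the minimum along \<open>v\<close> is attained more than once this singles out one of the
  candidates, and it does so by the exponents alone, so that the same \<open>\<beta>\<close> serves at all places.\<close>

definition generically_minimal :: "(int ^ 'd::finite) set \<Rightarrow> real ^ 'd \<Rightarrow> int ^ 'd \<Rightarrow> bool" where
  "generically_minimal A v \<beta> \<longleftrightarrow> \<beta> \<in> A \<and>
     (\<forall>U. open U \<and> v \<in> U \<longrightarrow> (\<exists>W q. q > 0 \<and> (1 / real q) *\<^sub>R real_vec W \<in> U \<and>
        inj_on (\<lambda>\<alpha>. int_dot \<alpha> W) A \<and> (\<forall>\<alpha>\<in>A. int_dot \<beta> W \<le> int_dot \<alpha> W)))"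

text \<open>Otherwise each exponent fails to be the minimum along the generic rational directions in some
  neighbourhood of \<open>v\<close>. The intersection of these finitely many neighbourhoods contains such a
  direction, and along it the minimum is attained nonetheless.\<close>

lemma exists_generically_minimal:
  assumes "finite A" "A \<noteq> {}"
  shows "\<exists>\<beta>. generically_minimal A v \<beta>"
proof (rule ccontr)
  assume "\<not> ?thesis"
  then have "\<forall>\<beta>\<in>A. \<exists>U. open U \<and> v \<in> U \<and> \<not> (\<exists>W q. q > 0 \<and> (1 / real q) *\<^sub>R real_vec W \<in> U \<and>
        inj_on (\<lambda>\<alpha>. int_dot \<alpha> W) A \<and> (\<forall>\<alpha>\<in>A. int_dot \<beta> W \<le> int_dot \<alpha> W))"
    unfolding generically_minimal_def by blast
  then obtain U where U: "\<And>\<beta>. \<beta> \<in> A \<Longrightarrow> open (U \<beta>) \<and> v \<in> U \<beta>"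
    "\<And>\<beta> W q. \<beta> \<in> A \<Longrightarrow> q > 0 \<Longrightarrow> (1 / real q) *\<^sub>R real_vec W \<in> U \<beta> \<Longrightarrow>
        inj_on (\<lambda>\<alpha>. int_dot \<alpha> W) A \<Longrightarrow> \<not> (\<forall>\<alpha>\<in>A. int_dot \<beta> W \<le> int_dot \<alpha> W)"
    by metis
  have "open (\<Inter>\<beta>\<in>A. U \<beta>)" "(\<Inter>\<beta>\<in>A. U \<beta>) \<noteq> {}"
    using U(1) assms by (auto intro!: open_INT)
  then obtain W q where W: "q > 0" "(1 / real q) *\<^sub>R real_vec W \<in> (\<Inter>\<beta>\<in>A. U \<beta>)"
      "inj_on (\<lambda>\<alpha>. int_dot \<alpha> W) A"
    using generic_direction_in_open assms(1) by metis
  obtain \<beta> where \<beta>: "\<beta> \<in> A" "\<forall>\<alpha>\<in>A. int_dot \<beta> W \<le> int_dot \<alpha> W"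
    using ex_min_if_finite[of "(\<lambda>\<alpha>. int_dot \<alpha> W) ` A"] assms by (force simp: not_less)
  show False
    using U(2)[OF \<beta>(1) W(1) _ W(3)] W(2) \<beta> by blast
qed

section \<open>Half-lines avoiding an amoeba\<close>

context place_extension
begin

text \<open>A sum can vanish only if no term exceeds the sum of the norms of the others.\<close>

lemma term_dominated_on_hypersurface:
  assumes a: "a \<in> hypersurface_points L emb f" and \<gamma>: "\<gamma> \<in> Poly_Mapping.keys f"
  shows "nrm (term_at f a \<gamma>) \<le> (\<Sum>\<alpha>\<in>Poly_Mapping.keys f - {\<gamma>}. nrm (term_at f a \<alpha>))"
proof -
  let ?A = "Poly_Mapping.keys f"
  have at: "a \<in> torus L" and zero: "(\<Oplus>\<alpha>\<in>?A. term_at f a \<alpha>) = \<zero>"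
    using a by (auto simp: hypersurface_points_eq)
  let ?s = "\<Oplus>\<alpha>\<in>?A - {\<gamma>}. term_at f a \<alpha>"
  have s: "?s \<in> carrier L"
    using at by (intro finsum_closed) (auto intro: term_at_closed)
  have "(\<Oplus>\<alpha>\<in>insert \<gamma> (?A - {\<gamma>}). term_at f a \<alpha>) = term_at f a \<gamma> \<oplus> ?s"
    using at by (subst finsum_insert) (auto intro: term_at_closed)
  then have "term_at f a \<gamma> \<oplus> ?s = \<zero>"
    using zero \<gamma> by (simp add: insert_absorb)
  then have "\<ominus> ?s = term_at f a \<gamma>"
    using s at by (intro minus_equality) (auto intro: term_at_closed)
  then have "nrm (term_at f a \<gamma>) = nrm ?s"
    using s by (metis nrm_minus)
  also have "\<dots> \<le> (\<Sum>\<alpha>\<in>?A - {\<gamma>}. nrm (term_at f a \<alpha>))"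
    using at by (intro nrm_finsum_le) (auto intro: term_at_closed)
  finally show ?thesis .
qed

text \<open>Far out in the directions near \<open>v\<close> the term of \<open>\<gamma>\<close> exceeds the sum of all others: the
  ratio of the term of \<open>\<alpha>\<close> to it decays like \<open>exp (- m t / 2)\<close>, where \<open>m\<close> is the
  gap between the maximum along \<open>v\<close> and the other values, uniformly in the starting point and the direction.\<close>

lemma avoids_points_near_infinity:
  fixes f :: "('f, 'd::finite) laurent_poly"
  assumes \<gamma>: "\<gamma> \<in> Poly_Mapping.keys f"
    and max: "\<And>\<alpha>. \<alpha> \<in> Poly_Mapping.keys f \<Longrightarrow> \<alpha> \<noteq> \<gamma> \<Longrightarrow> real_vec \<alpha> \<bullet> v < real_vec \<gamma> \<bullet> v"
  shows "\<exists>T \<delta>. \<delta> > 0 \<and> T \<ge> 0 \<and> (\<forall>u w t. norm (u - u0) < \<delta> \<longrightarrow> norm (w - v) < \<delta> \<longrightarrow> t \<ge> T \<longrightarrow>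
      u + t *\<^sub>R w \<notin> log_abs nrm ` hypersurface_points L emb f)"
proof -
  let ?A = "Poly_Mapping.keys f - {\<gamma>}"
  define N where "N = (\<lambda>\<alpha>. nrm (emb (Poly_Mapping.lookup f \<alpha>)))"
  define D where "D = (\<lambda>\<alpha>. real_vec \<alpha> - real_vec \<gamma>)"
  have N0: "N \<alpha> \<ge> 0" for \<alpha>
    by (simp add: N_def nrm_nonneg emb_closed)
  have N\<gamma>: "N \<gamma> > 0"
    using \<gamma> unfolding N_def by (intro nrm_pos emb_closed emb_nonzero) (simp add: in_keys_iff)
  obtain m where m: "m > 0" "\<And>\<alpha>. \<alpha> \<in> ?A \<Longrightarrow> D \<alpha> \<bullet> v \<le> - m"
  proof (cases "?A = {}")
    case False
    define m where "m = Min ((\<lambda>\<alpha>. - (D \<alpha> \<bullet> v)) ` ?A)"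
    have "m > 0"
      unfolding m_def using False max by (subst Min_gr_iff) (auto simp: D_def inner_diff_left)
    moreover have "D \<alpha> \<bullet> v \<le> - m" if "\<alpha> \<in> ?A" for \<alpha>
    proof -
      have "m \<le> - (D \<alpha> \<bullet> v)"
        unfolding m_def by (intro Min_le imageI that) auto
      then show ?thesis by simp
    qed
    ultimately show ?thesis using that by blast
  qed (use that[of 1] in auto)
  define R where "R = (\<Sum>\<alpha>\<in>?A. norm (D \<alpha>))"
  have R: "norm (D \<alpha>) \<le> R" if "\<alpha> \<in> ?A" for \<alpha>
    unfolding R_def using that by (intro member_le_sum) auto
  have R0: "R \<ge> 0"
    unfolding R_def by (intro sum_nonneg) auto
  define K where "K = (\<lambda>\<alpha>. N \<alpha> * exp (D \<alpha> \<bullet> u0 + R))"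
  have "filterlim (\<lambda>t::real. (- m / 2) * t) at_bot at_top"
    using m by (intro filterlim_tendsto_neg_mult_at_bot[OF tendsto_const]) (auto simp: filterlim_ident)
  then have "((\<lambda>t. exp ((- m / 2) * t)) \<longlongrightarrow> 0) at_top"
    by (rule filterlim_compose[OF exp_at_bot])
  then have "((\<lambda>t. \<Sum>\<alpha>\<in>?A. K \<alpha> * exp ((- m / 2) * t)) \<longlongrightarrow> (\<Sum>\<alpha>\<in>?A. K \<alpha> * 0)) at_top"
    by (intro tendsto_sum tendsto_mult tendsto_const)
  then have "\<forall>\<^sub>F t in at_top. (\<Sum>\<alpha>\<in>?A. K \<alpha> * exp ((- m / 2) * t)) < N \<gamma>"
    using N\<gamma> by (intro order_tendstoD) auto
  then obtain T0 where T0: "\<And>t. t \<ge> T0 \<Longrightarrow> (\<Sum>\<alpha>\<in>?A. K \<alpha> * exp ((- m / 2) * t)) < N \<gamma>"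
    by (auto simp: eventually_at_top_linorder)
  define T where "T = max 0 T0"
  define \<delta> where "\<delta> = min 1 (m / (2 * (R + 1)))"
  have \<delta>: "\<delta> > 0" "\<delta> \<le> 1" "R * \<delta> \<le> m / 2"
  proof -
    show "\<delta> > 0" "\<delta> \<le> 1" using m R0 by (auto simp: \<delta>_def)
    have half: "x * (m / (2 * x)) = m / 2" if "x > 0" for x
      using that by simp
    have "R * \<delta> \<le> (R + 1) * (m / (2 * (R + 1)))"
      using R0 m by (intro mult_mono) (auto simp: \<delta>_def)
    also have "\<dots> = m / 2"
      using R0 by (intro half) simp
    finally show "R * \<delta> \<le> m / 2" .
  qed
  have "u + t *\<^sub>R w \<notin> log_abs nrm ` hypersurface_points L emb f"
    if u: "norm (u - u0) < \<delta>" and w: "norm (w - v) < \<delta>" and t: "t \<ge> T" for u w t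
  proof
    assume "u + t *\<^sub>R w \<in> log_abs nrm ` hypersurface_points L emb f"
    then obtain a where a: "a \<in> hypersurface_points L emb f" "log_abs nrm a = u + t *\<^sub>R w"
      by force
    let ?x = "u + t *\<^sub>R w"
    have at: "a \<in> torus L" using a by (simp add: hypersurface_points_eq)
    have t0: "t \<ge> 0" "t \<ge> T0" using t by (auto simp: T_def)
    have "N \<gamma> * exp (real_vec \<gamma> \<bullet> ?x) \<le> (\<Sum>\<alpha>\<in>?A. N \<alpha> * exp (real_vec \<alpha> \<bullet> ?x))"
      using term_dominated_on_hypersurface[OF a(1) \<gamma>] at a(2) by (simp add: nrm_term_at N_def)
    also have "\<dots> = (\<Sum>\<alpha>\<in>?A. N \<alpha> * exp (D \<alpha> \<bullet> ?x)) * exp (real_vec \<gamma> \<bullet> ?x)"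
      by (simp add: sum_distrib_right D_def inner_diff_left exp_diff)
    finally have "N \<gamma> \<le> (\<Sum>\<alpha>\<in>?A. N \<alpha> * exp (D \<alpha> \<bullet> ?x))"
      by simp
    also have "\<dots> \<le> (\<Sum>\<alpha>\<in>?A. K \<alpha> * exp ((- m / 2) * t))"
    proof (rule sum_mono)
      fix \<alpha> assume \<alpha>: "\<alpha> \<in> ?A"
      have near: "D \<alpha> \<bullet> z \<le> R * \<delta>" if "norm z < \<delta>" for z
      proof -
        have "D \<alpha> \<bullet> z \<le> norm (D \<alpha>) * norm z"
          by (rule norm_cauchy_schwarz)
        also have "\<dots> \<le> R * \<delta>"
          using R[OF \<alpha>] R0 that by (intro mult_mono) auto
        finally show ?thesis .
      qed
      have "D \<alpha> \<bullet> u \<le> D \<alpha> \<bullet> u0 + R"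
        using near[OF u] R0 \<delta> by (smt (verit) inner_diff_right mult_left_le)
      moreover have "D \<alpha> \<bullet> w \<le> - m / 2"
        using near[OF w] \<delta> m(2)[OF \<alpha>] by (simp add: inner_diff_right)
      then have "t * (D \<alpha> \<bullet> w) \<le> t * (- m / 2)"
        using t0 by (intro mult_left_mono) auto
      ultimately have "D \<alpha> \<bullet> ?x \<le> (D \<alpha> \<bullet> u0 + R) + (- m / 2) * t"
        by (simp add: inner_add_right mult.commute)
      then have "exp (D \<alpha> \<bullet> ?x) \<le> exp (D \<alpha> \<bullet> u0 + R) * exp ((- m / 2) * t)"
        by (simp flip: exp_add)
      then show "N \<alpha> * exp (D \<alpha> \<bullet> ?x) \<le> K \<alpha> * exp ((- m / 2) * t)"
        unfolding K_def mult.assoc using N0 by (intro mult_left_mono)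
    qed
    also have "\<dots> < N \<gamma>"
      using T0[OF t0(2)] .
    finally show False by simp
  qed
  then show ?thesis
    using \<delta>(1) by (intro exI[of _ T] exI[of _ \<delta>]) (auto simp: T_def)
qed

text \<open>A bounded part of the half-line is compact and has positive distance from the
  closed amoeba; the unbounded part is controlled by the domination at infinity.\<close>

lemma nearby_half_lines_avoid_points:
  fixes f :: "('f, 'd::finite) laurent_poly"
  assumes \<gamma>: "\<gamma> \<in> Poly_Mapping.keys f"
    and max: "\<And>\<alpha>. \<alpha> \<in> Poly_Mapping.keys f \<Longrightarrow> \<alpha> \<noteq> \<gamma> \<Longrightarrow> real_vec \<alpha> \<bullet> v < real_vec \<gamma> \<bullet> v"
    and avoid: "\<And>t. t \<ge> 0 \<Longrightarrow> u0 + t *\<^sub>R v \<notin> amoeba L nrm emb f"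
  shows "\<exists>\<delta>>0. \<forall>u w t. norm (u - u0) < \<delta> \<longrightarrow> norm (w - v) < \<delta> \<longrightarrow> t \<ge> 0 \<longrightarrow>
      u + t *\<^sub>R w \<notin> log_abs nrm ` hypersurface_points L emb f"
proof -
  let ?P = "log_abs nrm ` hypersurface_points L emb f"
  obtain T \<delta>1 where T: "\<delta>1 > 0" "T \<ge> 0"
      "\<And>u w t. norm (u - u0) < \<delta>1 \<Longrightarrow> norm (w - v) < \<delta>1 \<Longrightarrow> t \<ge> T \<Longrightarrow> u + t *\<^sub>R w \<notin> ?P"
    using avoids_points_near_infinity[OF \<gamma> max, of u0] by blast
  have "compact ((\<lambda>t. u0 + t *\<^sub>R v) ` {0..T})"
    by (intro compact_continuous_image continuous_intros) auto
  moreover have "closed (amoeba L nrm emb f)"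
    by (simp add: amoeba_eq)
  moreover have "(\<lambda>t. u0 + t *\<^sub>R v) ` {0..T} \<inter> amoeba L nrm emb f = {}"
    using avoid by auto
  ultimately obtain d where d: "d > 0"
      "\<And>t y. 0 \<le> t \<Longrightarrow> t \<le> T \<Longrightarrow> y \<in> amoeba L nrm emb f \<Longrightarrow> d \<le> dist (u0 + t *\<^sub>R v) y"
    using separate_compact_closed[of "(\<lambda>t. u0 + t *\<^sub>R v) ` {0..T}" "amoeba L nrm emb f"] by auto
  define \<delta> where "\<delta> = min \<delta>1 (d / (1 + T))"
  have "\<delta> * (1 + T) \<le> d / (1 + T) * (1 + T)"
    using T by (intro mult_right_mono) (auto simp: \<delta>_def)
  then have \<delta>: "\<delta> > 0" "\<delta> \<le> \<delta>1" "\<delta> * (1 + T) \<le> d"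
    using T d by (auto simp: \<delta>_def)
  have "u + t *\<^sub>R w \<notin> ?P" if u: "norm (u - u0) < \<delta>" and w: "norm (w - v) < \<delta>" and t: "t \<ge> 0" for u w t
  proof (cases "t \<ge> T")
    case True
    then show ?thesis using T(3)[of u w t] u w \<delta> by auto
  next
    case False
    have "dist (u0 + t *\<^sub>R v) (u + t *\<^sub>R w) = norm ((u - u0) + t *\<^sub>R (w - v))"
      by (simp add: dist_norm norm_minus_commute algebra_simps)
    also have "\<dots> \<le> norm (u - u0) + t * norm (w - v)"
      using norm_triangle_ineq[of "u - u0" "t *\<^sub>R (w - v)"] t by simp
    also have "\<dots> < \<delta> + T * \<delta>"
      using u w t False \<delta> by (intro add_less_le_mono mult_mono) auto
    also have "\<dots> \<le> d"
      using \<delta> by (simp add: algebra_simps)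
    finally have "u + t *\<^sub>R w \<notin> amoeba L nrm emb f"
      using d(2)[of t "u + t *\<^sub>R w"] t False by force
    then show ?thesis
      using closure_subset[of ?P] unfolding amoeba_eq by blast
  qed
  then show ?thesis
    using \<delta>(1) by blast
qed

text \<open>If the inequality failed, it would also fail at some point \<open>Log a\<close> near \<open>u0\<close>. Restrict \<open>f\<close>
  to the curve through \<open>a\<close> in a generic rational direction near \<open>v\<close>. A root of norm greater than one would
  give a point of the hypersurface over a half-line near the given one, which is impossible. So all roots have norm at
  most one, and the constant coefficient, the term of \<open>\<beta>\<close>, is at most the leading one, the
  term of \<open>\<gamma>\<close>. Starting points other than the origin are essential in the applications.\<close>

proposition generically_minimal_term_le:
  fixes f :: "('f, 'd::finite) laurent_poly"
  assumes \<gamma>: "\<gamma> \<in> Poly_Mapping.keys f"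
    and max: "\<And>\<alpha>. \<alpha> \<in> Poly_Mapping.keys f \<Longrightarrow> \<alpha> \<noteq> \<gamma> \<Longrightarrow> real_vec \<alpha> \<bullet> v < real_vec \<gamma> \<bullet> v"
    and avoid: "\<And>t. t \<ge> 0 \<Longrightarrow> u0 + t *\<^sub>R v \<notin> amoeba L nrm emb f"
    and \<beta>: "generically_minimal (Poly_Mapping.keys f) v \<beta>"
  shows "nrm (emb (Poly_Mapping.lookup f \<beta>)) * exp (real_vec \<beta> \<bullet> u0)
       \<le> nrm (emb (Poly_Mapping.lookup f \<gamma>)) * exp (real_vec \<gamma> \<bullet> u0)"
proof (rule ccontr)
  let ?A = "Poly_Mapping.keys f"
  let ?g = "\<lambda>u. nrm (emb (Poly_Mapping.lookup f \<beta>)) * exp (real_vec \<beta> \<bullet> u)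
       - nrm (emb (Poly_Mapping.lookup f \<gamma>)) * exp (real_vec \<gamma> \<bullet> u)"
  assume "\<not> ?thesis"
  then have "u0 \<in> {u. 0 < ?g u}" by simp
  moreover have "open {u. 0 < ?g u}"
    by (intro open_Collect_less continuous_intros)
  ultimately obtain \<delta>2 where \<delta>2: "\<delta>2 > 0" "ball u0 \<delta>2 \<subseteq> {u. 0 < ?g u}"
    by (meson open_contains_ball)
  obtain \<delta> where \<delta>: "\<delta> > 0"
      "\<And>u w t. norm (u - u0) < \<delta> \<Longrightarrow> norm (w - v) < \<delta> \<Longrightarrow> t \<ge> 0 \<Longrightarrow>
      u + t *\<^sub>R w \<notin> log_abs nrm ` hypersurface_points L emb f"
    using nearby_half_lines_avoid_points[OF \<gamma> max avoid] by blast
  define U where "U = ball v \<delta> \<inter> (\<Inter>\<alpha>\<in>?A - {\<gamma>}. {w. real_vec \<alpha> \<bullet> w < real_vec \<gamma> \<bullet> w})"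
  have "open U"
    unfolding U_def by (intro open_Int open_ball open_INT ballI open_Collect_less continuous_intros) auto
  moreover have "v \<in> U"
    using \<delta> max by (auto simp: U_def)
  ultimately obtain W q where W: "q > 0" "(1 / real q) *\<^sub>R real_vec W \<in> U"
      "inj_on (\<lambda>\<alpha>. int_dot \<alpha> W) ?A" "\<And>\<alpha>. \<alpha> \<in> ?A \<Longrightarrow> int_dot \<beta> W \<le> int_dot \<alpha> W"
    using \<beta> unfolding generically_minimal_def by blast
  have \<beta>A: "\<beta> \<in> ?A"
    using \<beta> by (simp add: generically_minimal_def)
  let ?w = "(1 / real q) *\<^sub>R real_vec W"
  have w: "norm (?w - v) < \<delta>"
    using W(2) by (simp add: U_def dist_norm norm_minus_commute)
  have top: "int_dot \<alpha> W \<le> int_dot \<gamma> W" if "\<alpha> \<in> ?A" for \<alpha>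
  proof (cases "\<alpha> = \<gamma>")
    case False
    then have "real_vec \<alpha> \<bullet> ?w < real_vec \<gamma> \<bullet> ?w"
      using W(2) that by (auto simp: U_def)
    then show ?thesis
      using W(1) by (simp add: inner_real_vec divide_less_cancel)
  qed simp
  obtain a where a: "a \<in> torus L" "norm (log_abs nrm a - u0) < min \<delta> \<delta>2"
    using exists_log_abs_near[OF nontrivial, of "min \<delta> \<delta>2" u0] \<delta>(1) \<delta>2(1) by auto
  let ?e = "\<lambda>\<alpha>. nat (int_dot \<alpha> W - int_dot \<beta> W)"
  obtain c where c: "poly_coeffs (?e \<gamma>) c" "\<forall>\<alpha>\<in>?A. c (?e \<alpha>) = term_at f a \<alpha>"
      "\<forall>r\<in>carrier L. r \<noteq> \<zero> \<longrightarrow> poly_value (?e \<gamma>) c r = \<zero> \<longrightarrow>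
          move_along L a W r \<in> hypersurface_points L emb f"
    using restriction_to_coset[OF a(1) W(3) \<beta>A W(4) \<gamma> top] by blast
  have "nrm (c 0) \<le> nrm (c (?e \<gamma>))"
  proof (rule constant_le_leading[OF c(1)], rule ccontr)
    fix r assume r: "r \<in> carrier L" "poly_value (?e \<gamma>) c r = \<zero>" "\<not> nrm r \<le> 1"
    then have r0: "r \<noteq> \<zero>" by (auto simp: nrm_zero)
    let ?t = "real q * ln (nrm r)"
    have "log_abs nrm (move_along L a W r) = log_abs nrm a + ?t *\<^sub>R ?w"
      using log_abs_move_along[OF a(1), of r W] r r0 W(1) by simp
    moreover have "?t \<ge> 0"
      using r(3) by simp
    moreover have "move_along L a W r \<in> hypersurface_points L emb f"
      using c(3) r r0 by blast
    ultimately show False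
      using \<delta>(2)[of "log_abs nrm a" ?w ?t] a(2) w by (metis imageI min_less_iff_conj)
  qed
  moreover have "c 0 = term_at f a \<beta>" "c (?e \<gamma>) = term_at f a \<gamma>"
    using c(2) \<beta>A \<gamma> by force+
  ultimately have "?g (log_abs nrm a) \<le> 0"
    using a(1) by (simp add: nrm_term_at)
  moreover have "log_abs nrm a \<in> ball u0 \<delta>2"
    using a(2) by (simp add: dist_norm norm_minus_commute)
  ultimately show False
    using \<delta>2(2) by force
qed

text \<open>Near \<open>v\<close> the terms of \<open>\<alpha>1\<close> and \<open>\<alpha>2\<close> both have nearly the largest norm. By the
  Newton polygon, the restriction of \<open>f\<close> to a curve through such a point then has a root of norm
  close to one, and the corresponding point of the hypersurface has its logarithm close to \<open>v\<close>.\<close>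

proposition tie_in_amoeba:
  fixes f :: "('f, 'd::finite) laurent_poly"
  assumes u: ultrametric
    and coeffs: "\<And>\<alpha>. \<alpha> \<in> Poly_Mapping.keys f \<Longrightarrow> nrm (emb (Poly_Mapping.lookup f \<alpha>)) = 1"
    and tie: "\<alpha>1 \<in> Poly_Mapping.keys f" "\<alpha>2 \<in> Poly_Mapping.keys f" "\<alpha>1 \<noteq> \<alpha>2"
    and max1: "\<And>\<alpha>. \<alpha> \<in> Poly_Mapping.keys f \<Longrightarrow> real_vec \<alpha> \<bullet> v \<le> real_vec \<alpha>1 \<bullet> v"
    and max2: "\<And>\<alpha>. \<alpha> \<in> Poly_Mapping.keys f \<Longrightarrow> real_vec \<alpha> \<bullet> v \<le> real_vec \<alpha>2 \<bullet> v"
  shows "v \<in> amoeba L nrm emb f"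
  unfolding amoeba_eq closure_approachable
proof (intro allI impI)
  let ?A = "Poly_Mapping.keys f"
  fix \<epsilon> :: real assume e: "\<epsilon> > 0"
  obtain W where inj: "inj_on (\<lambda>\<alpha>. int_dot \<alpha> W) ?A"
    using generic_direction_in_open[OF finite_keys open_UNIV UNIV_not_empty, of f] by blast
  obtain \<beta> where \<beta>: "\<beta> \<in> ?A" "\<And>\<alpha>. \<alpha> \<in> ?A \<Longrightarrow> int_dot \<beta> W \<le> int_dot \<alpha> W"
    using ex_min_if_finite[of "(\<lambda>\<alpha>. int_dot \<alpha> W) ` ?A"] tie(1) by (force simp: not_less)
  obtain \<gamma> where \<gamma>: "\<gamma> \<in> ?A" "\<And>\<alpha>. \<alpha> \<in> ?A \<Longrightarrow> int_dot \<alpha> W \<le> int_dot \<gamma> W"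
    using ex_min_if_finite[of "(\<lambda>\<alpha>. - int_dot \<alpha> W) ` ?A"] tie(1) by (force simp: not_less)
  define \<delta> where "\<delta> = \<epsilon> / (2 * (norm (real_vec W) + 1))"
  have \<delta>: "\<delta> > 0" "\<delta> * norm (real_vec W) \<le> \<epsilon> / 2"
    using e by (auto simp: \<delta>_def field_simps add_pos_nonneg)
  define R where "R = (\<Sum>\<alpha>\<in>?A. norm (real_vec \<alpha>))"
  have R: "norm (real_vec \<alpha>) \<le> R" if "\<alpha> \<in> ?A" for \<alpha>
    unfolding R_def using that by (intro member_le_sum) auto
  have R0: "R \<ge> 0" unfolding R_def by (intro sum_nonneg) auto
  \<comment> \<open>The bounds ensure that moving from \<open>v\<close> by \<open>\<eta>\<close> changes the ratio of two terms by a factor of less than \<open>exp \<delta>\<close>.\<close>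
  define \<eta> where "\<eta> = min (\<epsilon> / 2) (\<delta> / (3 * (R + 1)))"
  have "(2 * R) * \<eta> \<le> (2 * R) * (\<delta> / (3 * (R + 1)))"
    using R0 by (intro mult_left_mono) (auto simp: \<eta>_def)
  also have "\<dots> < \<delta>"
  proof -
    have "2 * R * \<delta> < \<delta> * (3 * (R + 1))"
      using R0 \<delta>(1) by (simp add: algebra_simps add_nonneg_pos)
    then show ?thesis using R0 by (simp add: divide_less_eq)
  qed
  finally have R\<eta>: "2 * R * \<eta> < \<delta>" .
  have "\<delta> / (3 * (R + 1)) > 0"
    using \<delta>(1) R0 by simp
  then have \<eta>: "\<eta> > 0" "\<eta> \<le> \<epsilon> / 2"
    unfolding \<eta>_def using e by (auto simp only: min_less_iff_conj min.cobounded1)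
  obtain a where a: "a \<in> torus L" "norm (log_abs nrm a - v) < \<eta>"
    using exists_log_abs_near[OF nontrivial \<eta>(1)] by blast
  let ?e = "\<lambda>\<alpha>. nat (int_dot \<alpha> W - int_dot \<beta> W)"
  obtain c where c: "poly_coeffs (?e \<gamma>) c" "\<And>\<alpha>. \<alpha> \<in> ?A \<Longrightarrow> c (?e \<alpha>) = term_at f a \<alpha>"
      "\<And>i. c i \<noteq> \<zero> \<Longrightarrow> i \<in> ?e ` ?A"
      "\<forall>r\<in>carrier L. r \<noteq> \<zero> \<longrightarrow> poly_value (?e \<gamma>) c r = \<zero> \<longrightarrow>
          move_along L a W r \<in> hypersurface_points L emb f"
    using restriction_to_coset[OF a(1) inj \<beta> \<gamma>] by blast
  have "\<exists>r\<in>carrier L. poly_value (?e \<gamma>) c r = \<zero> \<and> exp (-\<delta>) \<le> nrm r \<and> nrm r \<le> exp \<delta>"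
  proof (rule ccontr)
    assume "\<not> ?thesis"
    then have "nrm r < exp (-\<delta>) \<or> exp \<delta> < nrm r"
      if "r \<in> carrier L" "poly_value (?e \<gamma>) c r = \<zero>" for r
      using that by force
    then obtain j where j: "c j \<noteq> \<zero>" "\<And>i. i \<noteq> j \<Longrightarrow> nrm (c i) \<le> exp (-\<delta>) * nrm (c j)"
      using ultrametric_dominant_coefficient[OF u c(1) \<delta>(1)] by blast
    obtain \<alpha> where \<alpha>: "\<alpha> \<in> ?A" "j = ?e \<alpha>"
      using c(3)[OF j(1)] by blast
    obtain \<alpha>' where \<alpha>': "\<alpha>' \<in> ?A" "\<alpha>' \<noteq> \<alpha>" "real_vec \<alpha> \<bullet> v \<le> real_vec \<alpha>' \<bullet> v"
      using tie max1[OF \<alpha>(1)] max2[OF \<alpha>(1)] by metis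
    have "?e \<alpha>' \<noteq> j"
    proof
      assume "?e \<alpha>' = j"
      then have "int_dot \<alpha>' W = int_dot \<alpha> W"
        using \<alpha> \<beta>(2)[OF \<alpha>(1)] \<beta>(2)[OF \<alpha>'(1)] by simp
      then show False
        using inj \<alpha>(1) \<alpha>'(1,2) by (simp add: inj_on_def)
    qed
    then have "nrm (term_at f a \<alpha>') \<le> exp (-\<delta>) * nrm (term_at f a \<alpha>)"
      using j(2) \<alpha> \<alpha>'(1) c(2) by metis
    then have "real_vec \<alpha>' \<bullet> log_abs nrm a \<le> - \<delta> + real_vec \<alpha> \<bullet> log_abs nrm a"
      using a(1) coeffs \<alpha>(1) \<alpha>'(1) by (simp add: nrm_term_at flip: exp_add)
    moreover have "\<bar>real_vec \<alpha> \<bullet> (log_abs nrm a - v)\<bar> \<le> R * \<eta>" if "\<alpha> \<in> ?A" for \<alpha>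
    proof -
      have "\<bar>real_vec \<alpha> \<bullet> (log_abs nrm a - v)\<bar> \<le> norm (real_vec \<alpha>) * norm (log_abs nrm a - v)"
        by (rule Cauchy_Schwarz_ineq2)
      also have "\<dots> \<le> R * \<eta>"
        using R[OF that] R0 a(2) by (intro mult_mono) auto
      finally show ?thesis .
    qed
    from this[OF \<alpha>(1)] this[OF \<alpha>'(1)]
    have "real_vec \<alpha> \<bullet> log_abs nrm a \<le> real_vec \<alpha> \<bullet> v + R * \<eta>"
      "real_vec \<alpha>' \<bullet> v \<le> real_vec \<alpha>' \<bullet> log_abs nrm a + R * \<eta>"
      by (simp_all add: inner_diff_right)
    ultimately show False
      using \<alpha>'(3) R\<eta> by linarith
  qed
  then obtain r where r: "r \<in> carrier L" "poly_value (?e \<gamma>) c r = \<zero>" "exp (-\<delta>) \<le> nrm r" "nrm r \<le> exp \<delta>"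
    by blast
  have pos: "nrm r > 0"
    using r(3) by (smt (verit) exp_gt_zero)
  then have r0: "r \<noteq> \<zero>" by (auto simp: nrm_zero)
  have "ln (nrm r) \<le> \<delta>" "- \<delta> \<le> ln (nrm r)"
    using ln_le_cancel_iff[of "nrm r" "exp \<delta>"] ln_le_cancel_iff[of "exp (-\<delta>)" "nrm r"] r(3,4) pos
    by simp_all
  then have "\<bar>ln (nrm r)\<bar> * norm (real_vec W) \<le> \<delta> * norm (real_vec W)"
    by (intro mult_right_mono) auto
  moreover have "dist (log_abs nrm (move_along L a W r)) v
      \<le> norm (log_abs nrm a - v) + \<bar>ln (nrm r)\<bar> * norm (real_vec W)"
    using log_abs_move_along[OF a(1), of r W] r r0
      norm_triangle_ineq[of "log_abs nrm a - v" "ln (nrm r) *\<^sub>R real_vec W"]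
    by (simp add: dist_norm algebra_simps)
  ultimately have "dist (log_abs nrm (move_along L a W r)) v < \<epsilon>"
    using a(2) \<eta>(2) \<delta>(2) by linarith
  then show "\<exists>y\<in>log_abs nrm ` hypersurface_points L emb f. dist y v < \<epsilon>"
    using c(4) r r0 by blast
qed

end

section \<open>Maximal subrings avoiding an inverse\<close>

definition is_subring :: "'f::field set \<Rightarrow> bool" where
  "is_subring B \<longleftrightarrow> 1 \<in> B \<and> (\<forall>x\<in>B. \<forall>y\<in>B. x - y \<in> B \<and> x * y \<in> B)"

lemma is_subringD:
  assumes "is_subring B"
  shows subring_one: "1 \<in> B"
    and subring_diff: "x \<in> B \<Longrightarrow> y \<in> B \<Longrightarrow> x - y \<in> B"
    and subring_mult: "x \<in> B \<Longrightarrow> y \<in> B \<Longrightarrow> x * y \<in> B"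
    and subring_zero: "0 \<in> B"
    and subring_uminus: "x \<in> B \<Longrightarrow> - x \<in> B"
    and subring_add: "x \<in> B \<Longrightarrow> y \<in> B \<Longrightarrow> x + y \<in> B"
    and subring_power: "x \<in> B \<Longrightarrow> x ^ n \<in> B"
    and subring_of_nat: "of_nat n \<in> B"
proof -
  show 1: "1 \<in> B" and d: "x \<in> B \<Longrightarrow> y \<in> B \<Longrightarrow> x - y \<in> B"
    and m: "x \<in> B \<Longrightarrow> y \<in> B \<Longrightarrow> x * y \<in> B" for x y
    using assms by (auto simp: is_subring_def)
  show 0: "0 \<in> B" using d[OF 1 1] by simp
  show u: "x \<in> B \<Longrightarrow> - x \<in> B" for x using d[OF 0, of x] by simp
  show a: "x \<in> B \<Longrightarrow> y \<in> B \<Longrightarrow> x + y \<in> B" for x y using d[OF _ u, of x y] by simp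
  show "x \<in> B \<Longrightarrow> x ^ n \<in> B" by (induction n) (auto intro: 1 m)
  show "of_nat n \<in> B" by (induction n) (auto intro: 0 1 a)
qed

lemma subring_sum:
  assumes "is_subring B" "\<And>i. i \<in> A \<Longrightarrow> g i \<in> B"
  shows "sum g A \<in> B"
  using assms(2)
  by (induction A rule: infinite_finite_induct) (auto intro: is_subringD[OF assms(1)])

definition adjoin :: "'f::field set \<Rightarrow> 'f \<Rightarrow> 'f set" where
  "adjoin B x = {poly p x | p. \<forall>i. Polynomial.coeff p i \<in> B}"

lemma adjoinI: "(\<And>i. Polynomial.coeff p i \<in> B) \<Longrightarrow> poly p x \<in> adjoin B x"
  by (auto simp: adjoin_def)

lemma adjoinE:
  assumes "y \<in> adjoin B x"
  obtains p where "\<And>i. Polynomial.coeff p i \<in> B" "y = poly p x"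
  using assms by (auto simp: adjoin_def)

lemma subring_adjoin:
  assumes B: "is_subring B"
  shows "is_subring (adjoin B x)"
  unfolding is_subring_def
proof (intro conjI ballI)
  note B' = is_subringD[OF B]
  show "1 \<in> adjoin B x"
    using adjoinI[of 1 B x] B' by (auto simp: coeff_1)
  fix y z assume "y \<in> adjoin B x" "z \<in> adjoin B x"
  then obtain p q where p: "\<And>i. Polynomial.coeff p i \<in> B" "y = poly p x"
      and q: "\<And>i. Polynomial.coeff q i \<in> B" "z = poly q x"
    by (metis adjoinE)
  have "poly (p - q) x \<in> adjoin B x"
    using p(1) q(1) B' by (intro adjoinI) auto
  then show "y - z \<in> adjoin B x" by (simp add: p q)
  have "poly (p * q) x \<in> adjoin B x"
    using p(1) q(1) B' by (intro adjoinI) (auto simp: coeff_mult intro!: subring_sum[OF B])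
  then show "y * z \<in> adjoin B x" by (simp add: p q)
qed

lemma subset_adjoin:
  assumes "is_subring B"
  shows "B \<subseteq> adjoin B x"
proof
  fix b assume "b \<in> B"
  then have "poly [:b:] x \<in> adjoin B x"
    using assms by (intro adjoinI) (auto simp: coeff_pCons subring_zero split: nat.split)
  then show "b \<in> adjoin B x" by simp
qed

lemma mem_adjoin:
  assumes "is_subring B"
  shows "x \<in> adjoin B x"
proof -
  have "poly [:0, 1:] x \<in> adjoin B x"
    using assms by (intro adjoinI) (auto simp: coeff_pCons subring_zero subring_one split: nat.split)
  then show ?thesis by simp
qed

text \<open>A largest subring in which \<open>\<omega>\<close> stays a non-unit. Every larger subring contains
  \<open>1 / \<omega>\<close>, and this makes it a local ring whose maximal ideal is the radical of the ideal
  generated by \<open>\<omega>\<close>.\<close>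

locale maximal_avoiding_inverse =
  fixes B :: "'f::field set" and \<omega> :: 'f
  assumes subring: "is_subring B"
    and \<omega>: "\<omega> \<in> B" "\<omega> \<noteq> 0" "1 / \<omega> \<notin> B"
    and maximal: "\<And>B'. is_subring B' \<Longrightarrow> B \<subseteq> B' \<Longrightarrow> 1 / \<omega> \<notin> B' \<Longrightarrow> B' = B"

lemma exists_maximal_avoiding_inverse:
  assumes R: "is_subring R" and \<omega>: "\<omega> \<in> R" "\<omega> \<noteq> 0" "1 / \<omega> \<notin> R"
  shows "\<exists>B. R \<subseteq> B \<and> maximal_avoiding_inverse B \<omega>"
proof -
  let ?S = "{B. is_subring B \<and> R \<subseteq> B \<and> 1 / \<omega> \<notin> B}"
  have "\<exists>M\<in>?S. \<forall>Z1\<in>?S. M \<subseteq> Z1 \<longrightarrow> Z1 = M"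
  proof (rule subset_Zorn_nonempty)
    show "?S \<noteq> {}" using assms by blast
    fix C assume C: "C \<noteq> {}" "subset.chain ?S C"
    have "is_subring (\<Union>C)"
      unfolding is_subring_def
    proof (intro conjI ballI)
      show "1 \<in> \<Union>C"
        using C subring_one by (force simp: subset.chain_def)
      fix x y assume "x \<in> \<Union>C" "y \<in> \<Union>C"
      then obtain Z1 Z2 where XY: "Z1 \<in> C" "x \<in> Z1" "Z2 \<in> C" "y \<in> Z2" by blast
      then have "Z1 \<subseteq> Z2 \<or> Z2 \<subseteq> Z1"
        using C(2) by (auto simp: subset.chain_def)
      then obtain Z3 where Z3: "Z3 \<in> C" "x \<in> Z3" "y \<in> Z3"
        using XY by blast
      then have "is_subring Z3" using C(2) by (auto simp: subset.chain_def)
      then show "x - y \<in> \<Union>C" "x * y \<in> \<Union>C"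
        using Z3 by (auto intro: is_subringD)
    qed
    then show "\<Union>C \<in> ?S"
      using C by (auto simp: subset.chain_def)
  qed
  then obtain B where B: "B \<in> ?S" "\<forall>Z1\<in>?S. B \<subseteq> Z1 \<longrightarrow> Z1 = B" by blast
  have "maximal_avoiding_inverse B \<omega>"
  proof
    show "is_subring B" "\<omega> \<in> B" "\<omega> \<noteq> 0" "1 / \<omega> \<notin> B" using B(1) \<omega> by auto
    fix B' assume "is_subring B'" "B \<subseteq> B'" "1 / \<omega> \<notin> B'"
    then show "B' = B" using B by auto
  qed
  then show ?thesis using B(1) by blast
qed

context maximal_avoiding_inverse
begin

lemmas B_closed = is_subringD[OF subring]

definition nonunits :: "'f set" where
  "nonunits = {x \<in> B. x = 0 \<or> 1 / x \<notin> B}"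

definition units :: "'f set" where
  "units = {x \<in> B. x \<noteq> 0 \<and> 1 / x \<in> B}"

lemma units_eq: "x \<in> units \<longleftrightarrow> x \<in> B \<and> x \<notin> nonunits"
  by (auto simp: units_def nonunits_def)

text \<open>If \<open>1 / x\<close> is not in \<open>B\<close>, then adjoining it produces \<open>1 / \<omega>\<close> as a polynomial in
  \<open>1 / x\<close>; clearing denominators shows that \<open>\<omega>\<close> divides a power of \<open>x\<close>. In this form
  closure of the non-units under addition follows from the binomial theorem.\<close>

lemma nonunits_eq: "nonunits = {x \<in> B. \<exists>n. x ^ n / \<omega> \<in> B}"
proof (intro equalityI subsetI)
  fix x assume x: "x \<in> nonunits"
  show "x \<in> {x \<in> B. \<exists>n. x ^ n / \<omega> \<in> B}"
  proof (cases "x = 0")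
    case True
    then have "x ^ 1 / \<omega> \<in> B" by (simp add: B_closed)
    then show ?thesis using True B_closed by blast
  next
    case False
    then have xB: "x \<in> B" "1 / x \<notin> B" using x by (auto simp: nonunits_def)
    have "1 / \<omega> \<in> adjoin B (1 / x)"
      using maximal[OF subring_adjoin[OF subring] subset_adjoin[OF subring], of "1 / x"]
        mem_adjoin[OF subring, of "1 / x"] xB by auto
    then obtain p where p: "\<And>i. Polynomial.coeff p i \<in> B" "1 / \<omega> = poly p (1 / x)"
      by (metis adjoinE)
    have "x ^ Polynomial.degree p / \<omega> = x ^ Polynomial.degree p * poly p (1 / x)"
      unfolding p(2)[symmetric] by simp
    also have "\<dots> = (\<Sum>i\<le>Polynomial.degree p. Polynomial.coeff p i * x ^ (Polynomial.degree p - i))"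
      unfolding poly_altdef sum_distrib_left
    proof (rule sum.cong)
      fix i assume "i \<in> {..Polynomial.degree p}"
      then have "x ^ Polynomial.degree p = x ^ (Polynomial.degree p - i) * x ^ i"
        by (simp flip: power_add)
      then show "x ^ Polynomial.degree p * (Polynomial.coeff p i * (1 / x) ^ i) = Polynomial.coeff p i * x ^ (Polynomial.degree p - i)"
        using False by (simp add: power_divide)
    qed simp
    also have "\<dots> \<in> B"
      using p(1) xB by (intro subring_sum[OF subring]) (auto intro: B_closed)
    finally show ?thesis using xB by blast
  qed
next
  fix x assume "x \<in> {x \<in> B. \<exists>n. x ^ n / \<omega> \<in> B}"
  then obtain n where n: "x \<in> B" "x ^ n / \<omega> \<in> B" by blast
  show "x \<in> nonunits"
  proof (rule ccontr)
    assume "x \<notin> nonunits"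
    then have x: "x \<noteq> 0" "1 / x \<in> B" using n by (auto simp: nonunits_def)
    then have "(1 / x) ^ n * (x ^ n / \<omega>) \<in> B"
      using n by (intro B_closed)
    moreover have "(1 / x) ^ n * (x ^ n / \<omega>) = 1 / \<omega>"
      using x by (simp add: power_divide)
    ultimately show False using \<omega> by simp
  qed
qed

lemma one_not_nonunit: "1 \<notin> nonunits"
  using B_closed by (auto simp: nonunits_def)

lemma nonunits_subset: "nonunits \<subseteq> B"
  by (auto simp: nonunits_def)

lemma nonunits_mult: "c \<in> B \<Longrightarrow> x \<in> nonunits \<Longrightarrow> c * x \<in> nonunits"
proof -
  assume c: "c \<in> B" and "x \<in> nonunits"
  then obtain n where x: "x \<in> B" "x ^ n / \<omega> \<in> B" by (auto simp: nonunits_eq)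
  have "(c * x) ^ n / \<omega> = c ^ n * (x ^ n / \<omega>)" by (simp add: power_mult_distrib)
  then have "(c * x) ^ n / \<omega> \<in> B" using c x B_closed by metis
  then show ?thesis using c x B_closed by (auto simp: nonunits_eq)
qed

lemma nonunits_add:
  assumes "x \<in> nonunits" "y \<in> nonunits"
  shows "x + y \<in> nonunits"
proof -
  obtain n m where x: "x \<in> B" "x ^ n / \<omega> \<in> B" and y: "y \<in> B" "y ^ m / \<omega> \<in> B"
    using assms by (auto simp: nonunits_eq)
  have "(x + y) ^ (n + m) / \<omega> = (\<Sum>k\<le>n+m. of_nat ((n+m) choose k) * x ^ k * y ^ (n + m - k) / \<omega>)"
    by (simp add: binomial_ring sum_divide_distrib)
  also have "\<dots> \<in> B"
  proof (rule subring_sum[OF subring])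
    fix k assume "k \<in> {..n+m}"
    show "of_nat ((n+m) choose k) * x ^ k * y ^ (n + m - k) / \<omega> \<in> B"
    proof (cases "n \<le> k")
      case True
      then have "of_nat ((n+m) choose k) * x ^ k * y ^ (n + m - k) / \<omega>
          = of_nat ((n+m) choose k) * (x ^ n / \<omega>) * (x ^ (k - n) * y ^ (n + m - k))"
        by (simp flip: power_add)
      then show ?thesis using x y B_closed by metis
    next
      case False
      then have "n + m - k = m + (n - k)" by simp
      then have "of_nat ((n+m) choose k) * x ^ k * y ^ (n + m - k) / \<omega>
          = of_nat ((n+m) choose k) * (y ^ m / \<omega>) * (x ^ k * y ^ (n - k))"
        by (simp add: power_add)
      then show ?thesis using x y B_closed by metis
    qed
  qed
  finally show ?thesis using x y B_closed by (auto simp: nonunits_eq)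
qed

lemma zero_nonunit: "0 \<in> nonunits"
  using B_closed by (auto simp: nonunits_def)

lemma nonunits_diff: "x \<in> nonunits \<Longrightarrow> y \<in> nonunits \<Longrightarrow> x - y \<in> nonunits"
  using nonunits_add[of x "(- 1) * y"] nonunits_mult[of "- 1" y] B_closed by simp

lemma nonunits_sum: "(\<And>i. i \<in> A \<Longrightarrow> g i \<in> nonunits) \<Longrightarrow> sum g A \<in> nonunits"
  by (induction A rule: infinite_finite_induct) (auto intro: nonunits_add zero_nonunit)

lemma \<omega>_nonunit: "\<omega> \<in> nonunits"
  using \<omega> by (auto simp: nonunits_def)

lemma one_minus_nonunit: "x \<in> nonunits \<Longrightarrow> 1 - x \<in> units"
  using nonunits_add[of "1 - x" x] one_not_nonunit nonunits_subset B_closed by (auto simp: units_eq)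

lemma units_mult: "u \<in> units \<Longrightarrow> w \<in> units \<Longrightarrow> u * w \<in> units"
  using B_closed(3)[of "1/u" "1/w"] by (auto simp: units_def intro: B_closed)

lemma units_inverse: "u \<in> units \<Longrightarrow> 1 / u \<in> units"
  by (auto simp: units_def)

lemma one_unit: "1 \<in> units"
  by (simp add: units_def B_closed)

lemma units_power: "u \<in> units \<Longrightarrow> u ^ n \<in> units"
  by (induction n) (simp_all add: units_mult one_unit)

text \<open>In the relation for \<open>1 / x\<close> the constant coefficient can be moved to the other side, where it
  leaves the unit \<open>u\<close>. Multiplying by \<open>x^n\<close> expresses \<open>x^n\<close> through lower powers of
  \<open>x\<close> with non-unit coefficients, and this replaces the leading term of \<open>p\<close>.\<close>

lemma shorten_relation:
  assumes x: "x \<noteq> 0"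
    and p: "\<And>i. Polynomial.coeff p i \<in> nonunits" "poly p x = 1"
    and q: "\<And>i. Polynomial.coeff q i \<in> nonunits" "poly q (1 / x) = 1"
    and deg: "Polynomial.degree q \<le> Polynomial.degree p"
  shows "\<exists>p'. (\<forall>i. Polynomial.coeff p' i \<in> nonunits) \<and> poly p' x = 1 \<and> Polynomial.degree p' < Polynomial.degree p"
proof -
  define n m where "n = Polynomial.degree p" and "m = Polynomial.degree q"
  have "n > 0"
  proof (rule ccontr)
    assume "\<not> n > 0"
    then have "poly p x = Polynomial.coeff p 0" by (simp add: poly_altdef n_def)
    then show False using p one_not_nonunit by metis
  qed
  define u where "u = 1 - Polynomial.coeff q 0"
  have u: "u \<in> units" unfolding u_def by (rule one_minus_nonunit[OF q(1)])
  have u0: "u \<noteq> 0" using u by (simp add: units_def)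
  have "1 = (\<Sum>j\<le>m. Polynomial.coeff q j * (1 / x) ^ j)"
    using q(2) by (simp add: poly_altdef m_def)
  also have "\<dots> = Polynomial.coeff q 0 + (\<Sum>j\<in>{1..m}. Polynomial.coeff q j * (1 / x) ^ j)"
    by (subst sum.atMost_shift) (simp add: sum.atLeast1_atMost_eq lessThan_Suc_atMost)
  finally have "u = (\<Sum>j\<in>{1..m}. Polynomial.coeff q j * (1 / x) ^ j)"
    by (simp add: u_def algebra_simps)
  then have "x ^ n * u = (\<Sum>j\<in>{1..m}. x ^ n * (Polynomial.coeff q j * (1 / x) ^ j))"
    by (simp add: sum_distrib_left)
  also have "\<dots> = (\<Sum>j\<in>{1..m}. Polynomial.coeff q j * x ^ (n - j))"
  proof (rule sum.cong)
    fix j assume "j \<in> {1..m}"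
    then have "x ^ n = x ^ (n - j) * x ^ j"
      using deg by (simp add: n_def m_def flip: power_add)
    then show "x ^ n * (Polynomial.coeff q j * (1 / x) ^ j) = Polynomial.coeff q j * x ^ (n - j)"
      using x by (simp add: power_divide)
  qed simp
  finally have xn: "x ^ n * u = (\<Sum>j\<in>{1..m}. Polynomial.coeff q j * x ^ (n - j))" .
  define s where "s = (\<Sum>j\<in>{1..m}. Polynomial.monom (Polynomial.coeff p n / u * Polynomial.coeff q j) (n - j))"
  define p' where "p' = p - Polynomial.monom (Polynomial.coeff p n) n + s"
  have ps: "poly s x = Polynomial.coeff p n * x ^ n"
  proof -
    have "poly s x = Polynomial.coeff p n / u * (\<Sum>j\<in>{1..m}. Polynomial.coeff q j * x ^ (n - j))"
      by (simp add: s_def poly_sum poly_monom sum_distrib_left mult.assoc)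
    then show ?thesis using u0 unfolding xn[symmetric] by simp
  qed
  have cs: "Polynomial.coeff s i \<in> nonunits" for i
  proof -
    have "Polynomial.coeff p n / u * Polynomial.coeff q j \<in> nonunits" for j
    proof -
      have "Polynomial.coeff p n / u \<in> B"
        using p(1)[of n] u nonunits_subset B_closed(3)[of "Polynomial.coeff p n" "1 / u"] by (auto simp: units_def)
      then show ?thesis using q(1) by (intro nonunits_mult)
    qed
    then show ?thesis
      unfolding s_def coeff_sum by (intro nonunits_sum) (auto simp: coeff_monom zero_nonunit)
  qed
  have "Polynomial.coeff p' i \<in> nonunits" for i
    unfolding p'_def using p(1) cs[of i]
    by (auto simp: coeff_monom intro!: nonunits_add nonunits_diff zero_nonunit)
  moreover have "poly p' x = 1"
    using p(2) ps by (simp add: p'_def poly_monom)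
  moreover have "Polynomial.degree p' < n"
  proof (rule degree_lessI)
    show "p' \<noteq> 0 \<or> n > 0" using \<open>n > 0\<close> by simp
    have "Polynomial.coeff s k = 0" if "k \<ge> n" for k
      unfolding s_def coeff_sum using that \<open>n > 0\<close> by (intro sum.neutral) (auto simp: coeff_monom)
    then show "\<forall>k\<ge>n. Polynomial.coeff p' k = 0"
      by (auto simp: p'_def coeff_monom n_def coeff_eq_0)
  qed
  ultimately show ?thesis by (auto simp: n_def)
qed

text \<open>If neither \<open>x\<close> nor \<open>1 / x\<close> were in \<open>B\<close>, adjoining either one would produce
  \<open>1 / \<omega>\<close>, hence one as a polynomial in it with non-unit coefficients. Of two such relations of least degree,
  the longer one can be shortened.\<close>

proposition valuation_ring:
  assumes x: "x \<noteq> 0"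
  shows "x \<in> B \<or> 1 / x \<in> B"
proof (rule ccontr)
  assume neg: "\<not> ?thesis"
  define rel where "rel = (\<lambda>y p. (\<forall>i. Polynomial.coeff p i \<in> nonunits) \<and> poly p y = 1)"
  have ex: "\<exists>p. rel y p" if y: "y \<notin> B" for y
  proof -
    have "1 / \<omega> \<in> adjoin B y"
      using maximal[OF subring_adjoin[OF subring] subset_adjoin[OF subring], of y]
        mem_adjoin[OF subring, of y] y by auto
    then obtain p where p: "\<And>i. Polynomial.coeff p i \<in> B" "1 / \<omega> = poly p y"
      by (metis adjoinE)
    have "rel y (Polynomial.smult \<omega> p)"
      using nonunits_mult[OF p(1) \<omega>_nonunit] \<omega>(2)
      by (simp add: rel_def mult.commute[of \<omega>] flip: p(2))
    then show ?thesis by blast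
  qed
  have min: "\<exists>p. rel y p \<and> (\<forall>p'. rel y p' \<longrightarrow> Polynomial.degree p \<le> Polynomial.degree p')" if "y \<notin> B" for y
    using ex_has_least_nat[of "rel y" _ Polynomial.degree] ex[OF that] by blast
  obtain p where p: "rel x p" "\<And>p'. rel x p' \<Longrightarrow> Polynomial.degree p \<le> Polynomial.degree p'"
    using min[of x] neg by blast
  obtain q where q: "rel (1 / x) q" "\<And>q'. rel (1 / x) q' \<Longrightarrow> Polynomial.degree q \<le> Polynomial.degree q'"
    using min[of "1 / x"] neg by blast
  show False
  proof (cases "Polynomial.degree q \<le> Polynomial.degree p")
    case True
    then show False
      using shorten_relation[of x p q] p q x unfolding rel_def by (metis not_le)
  next
    case False
    then show False
      using shorten_relation[of "1 / x" q p] p q x unfolding rel_def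
      by (metis not_le nle_le div_by_1 divide_divide_eq_right divide_eq_0_iff mult.left_neutral one_neq_zero)
  qed
qed

text \<open>In a valuation ring divisibility is a total preorder, so one of finitely many elements divides all of them.\<close>

lemma exists_dominating:
  assumes "finite T" "T \<noteq> {}" "0 \<notin> T"
  shows "\<exists>t\<in>T. \<forall>s\<in>T. s / t \<in> B"
  using assms
proof (induction T rule: finite_ne_induct)
  case (singleton x)
  then show ?case by (auto simp: B_closed)
next
  case (insert x T)
  then obtain t where t: "t \<in> T" "\<forall>s\<in>T. s / t \<in> B" by auto
  have nz: "x \<noteq> 0" "t \<noteq> 0" using insert t by auto
  show ?case
  proof (cases "x / t \<in> B")
    case True
    then show ?thesis using t by auto
  next
    case False
    then have "t / x \<in> B" using valuation_ring[of "x / t"] nz by auto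
    then have "s / x \<in> B" if "s \<in> T" for s
      using that t(2) nz B_closed(3)[of "s / t" "t / x"] by auto
    then show ?thesis using nz by (auto simp: B_closed)
  qed
qed

text \<open>In a vanishing sum the dominating term cannot be alone: otherwise, dividing by it, one would be a sum of non-units.\<close>

lemma balanced_terms:
  assumes x: "x \<noteq> 0" and p: "p \<noteq> 0" "poly p x = 0"
  shows "\<exists>i j. i < j \<and> Polynomial.coeff p i \<noteq> 0 \<and> Polynomial.coeff p j \<noteq> 0
    \<and> (Polynomial.coeff p j * x ^ j) / (Polynomial.coeff p i * x ^ i) \<in> units"
proof -
  define I where "I = {i. i \<le> Polynomial.degree p \<and> Polynomial.coeff p i \<noteq> 0}"
  define t where "t = (\<lambda>i. Polynomial.coeff p i * x ^ i)"
  have I: "finite I" "Polynomial.degree p \<in> I" using p by (auto simp: I_def)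
  have nz: "t i \<noteq> 0" if "i \<in> I" for i using that x by (simp add: t_def I_def)
  obtain i where i: "i \<in> I" "\<And>j. j \<in> I \<Longrightarrow> t j / t i \<in> B"
    using exists_dominating[of "t ` I"] I nz by force
  have "\<exists>j\<in>I - {i}. t j / t i \<in> units"
  proof (rule ccontr)
    assume "\<not> ?thesis"
    then have "(\<Sum>j\<in>I - {i}. t j / t i) \<in> nonunits"
      using i(2) by (intro nonunits_sum) (auto simp: units_eq)
    moreover have "(\<Sum>j\<in>I. t j) = 0"
    proof -
      have "(\<Sum>j\<in>I. t j) = (\<Sum>j\<le>Polynomial.degree p. t j)"
        by (rule sum.mono_neutral_left) (auto simp: I_def t_def)
      then show ?thesis using p(2) by (simp add: poly_altdef t_def)
    qed
    then have "(\<Sum>j\<in>I. t j / t i) = 0" by (simp flip: sum_divide_distrib)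
    then have "1 + (\<Sum>j\<in>I - {i}. t j / t i) = 0"
      using nz[OF i(1)] by (simp add: sum.remove[OF I(1) i(1)])
    then have "1 = 0 - (\<Sum>j\<in>I - {i}. t j / t i)"
      by (simp add: eq_neg_iff_add_eq_0)
    ultimately show False
      using one_not_nonunit nonunits_diff[OF zero_nonunit] by metis
  qed
  then obtain j where j: "j \<in> I" "j \<noteq> i" "t j / t i \<in> units" by blast
  have c: "Polynomial.coeff p i \<noteq> 0" "Polynomial.coeff p j \<noteq> 0" using i j by (auto simp: I_def)
  show ?thesis
  proof (cases "i < j")
    case True
    then show ?thesis using j c by (auto simp: t_def)
  next
    case False
    then have "j < i" using j(2) by simp
    moreover have "t i / t j \<in> units" using units_inverse[OF j(3)] by simp
    ultimately show ?thesis using c unfolding t_def by blast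
  qed
qed

end

section \<open>The norm attached to a valuation ring of rank one\<close>

text \<open>Some positive power of every nonzero element is a power of \<open>\<pi>\<close> up to a unit. The value group
  is then contained in the rational multiples of the value of \<open>\<pi>\<close>, and the valuation is given by a
  real-valued norm.\<close>

locale discretely_commensurable = maximal_avoiding_inverse +
  fixes \<pi> :: 'a
  assumes \<pi>: "\<pi> \<noteq> 0" "\<pi> \<in> nonunits"
    and commensurable: "\<And>x. x \<noteq> 0 \<Longrightarrow> \<exists>n>0. \<exists>k. \<exists>u\<in>units. x ^ n = \<pi> powi k * u"
begin

lemma \<pi>_power_nonunit: "j > 0 \<Longrightarrow> \<pi> ^ j \<in> nonunits"
  using nonunits_mult[OF B_closed(7) \<pi>(2), of \<pi> "j - 1"] \<pi>(2) nonunits_subset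
  by (auto simp flip: power_Suc2)

lemma unit_power_\<pi>:
  assumes "\<pi> powi j \<in> units"
  shows "j = 0"
proof (rule ccontr)
  assume "j \<noteq> 0"
  have "\<pi> ^ nat \<bar>j\<bar> \<in> units"
  proof (cases "j > 0")
    case True
    then show ?thesis using assms by (simp add: power_int_def)
  next
    case False
    then have "\<pi> powi j = 1 / \<pi> ^ nat \<bar>j\<bar>"
      using \<open>j \<noteq> 0\<close> by (simp add: power_int_def power_one_over inverse_eq_divide)
    then show ?thesis using units_inverse[OF assms] by simp
  qed
  moreover have "\<pi> ^ nat \<bar>j\<bar> \<in> nonunits"
    using \<open>j \<noteq> 0\<close> by (intro \<pi>_power_nonunit) simp
  ultimately show False by (simp add: units_eq)
qed

text \<open>The norm is normalised by \<open>|\<pi>| = 1/2\<close>; the exponent \<open>- k / n\<close> comes from any relation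
  \<open>x^n = \<pi>^k u\<close> with a unit \<open>u\<close>.\<close>

definition val :: "'a \<Rightarrow> real" where
  "val x = (if x = 0 then 0 else
     2 powr (SOME s. \<exists>n>0. \<exists>k. \<exists>u\<in>units. x ^ n = \<pi> powi k * u \<and> s = - of_int k / real n))"

text \<open>Two relations for the same \<open>x\<close> have proportional exponents, since no power of \<open>\<pi>\<close> with a nonzero exponent
  is a unit.\<close>

lemma val_eqI:
  assumes n: "n > 0" and u: "u \<in> units" and x: "x ^ n = \<pi> powi k * u"
  shows "val x = 2 powr (- of_int k / real n)"
proof -
  have "u \<noteq> 0" using u by (simp add: units_def)
  then have "x ^ n \<noteq> 0"
    using \<pi>(1) unfolding x by simp
  then have x0: "x \<noteq> 0" using n by auto
  let ?P = "\<lambda>s. \<exists>n>0. \<exists>k. \<exists>u\<in>units. x ^ n = \<pi> powi k * u \<and> s = - of_int k / real n"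
  have "?P (- of_int k / real n)" using assms by blast
  moreover have "s = - of_int k / real n" if "?P s" for s
  proof -
    obtain m l w where m: "m > 0" "w \<in> units" "x ^ m = \<pi> powi l * w" "s = - of_int l / real m"
      using \<open>?P s\<close> by blast
    have "\<pi> powi (k * int m) * u ^ m = (x ^ n) ^ m"
      unfolding x by (simp add: power_mult_distrib power_int_mult)
    also have "\<dots> = (x ^ m) ^ n"
      by (simp flip: power_mult add: mult.commute)
    also have "\<dots> = \<pi> powi (l * int n) * w ^ n"
      unfolding m(3) by (simp add: power_mult_distrib power_int_mult)
    finally have "\<pi> powi (k * int m - l * int n) = w ^ n * (1 / u ^ m)"
      using \<pi>(1) \<open>u \<noteq> 0\<close> by (simp add: power_int_diff field_simps)
    also have "\<dots> \<in> units"
      using u m(2) by (intro units_mult units_inverse units_power)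
    finally have "k * int m = l * int n"
      using unit_power_\<pi> by fastforce
    then have "of_int k * real m = of_int l * real n"
      by (metis of_int_mult of_int_of_nat_eq)
    then have "of_int l / real m = of_int k / real n"
      using m(1) n by (simp add: frac_eq_eq)
    then show ?thesis
      using m(4) by simp
  qed
  ultimately have "(SOME s. ?P s) = - of_int k / real n"
    by (rule someI2)
  then show ?thesis
    using x0 by (simp add: val_def)
qed

lemma val_unit: "u \<in> units \<Longrightarrow> val u = 1"
  using val_eqI[of 1 u u 0] by simp

lemma val_\<pi>: "val \<pi> = 1 / 2"
  using val_eqI[of 1 1 \<pi> 1] one_unit by (simp add: powr_minus)

lemma val_zero: "val 0 = 0"
  by (simp add: val_def)

lemma val_pos: "x \<noteq> 0 \<Longrightarrow> val x > 0"
  by (simp add: val_def)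

lemma val_mult: "val (x * y) = val x * val y"
proof (cases "x = 0 \<or> y = 0")
  case True
  then show ?thesis by (auto simp: val_zero)
next
  case False
  then obtain n k u m l w where x: "n > 0" "u \<in> units" "x ^ n = \<pi> powi k * u"
      and y: "m > 0" "w \<in> units" "y ^ m = \<pi> powi l * w"
    using commensurable[of x] commensurable[of y] by metis
  have "(x * y) ^ (n * m) = (x ^ n) ^ m * (y ^ m) ^ n"
    by (simp add: power_mult_distrib mult.commute flip: power_mult)
  also have "\<dots> = \<pi> powi (k * int m + l * int n) * (u ^ m * w ^ n)"
    unfolding x(3) y(3) using \<pi>(1) by (simp add: power_mult_distrib power_int_mult power_int_add)
  finally have "val (x * y) = 2 powr (- of_int (k * int m + l * int n) / real (n * m))"
    using x y by (intro val_eqI[of _ "u ^ m * w ^ n"] units_mult units_power) auto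
  also have "- of_int (k * int m + l * int n) / real (n * m) = - of_int k / real n + - of_int l / real m"
    using x(1) y(1) by (simp add: field_simps)
  finally show ?thesis
    using val_eqI[OF x] val_eqI[OF y] by (simp only: powr_add)
qed

lemma val_le_one:
  assumes "x \<in> B"
  shows "val x \<le> 1"
proof (cases "x = 0")
  case False
  then obtain n k u where x: "n > 0" "u \<in> units" "x ^ n = \<pi> powi k * u"
    using commensurable[of x] by metis
  have "k \<ge> 0"
  proof (rule ccontr)
    assume "\<not> k \<ge> 0"
    then have "\<pi> powi (- k) = \<pi> ^ nat (- k)"
      by (simp add: power_int_def)
    then have "\<pi> powi (- k) \<in> nonunits"
      using \<open>\<not> k \<ge> 0\<close> \<pi>_power_nonunit[of "nat (- k)"] by simp
    then have "x ^ n * \<pi> powi (- k) \<in> nonunits"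
      using assms by (intro nonunits_mult B_closed)
    moreover have "x ^ n * \<pi> powi (- k) = u"
      unfolding x(3) using \<pi>(1) by (simp add: power_int_minus)
    ultimately show False using x(2) by (simp add: units_eq)
  qed
  then have "2 powr (- of_int k / real n) \<le> 2 powr 0"
    using x(1) by (intro powr_mono) (auto simp: field_simps)
  then show ?thesis
    using val_eqI[OF x] by simp
qed (simp add: val_zero)

text \<open>One of \<open>y / x\<close> and \<open>x / y\<close> is in the valuation ring, hence also one plus it.\<close>

lemma val_add: "val (x + y) \<le> max (val x) (val y)"
proof -
  have le: "val (x + y) \<le> val x" if "x \<noteq> 0" "y / x \<in> B" for x y
  proof -
    have "val (1 + y / x) \<le> 1"
      using that(2) by (intro val_le_one B_closed)
    then have "val x * val (1 + y / x) \<le> val x * 1"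
      using val_pos[OF that(1)] by (intro mult_left_mono) auto
    then show ?thesis
      using that(1) by (simp add: distrib_left flip: val_mult)
  qed
  show ?thesis
  proof (cases "x = 0 \<or> y = 0")
    case False
    then consider "y / x \<in> B" | "x / y \<in> B"
      using valuation_ring[of "x / y"] by auto
    then show ?thesis
    proof cases
      case 1
      then show ?thesis using le[of x y] False by auto
    next
      case 2
      then show ?thesis using le[of y x] False by (auto simp: add.commute)
    qed
  qed (auto simp: val_zero)
qed

lemma field_norm_val: "field_norm ring_of_type_algebra val"
  unfolding field_norm_def ring_of_type_algebra_def
proof (intro conjI ballI)
  have nonneg: "0 \<le> val x" for x
    using val_pos[of x] by (cases "x = 0") (auto simp: val_zero)
  fix x y :: 'a
  show "0 \<le> val x" by (rule nonneg)
  have "val (x + y) \<le> val x + val y"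
    using val_add[of x y] nonneg[of x] nonneg[of y] by linarith
  then show "val (x \<oplus>\<^bsub>\<lparr>carrier = UNIV, monoid.mult = (*), one = 1, zero = 0, add = (+)\<rparr>\<^esub> y) \<le> val x + val y"
    by simp
qed (use val_pos in \<open>force simp: val_zero val_mult\<close>)+

end

definition fractions :: "'f::field set \<Rightarrow> 'f set" where
  "fractions R = {a / b | a b. a \<in> R \<and> b \<in> R \<and> b \<noteq> 0}"

text \<open>A common setting for the integers in a number field and for \<open>K[t]\<close> in a function field. The
  last assumption does the work of the existence of infinitely many primes: some non-unit is coprime to
  any given \<open>D\<close>.\<close>

locale euclidean_subring =
  fixes R :: "'f::field set" and size :: "'f \<Rightarrow> nat"
  assumes subring_R: "is_subring R"
    and division: "\<And>a b. a \<in> R \<Longrightarrow> b \<in> R \<Longrightarrow> b \<noteq> 0 \<Longrightarrow>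
        \<exists>q\<in>R. a - q * b = 0 \<or> size (a - q * b) < size b"
    and size_less: "\<And>a b. a \<in> R \<Longrightarrow> b \<in> R \<Longrightarrow> a \<noteq> 0 \<Longrightarrow> b \<noteq> 0 \<Longrightarrow> 1 / a \<notin> R \<Longrightarrow> size b < size (a * b)"
    and algebraic: "\<And>x. \<exists>p. p \<noteq> 0 \<and> (\<forall>i. Polynomial.coeff p i \<in> fractions R) \<and> poly p x = 0"
    and coprime_nonunit: "\<And>D. D \<in> R \<Longrightarrow> D \<noteq> 0 \<Longrightarrow>
        \<exists>\<omega>\<in>R. \<omega> \<noteq> 0 \<and> 1 / \<omega> \<notin> R \<and> (\<exists>a\<in>R. \<exists>b\<in>R. a * D + b * \<omega> = 1)"
begin

text \<open>The non-units of \<open>B\<close> that lie in \<open>R\<close> form a prime ideal of \<open>R\<close>. An element of least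
  size generates it by Euclidean division, and repeated division by this generator ends because
  the size decreases.\<close>

lemma exists_uniformizer:
  assumes B: "maximal_avoiding_inverse B \<omega>" and RB: "R \<subseteq> B" and \<omega>R: "\<omega> \<in> R"
  shows "\<exists>\<pi>\<in>R. \<pi> \<noteq> 0 \<and> \<pi> \<in> maximal_avoiding_inverse.nonunits B \<and>
     (\<forall>c\<in>R. c \<noteq> 0 \<longrightarrow> (\<exists>k. \<exists>u\<in>maximal_avoiding_inverse.units B. c = \<pi> ^ k * u))"
proof -
  interpret maximal_avoiding_inverse B \<omega> by (rule B)
  note R = is_subringD[OF subring_R]
  let ?P = "\<lambda>a. a \<in> R \<and> a \<noteq> 0 \<and> a \<in> nonunits"
  have "?P \<omega>" using \<omega>R \<omega> \<omega>_nonunit by simp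
  then obtain \<pi> where \<pi>: "?P \<pi>" "\<And>a. ?P a \<Longrightarrow> size \<pi> \<le> size a"
    using ex_has_least_nat[of ?P \<omega> size] by blast
  have "1 / \<pi> \<notin> R"
    using \<pi>(1) RB by (auto simp: nonunits_def)
  have "\<exists>k. \<exists>u\<in>units. c = \<pi> ^ k * u" if "c \<in> R" "c \<noteq> 0" for c
    using that
  proof (induction "size c" arbitrary: c rule: less_induct)
    case less
    show ?case
    proof (cases "c \<in> nonunits")
      case False
      then have "c \<in> units" using less.prems RB by (auto simp: units_eq)
      then show ?thesis by (intro exI[of _ 0]) auto
    next
      case True
      obtain q where q: "q \<in> R" "c - q * \<pi> = 0 \<or> size (c - q * \<pi>) < size \<pi>"
        using division[of c \<pi>] less.prems \<pi>(1) by blast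
      have "c - q * \<pi> \<in> R" "c - q * \<pi> \<in> nonunits"
        using True less.prems q \<pi>(1) RB by (auto intro!: nonunits_diff nonunits_mult R)
      then have c: "c = \<pi> * q"
        using q(2) \<pi>(2)[of "c - q * \<pi>"] by (metis eq_iff_diff_eq_0 mult.commute not_le)
      then have "q \<noteq> 0" using less.prems by auto
      then have "size q < size c"
        unfolding c using size_less[of \<pi> q] \<pi>(1) q(1) \<open>1 / \<pi> \<notin> R\<close> by blast
      then obtain k u where "u \<in> units" "q = \<pi> ^ k * u"
        using less.hyps q(1) \<open>q \<noteq> 0\<close> by blast
      then show ?thesis
        unfolding c by (intro exI[of _ "Suc k"]) auto
    qed
  qed
  then show ?thesis using \<pi>(1) by blast
qed

text \<open>An algebraic equation for \<open>x\<close> over the fractions of \<open>R\<close> has two terms that agree up to a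
  unit, and their coefficients are powers of \<open>\<pi>\<close> up to units. Hence a power of \<open>x\<close> is
  one too.\<close>

lemma commensurable_with_uniformizer:
  assumes B: "maximal_avoiding_inverse B \<omega>"
    and \<pi>: "\<pi> \<noteq> 0"
    and factor: "\<And>c. c \<in> R \<Longrightarrow> c \<noteq> 0 \<Longrightarrow> \<exists>k. \<exists>u\<in>maximal_avoiding_inverse.units B. c = \<pi> ^ k * u"
    and x: "x \<noteq> 0"
  shows "\<exists>n>0. \<exists>k. \<exists>u\<in>maximal_avoiding_inverse.units B. x ^ n = \<pi> powi k * u"
proof -
  interpret maximal_avoiding_inverse B \<omega> by (rule B)
  have frac: "\<exists>k. \<exists>u\<in>units. e = \<pi> powi k * u" if e: "e \<in> fractions R" "e \<noteq> 0" for e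
  proof -
    obtain a b where ab: "a \<in> R" "b \<in> R" "a \<noteq> 0" "b \<noteq> 0" "e = a / b"
      using e by (auto simp: fractions_def)
    obtain k u l w where u: "u \<in> units" "a = \<pi> ^ k * u" and w: "w \<in> units" "b = \<pi> ^ l * w"
      using factor ab by metis
    have "e = \<pi> powi (int k - int l) * (u * (1 / w))"
      using ab(5) u w \<pi> by (simp add: power_int_diff)
    moreover have "u * (1 / w) \<in> units"
      using u w by (intro units_mult units_inverse)
    ultimately show ?thesis by blast
  qed
  obtain p where p: "p \<noteq> 0" "\<And>i. Polynomial.coeff p i \<in> fractions R" "poly p x = 0"
    using algebraic[of x] by blast
  obtain i j where ij: "i < j" "Polynomial.coeff p i \<noteq> 0" "Polynomial.coeff p j \<noteq> 0"
      "(Polynomial.coeff p j * x ^ j) / (Polynomial.coeff p i * x ^ i) \<in> units" (is "?w \<in> units")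
    using balanced_terms[OF x p(1,3)] by blast
  obtain k u where k: "u \<in> units" "Polynomial.coeff p i = \<pi> powi k * u"
    using frac[OF p(2) ij(2)] by blast
  obtain l v where l: "v \<in> units" "Polynomial.coeff p j = \<pi> powi l * v"
    using frac[OF p(2) ij(3)] by blast
  have "x ^ j = x ^ (j - i) * x ^ i"
    using ij(1) by (simp flip: power_add)
  then have "x ^ (j - i) = ?w * Polynomial.coeff p i / Polynomial.coeff p j"
    using x ij(2,3) by simp
  also have "\<dots> = \<pi> powi (k - l) * (?w * u * (1 / v))"
    unfolding k(2) l(2) using \<pi> by (simp add: power_int_diff)
  finally have "x ^ (j - i) = \<pi> powi (k - l) * (?w * u * (1 / v))" .
  moreover have "?w * u * (1 / v) \<in> units"
    using ij(4) k(1) l(1) by (intro units_mult units_inverse)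
  ultimately show ?thesis
    using ij(1) by (metis zero_less_diff)
qed

text \<open>The product of all numerators and denominators works: where it is invertible, so are they.\<close>

lemma common_denominator:
  assumes "finite E" "E \<subseteq> fractions R - {0}"
  shows "\<exists>D\<in>R. D \<noteq> 0 \<and> (\<forall>B. is_subring B \<longrightarrow> R \<subseteq> B \<longrightarrow> 1 / D \<in> B \<longrightarrow>
      (\<forall>e\<in>E. e \<in> B \<and> 1 / e \<in> B))"
  using assms
proof (induction E rule: finite_induct)
  case empty
  then show ?case using subring_one[OF subring_R] by (intro bexI[of _ 1]) auto
next
  case (insert e E)
  obtain D where D: "D \<in> R" "D \<noteq> 0"
      "\<And>B. is_subring B \<Longrightarrow> R \<subseteq> B \<Longrightarrow> 1 / D \<in> B \<Longrightarrow> \<forall>e\<in>E. e \<in> B \<and> 1 / e \<in> B"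
    using insert by auto
  have e: "e \<in> fractions R" "e \<noteq> 0"
    using insert.prems by simp_all
  then obtain a b where "a \<in> R" "b \<in> R" "b \<noteq> 0" "e = a / b"
    unfolding fractions_def by blast
  with e(2) have ab: "a \<in> R" "b \<in> R" "a \<noteq> 0" "b \<noteq> 0" "e = a / b"
    by simp_all
  have "\<forall>e\<in>insert e E. e \<in> B \<and> 1 / e \<in> B"
    if B: "is_subring B" "R \<subseteq> B" "1 / (a * b * D) \<in> B" for B
  proof -
    note m = subring_mult[OF B(1)]
    have el: "a \<in> B" "b \<in> B" "D \<in> B" using ab(1,2) D(1) B(2) by auto
    have "(a * b) * (1 / (a * b * D)) \<in> B" "(a * a * D) * (1 / (a * b * D)) \<in> B"
      "(b * b * D) * (1 / (a * b * D)) \<in> B"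
      by (intro m el B(3))+
    moreover have "(a * b) * (1 / (a * b * D)) = 1 / D" "(a * a * D) * (1 / (a * b * D)) = e"
      "(b * b * D) * (1 / (a * b * D)) = 1 / e"
      using ab(3,4) D(2) by (simp_all add: ab(5))
    ultimately have "1 / D \<in> B" "e \<in> B" "1 / e \<in> B"
      by simp_all
    then show ?thesis using D(3)[OF B(1,2)] by blast
  qed
  moreover have "a * b * D \<in> R"
    by (intro subring_mult[OF subring_R] ab(1,2) D(1))
  moreover have "a * b * D \<noteq> 0"
    using ab(3,4) D(2) by simp
  ultimately show ?case
    by blast
qed

text \<open>Choose \<open>\<omega>\<close> coprime to a common multiple \<open>D\<close> of the numerators and denominators of all
  coefficients in algebraic equations for the elements of \<open>C\<close>. In a maximal subring avoiding
  \<open>1 / \<omega>\<close> these coefficients are units, so two balanced terms of the equation for \<open>c\<close> show that a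
  power of \<open>c\<close> is a unit.\<close>

proposition exists_norm_equal_one_on:
  assumes C: "finite C" "0 \<notin> C"
  shows "\<exists>N. field_norm ring_of_type_algebra N \<and> (\<exists>x. x \<noteq> 0 \<and> N x \<noteq> 1) \<and>
     (\<forall>x\<in>R. N x \<le> 1) \<and> (\<forall>x\<in>R. x \<noteq> 0 \<longrightarrow> 1 / x \<in> R \<longrightarrow> N x = 1) \<and> (\<forall>c\<in>C. N c = 1)"
proof -
  obtain P where P: "\<And>x. P x \<noteq> 0" "\<And>x i. Polynomial.coeff (P x) i \<in> fractions R" "\<And>x. poly (P x) x = 0"
    using algebraic by metis
  define E where "E = (\<Union>c\<in>C. Polynomial.coeff (P c) ` {..Polynomial.degree (P c)}) - {0}"
  have "finite E" "E \<subseteq> fractions R - {0}"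
    using C P(2) by (auto simp: E_def)
  then obtain D where D: "D \<in> R" "D \<noteq> 0"
      "\<And>B. is_subring B \<Longrightarrow> R \<subseteq> B \<Longrightarrow> 1 / D \<in> B \<Longrightarrow> \<forall>e\<in>E. e \<in> B \<and> 1 / e \<in> B"
    using common_denominator by metis
  obtain \<omega> a b where \<omega>R: "\<omega> \<in> R" "\<omega> \<noteq> 0" "1 / \<omega> \<notin> R" and ab: "a \<in> R" "b \<in> R" "a * D + b * \<omega> = 1"
    using coprime_nonunit[OF D(1,2)] by blast
  obtain B where B: "R \<subseteq> B" "maximal_avoiding_inverse B \<omega>"
    using exists_maximal_avoiding_inverse[OF subring_R \<omega>R] by blast
  interpret maximal_avoiding_inverse B \<omega> by (rule B(2))
  have "D \<notin> nonunits"
  proof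
    assume "D \<in> nonunits"
    then have "a * D + b * \<omega> \<in> nonunits"
      using ab B(1) \<omega>_nonunit by (intro nonunits_add nonunits_mult) auto
    then show False using ab(3) one_not_nonunit by simp
  qed
  then have "1 / D \<in> B" using D(1,2) B(1) by (auto simp: nonunits_def)
  then have "\<forall>e\<in>E. e \<in> B \<and> 1 / e \<in> B"
    by (rule D(3)[OF subring B(1)])
  moreover have "0 \<notin> E"
    by (simp add: E_def)
  ultimately have E: "e \<in> units" if "e \<in> E" for e
    using that unfolding units_def by blast
  obtain \<pi> where \<pi>: "\<pi> \<in> R" "\<pi> \<noteq> 0" "\<pi> \<in> nonunits"
      "\<And>c. c \<in> R \<Longrightarrow> c \<noteq> 0 \<Longrightarrow> \<exists>k. \<exists>u\<in>units. c = \<pi> ^ k * u"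
    using exists_uniformizer[OF B(2,1) \<omega>R(1)] by blast
  interpret discretely_commensurable B \<omega> \<pi>
    using \<pi> commensurable_with_uniformizer[OF B(2) \<pi>(2,4)] by unfold_locales
  have "val c = 1" if c: "c \<in> C" for c
  proof -
    have c0: "c \<noteq> 0" using c C by auto
    obtain i j where ij: "i < j" "Polynomial.coeff (P c) i \<noteq> 0" "Polynomial.coeff (P c) j \<noteq> 0"
        "(Polynomial.coeff (P c) j * c ^ j) / (Polynomial.coeff (P c) i * c ^ i) \<in> units" (is "?w \<in> units")
      using balanced_terms[OF c0 P(1,3)] by blast
    have co: "Polynomial.coeff (P c) l \<in> units" if "Polynomial.coeff (P c) l \<noteq> 0" for l
    proof (rule E)
      have "Polynomial.coeff (P c) l \<in> Polynomial.coeff (P c) ` {..Polynomial.degree (P c)}"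
        using le_degree[OF that] by (intro imageI) simp
      then show "Polynomial.coeff (P c) l \<in> E"
        using that c by (auto simp only: E_def)
    qed
    have "c ^ j = c ^ (j - i) * c ^ i"
      using ij(1) by (simp flip: power_add)
    then have "c ^ (j - i) = ?w * Polynomial.coeff (P c) i * (1 / Polynomial.coeff (P c) j)"
      using c0 ij(2,3) by simp
    also have "\<dots> \<in> units"
      using ij by (intro units_mult units_inverse co)
    finally have "val c = 2 powr (- of_int 0 / real (j - i))"
      using ij(1) by (intro val_eqI[of _ "c ^ (j - i)"]) auto
    then show ?thesis by simp
  qed
  moreover have "val x = 1" if "x \<in> R" "x \<noteq> 0" "1 / x \<in> R" for x
    using that B(1) by (intro val_unit) (auto simp: units_def)
  moreover have "val x \<le> 1" if "x \<in> R" for x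
    using that B(1) val_le_one by blast
  moreover have "\<pi> \<noteq> 0 \<and> val \<pi> \<noteq> 1"
    using \<pi> val_\<pi> by simp
  ultimately show ?thesis
    using field_norm_val by blast
qed

end

section \<open>Equivalent norms\<close>

abbreviation type_ring :: "'f::field ring" where
  "type_ring \<equiv> ring_of_type_algebra"

lemma type_ring_simps [simp]:
  "carrier (type_ring :: 'f::field ring) = UNIV"
  "x \<otimes>\<^bsub>type_ring\<^esub> y = x * y" "x \<oplus>\<^bsub>type_ring\<^esub> y = x + y"
  "\<zero>\<^bsub>type_ring\<^esub> = (0 :: 'f)" "\<one>\<^bsub>type_ring\<^esub> = (1 :: 'f)"
  by (simp_all add: ring_of_type_algebra_def)

lemma type_ring_uminus: "\<ominus>\<^bsub>type_ring\<^esub> x = - (x :: 'f::field)"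
proof -
  interpret field "type_ring :: 'f ring" by (rule field_from_type_algebra)
  show ?thesis by (rule minus_equality) simp_all
qed

lemma type_ring_minus: "x \<ominus>\<^bsub>type_ring\<^esub> y = x - (y :: 'f::field)"
  by (simp add: a_minus_def type_ring_uminus)

lemma type_ring_inv: "x \<noteq> 0 \<Longrightarrow> inv\<^bsub>type_ring\<^esub> x = 1 / (x :: 'f::field)"
proof -
  assume "x \<noteq> 0"
  interpret field "type_ring :: 'f ring" by (rule field_from_type_algebra)
  show ?thesis using \<open>x \<noteq> 0\<close> by (intro comm_inv_char) simp_all
qed

lemma type_ring_nat_pow: "x [^]\<^bsub>type_ring\<^esub> (n::nat) = (x :: 'f::field) ^ n"
proof -
  interpret field "type_ring :: 'f ring" by (rule field_from_type_algebra)
  show ?thesis by (induction n) auto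
qed

lemma field_normD:
  assumes "field_norm (type_ring :: 'f::field ring) N"
  shows field_norm_eq_0: "N x = 0 \<longleftrightarrow> x = 0"
    and field_norm_pos: "x \<noteq> 0 \<Longrightarrow> 0 < N x"
    and field_norm_mult: "N (x * y) = N x * N y"
    and field_norm_power: "N (x ^ n) = N x ^ n"
    and field_norm_inverse: "x \<noteq> 0 \<Longrightarrow> N (1 / x) = 1 / N x"
proof -
  have nn: "0 \<le> N x" for x using assms by (simp add: field_norm_def)
  show z: "N x = 0 \<longleftrightarrow> x = 0" for x using assms by (simp add: field_norm_def)
  show p: "x \<noteq> 0 \<Longrightarrow> 0 < N x" for x using nn[of x] z[of x] by linarith
  show m: "N (x * y) = N x * N y" for x y using assms by (simp add: field_norm_def)
  have one: "N 1 = 1" using m[of 1 1] z[of 1] by simp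
  show "N (x ^ n) = N x ^ n" by (induction n) (simp_all add: one m)
  show "x \<noteq> 0 \<Longrightarrow> N (1 / x) = 1 / N x" using m[of x "1 / x"] one p[of x] by (simp add: field_simps)
qed

text \<open>This describes the open unit ball in terms of the topology alone, and so makes it an invariant of the
  equivalence class of the norm.\<close>

lemma powers_tend_to_zero_iff:
  fixes N :: "'f::field \<Rightarrow> real"
  assumes N: "field_norm type_ring N"
  shows "limitin (mtopology_of (norm_metric type_ring UNIV N)) (\<lambda>n. x ^ n) 0 sequentially \<longleftrightarrow> N x < 1"
proof -
  let ?d = "\<lambda>x y. if x \<in> carrier type_ring \<and> y \<in> carrier type_ring then N (x \<ominus>\<^bsub>type_ring\<^esub> y) else 0"
  interpret Metric_space UNIV ?d
    by (rule norm_metric_Metric_space[OF field_from_type_algebra N]) simp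
  have "limitin (mtopology_of (norm_metric type_ring UNIV N)) (\<lambda>n. x ^ n) 0 sequentially
      \<longleftrightarrow> (\<forall>\<epsilon>>0. \<exists>n0. \<forall>n\<ge>n0. N x ^ n < \<epsilon>)"
    unfolding norm_metric_def mtopology_of limit_metric_sequentially
    by (simp add: type_ring_minus field_norm_power[OF N])
  also have "\<dots> \<longleftrightarrow> N x < 1"
  proof
    assume "\<forall>\<epsilon>>0. \<exists>n0. \<forall>n\<ge>n0. N x ^ n < \<epsilon>"
    then obtain n where "N x ^ n < 1" using zero_less_one by blast
    then show "N x < 1" using one_le_power[of "N x" n] by linarith
  next
    assume "N x < 1"
    moreover have "0 \<le> N x" using N by (simp add: field_norm_def)
    ultimately have "(\<lambda>n. N x ^ n) \<longlonglongrightarrow> 0" by (intro LIMSEQ_power_zero) simp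
    then show "\<forall>\<epsilon>>0. \<exists>n0. \<forall>n\<ge>n0. N x ^ n < \<epsilon>"
      using order_tendstoD(2)[of _ 0 sequentially] unfolding eventually_sequentially by blast
  qed
  finally show ?thesis .
qed

lemma norm_equivD:
  fixes N M :: "'f::field \<Rightarrow> real"
  assumes "(N, M) \<in> norm_equiv"
  shows norm_equiv_norms: "field_norm type_ring N" "field_norm type_ring M"
    and norm_equiv_less_one: "N x < 1 \<longleftrightarrow> M x < 1"
    and norm_equiv_eq_one: "N x = 1 \<Longrightarrow> M x = 1"
    and norm_equiv_le_one: "N x \<le> 1 \<Longrightarrow> M x \<le> 1"
proof -
  have nN: "field_norm type_ring N" and nM: "field_norm type_ring M"
    and top: "mtopology_of (norm_metric type_ring UNIV N) = mtopology_of (norm_metric type_ring UNIV M)"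
    using assms by (auto simp: norm_equiv_def)
  show "field_norm type_ring N" "field_norm type_ring M" by (fact nN nM)+
  show less: "N x < 1 \<longleftrightarrow> M x < 1" for x
    using powers_tend_to_zero_iff[OF nN, of x] powers_tend_to_zero_iff[OF nM, of x] top by simp
  have le: "N x \<le> 1 \<Longrightarrow> M x \<le> 1" for x
  proof (cases "x = 0")
    case True
    have "M 0 = 0" using field_norm_eq_0[OF nM] by blast
    then show ?thesis using True by simp
  next
    case False
    assume "N x \<le> 1"
    then have "\<not> N (1 / x) < 1"
      using False field_norm_pos[OF nN False] by (simp add: field_norm_inverse[OF nN] field_simps)
    then have "\<not> M (1 / x) < 1" using less by simp
    then show ?thesis
      using False field_norm_pos[OF nM False] by (simp add: field_norm_inverse[OF nM] field_simps)
  qed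
  then show "N x \<le> 1 \<Longrightarrow> M x \<le> 1" .
  show "N x = 1 \<Longrightarrow> M x = 1"
    using le[of x] less[of x] by simp
qed

section \<open>Algebraic elements over a generated field\<close>

lemma fractions_closed:
  assumes R: "is_subring R" and "x \<in> fractions R" "y \<in> fractions R"
  shows "x + y \<in> fractions R" "x * y \<in> fractions R" "- x \<in> fractions R" "1 / x \<in> fractions R"
proof -
  obtain a b c d where x: "a \<in> R" "b \<in> R" "b \<noteq> 0" "x = a / b" and y: "c \<in> R" "d \<in> R" "d \<noteq> 0" "y = c / d"
    using assms(2,3) unfolding fractions_def by blast
  note B = is_subringD[OF R]
  have fr: "p / q \<in> fractions R" if "p \<in> R" "q \<in> R" "q \<noteq> 0" for p q
    using that by (auto simp: fractions_def)
  have "(a * d + c * b) / (b * d) \<in> fractions R"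
    using x y by (intro fr B) auto
  then show "x + y \<in> fractions R" using x y by (simp add: add_frac_eq)
  have "(a * c) / (b * d) \<in> fractions R"
    using x y by (intro fr B) auto
  then show "x * y \<in> fractions R" using x y by simp
  have "(- a) / b \<in> fractions R"
    using x by (intro fr B) auto
  then show "- x \<in> fractions R" using x by simp
  show "1 / x \<in> fractions R"
  proof (cases "a = 0")
    case True
    then show ?thesis using x fr[of 0 1] B(1,4) by simp
  next
    case False
    then show ?thesis using x fr[of b a] by simp
  qed
qed

lemma subset_fractions: "is_subring R \<Longrightarrow> R \<subseteq> fractions R"
  using subring_one by (force simp: fractions_def)

lemma generate_field_subset_fractions:
  fixes R :: "'f::field set"
  assumes R: "is_subring R" and H: "H \<subseteq> R"
  shows "generate_field type_ring H \<subseteq> fractions R"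
proof
  fix x :: 'f assume "x \<in> generate_field type_ring H"
  then show "x \<in> fractions R"
  proof induction
    case (m_inv h)
    then show ?case using fractions_closed(4)[OF R m_inv.IH m_inv.IH] by (simp add: type_ring_inv)
  next
    case (a_inv h)
    then show ?case using fractions_closed(3)[OF R a_inv.IH a_inv.IH] by (simp add: type_ring_uminus)
  qed (use subset_fractions[OF R] H subring_one[OF R] in \<open>auto simp: fractions_closed[OF R]\<close>)
qed

lemma eval_type_ring:
  "ring.eval type_ring l x = poly (Poly (rev l)) (x :: 'f::field)"
proof -
  interpret field "type_ring :: 'f ring" by (rule field_from_type_algebra)
  show ?thesis
    by (induction l) (auto simp: Poly_append poly_monom type_ring_nat_pow algebra_simps)
qed

lemma polynomial_type_ring:
  "l \<in> carrier (univ_poly type_ring K) \<longleftrightarrow> set l \<subseteq> K \<and> (l \<noteq> [] \<longrightarrow> hd l \<noteq> (0 :: 'f::field))"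
  unfolding univ_poly_carrier[symmetric] polynomial_def by auto

lemma coeff_Poly_mem:
  assumes "set l \<subseteq> A" "0 \<in> A"
  shows "Polynomial.coeff (Poly l) i \<in> A"
  using assms by (auto simp: nth_default_def coeff_Poly_eq)

lemma algebraic_imp_poly_root:
  fixes x :: "'f::field"
  assumes R: "is_subring R" and K: "K \<subseteq> fractions R"
    and "\<not> ring.transcendental type_ring K x"
  shows "\<exists>p. p \<noteq> 0 \<and> (\<forall>i. Polynomial.coeff p i \<in> fractions R) \<and> poly p x = 0"
proof -
  interpret field "type_ring :: 'f ring" by (rule field_from_type_algebra)
  obtain l m where lm: "l \<in> carrier (univ_poly type_ring K)" "m \<in> carrier (univ_poly type_ring K)"
      "eval l x = eval m x" "l \<noteq> m"
    using assms(3) by (auto simp: transcendental_def inj_on_def)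
  let ?p = "Poly (rev l) - Poly (rev m)"
  have inj: "coeffs (Poly (rev l)) = rev l" if "l \<in> carrier (univ_poly type_ring K)" for l :: "'f list"
    using that by (cases l) (auto simp: polynomial_type_ring strip_while_idem_iff)
  have "?p \<noteq> 0"
    using inj[OF lm(1)] inj[OF lm(2)] lm(4) by (metis eq_iff_diff_eq_0 rev_rev_ident)
  moreover have "poly ?p x = 0"
    using lm(3) by (simp add: eval_type_ring)
  moreover have "Polynomial.coeff ?p i \<in> fractions R" for i
  proof -
    have 0: "0 \<in> fractions R" using subset_fractions[OF R] subring_zero[OF R] by blast
    have c: "Polynomial.coeff (Poly (rev l)) i \<in> fractions R" "Polynomial.coeff (Poly (rev m)) i \<in> fractions R"
      using lm(1,2) K 0 unfolding polynomial_type_ring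
      by (metis coeff_Poly_mem set_rev subset_trans)+
    show ?thesis
      using fractions_closed(1)[OF R c(1) fractions_closed(3)[OF R c(2) c(2)]] by simp
  qed
  ultimately show ?thesis by blast
qed

section \<open>Number fields\<close>

text \<open>For the last property of a Euclidean subring take \<open>1 + 3 d\<close>: it is coprime to \<open>d\<close>, and it
  differs from zero and from the units for every nonzero \<open>d\<close> (unlike \<open>1 + d\<close> or
  \<open>1 + 2 d\<close>).\<close>

lemma euclidean_subring_integers:
  assumes "number_field TYPE('f::field)"
  shows "euclidean_subring (range (of_int :: int \<Rightarrow> 'f)) (\<lambda>x. nat \<bar>inv_into UNIV of_int x\<bar>)"
proof -
  have char: "CHAR('f) = 0"
    and fin: "ring.finite_dimension (type_ring :: 'f ring) (generate_field type_ring {}) UNIV"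
    using assms by (auto simp: number_field_def)
  have inj: "inj (of_int :: int \<Rightarrow> 'f)"
  proof (rule injI)
    fix a b :: int assume "(of_int a :: 'f) = of_int b"
    then have "(of_int (a - b) :: 'f) = 0" by simp
    then show "a = b" using char by (simp only: of_int_eq_0_iff_char_dvd) simp
  qed
  have eq: "(of_int a :: 'f) = of_int b \<longleftrightarrow> a = b" for a b using inj by (auto dest: injD)
  have eq0: "(of_int a :: 'f) = 0 \<longleftrightarrow> a = 0" for a using eq[of a 0] by simp
  have inv: "inv_into UNIV of_int (of_int a :: 'f) = a" for a using inj by simp
  have sub: "is_subring (range (of_int :: int \<Rightarrow> 'f))"
    by (auto simp: is_subring_def simp flip: of_int_diff of_int_mult intro: range_eqI[of _ _ 1])
  interpret field "type_ring :: 'f ring" by (rule field_from_type_algebra)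
  show ?thesis
  proof
    fix a b :: 'f assume "a \<in> range of_int" "b \<in> range of_int" "b \<noteq> 0"
    then obtain m n where mn: "a = of_int m" "b = of_int n" "n \<noteq> 0" by (auto simp: eq0)
    have "a - of_int (m div n) * b = of_int (m mod n)"
      unfolding mn by (simp add: minus_div_mult_eq_mod flip: of_int_diff of_int_mult)
    moreover have "nat \<bar>m mod n\<bar> < nat \<bar>n\<bar>"
      using mn(3) abs_mod_less[of n m] by simp
    ultimately show "\<exists>q\<in>range of_int. a - q * b = 0 \<or> nat \<bar>inv_into UNIV of_int (a - q * b)\<bar> < nat \<bar>inv_into UNIV of_int b\<bar>"
      unfolding mn(2) by (intro bexI[of _ "of_int (m div n)"]) (auto simp: inv)
  next
    fix a b :: 'f assume *: "a \<in> range of_int" "b \<in> range of_int" "a \<noteq> 0" "b \<noteq> 0" "1 / a \<notin> range of_int"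
    then obtain m n where mn: "a = of_int m" "b = of_int n" "m \<noteq> 0" "n \<noteq> 0" by (auto simp: eq0)
    have "\<bar>m\<bar> \<noteq> 1"
    proof
      assume "\<bar>m\<bar> = 1"
      then have "m = 1 \<or> m = - 1" by linarith
      then have "1 / a = of_int m" unfolding mn by auto
      then show False using *(5) by simp
    qed
    then have "\<bar>m\<bar> > 1" using mn(3) by linarith
    then have "\<bar>n\<bar> < \<bar>m * n\<bar>" using mn(4) by (simp add: abs_mult)
    then show "nat \<bar>inv_into UNIV of_int b\<bar> < nat \<bar>inv_into UNIV of_int (a * b)\<bar>"
      unfolding mn of_int_mult[symmetric] inv using mn(3,4) by linarith
  next
    fix x :: 'f
    have "subfield (generate_field type_ring {}) (type_ring :: 'f ring)"
      by (rule generate_field_is_subfield) simp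
    moreover have "subring UNIV (type_ring :: 'f ring)"
      using carrier_is_subring by simp
    ultimately have "\<not> transcendental (generate_field type_ring {}) x"
      using finite_dimension_imp_algebraic[OF _ _ fin, of x] by (simp add: over_def)
    then show "\<exists>p. p \<noteq> 0 \<and> (\<forall>i. Polynomial.coeff p i \<in> fractions (range of_int)) \<and> poly p x = 0"
      by (intro algebraic_imp_poly_root[OF sub generate_field_subset_fractions[OF sub]]) auto
  next
    fix D :: 'f assume "D \<in> range of_int" "D \<noteq> 0"
    then obtain d where d: "D = of_int d" "d \<noteq> 0" by (auto simp: eq0)
    let ?w = "1 + 3 * d"
    have w0: "(of_int ?w :: 'f) \<noteq> 0" unfolding eq0 by presburger
    have "1 / (of_int ?w :: 'f) \<notin> range of_int"
    proof
      assume "1 / (of_int ?w :: 'f) \<in> range of_int"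
      then obtain m where "1 / (of_int ?w :: 'f) = of_int m" by blast
      then have "(of_int (?w * m) :: 'f) = of_int 1"
        using w0 by (simp only: of_int_mult of_int_1) (metis nonzero_mult_div_cancel_left times_divide_eq_right mult.right_neutral)
      then have "?w * m = 1" by (simp only: eq)
      then have "\<bar>?w * m\<bar> = 1" by (simp only: abs_one)
      then have "\<bar>?w\<bar> = 1" by (rule abs_zmult_eq_1)
      then show False using d(2) by linarith
    qed
    moreover have "of_int (- 3) * D + of_int 1 * of_int ?w = 1"
      by (simp add: d(1))
    ultimately show "\<exists>\<omega>\<in>range of_int. \<omega> \<noteq> 0 \<and> 1 / \<omega> \<notin> range of_int \<and>
        (\<exists>a\<in>range of_int. \<exists>b\<in>range of_int. a * D + b * \<omega> = 1)"
      using w0 by blast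
  qed (rule sub)
qed

section \<open>Function fields of transcendence degree one\<close>

lemma division_with_coefficients_in:
  fixes a b :: "'f::field poly"
  assumes K: "is_subring K" "\<And>x. x \<in> K \<Longrightarrow> x \<noteq> 0 \<Longrightarrow> 1 / x \<in> K"
    and b: "\<And>i. Polynomial.coeff b i \<in> K" "b \<noteq> 0" and a: "\<And>i. Polynomial.coeff a i \<in> K"
  shows "\<exists>q. (\<forall>i. Polynomial.coeff q i \<in> K) \<and>
     (a - q * b = 0 \<or> Polynomial.degree (a - q * b) < Polynomial.degree b)"
  using a
proof (induction "Polynomial.degree a" arbitrary: a rule: less_induct)
  case less
  note B = is_subringD[OF K(1)]
  show ?case
  proof (cases "Polynomial.degree a < Polynomial.degree b")
    case True
    then show ?thesis using B by (intro exI[of _ 0]) auto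
  next
    case False
    let ?n = "Polynomial.degree a" and ?k = "Polynomial.degree b"
    define m where "m = Polynomial.monom (Polynomial.coeff a ?n / Polynomial.coeff b ?k) (?n - ?k)"
    have lb: "Polynomial.coeff b ?k \<noteq> 0" using b(2) by simp
    have "Polynomial.coeff a ?n * (1 / Polynomial.coeff b ?k) \<in> K"
      using less.prems b lb by (intro B K(2))
    then have mK: "Polynomial.coeff m i \<in> K" for i
      using B by (auto simp: m_def)
    have mb: "Polynomial.coeff (m * b) i \<in> K" for i
      using mK b(1) by (auto simp: coeff_mult intro!: subring_sum[OF K(1)] B)
    have "Polynomial.coeff (m * b) ?n = Polynomial.coeff a ?n"
      using False lb by (simp add: m_def coeff_monom_mult)
    moreover have "Polynomial.degree (m * b) \<le> ?n"
    proof -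
      have "Polynomial.degree m \<le> ?n - ?k" by (simp add: m_def degree_monom_le)
      then show ?thesis using degree_mult_le[of m b] False by linarith
    qed
    ultimately have "a - m * b = 0 \<or> Polynomial.degree (a - m * b) < ?n"
      by (intro eq_zero_or_degree_less degree_diff_le) auto
    then show ?thesis
    proof
      assume "a - m * b = 0"
      then show ?thesis using mK by blast
    next
      assume "Polynomial.degree (a - m * b) < ?n"
      then obtain q where q: "\<forall>i. Polynomial.coeff q i \<in> K"
          "a - m * b - q * b = 0 \<or> Polynomial.degree (a - m * b - q * b) < ?k"
        using less.hyps[of "a - m * b"] less.prems mb B(2) by auto
      have "a - m * b - q * b = a - (m + q) * b" by (simp only: distrib_right diff_diff_eq)
      moreover have "Polynomial.coeff (m + q) i \<in> K" for i
        using q(1) mK B(6) by simp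
      ultimately show ?thesis
        using q(2) by metis
    qed
  qed
qed

lemma subfield_type_ringD:
  assumes "subfield K (type_ring :: 'f::field ring)"
  shows "is_subring K" "x \<in> K \<Longrightarrow> x \<noteq> 0 \<Longrightarrow> 1 / x \<in> K"
proof -
  interpret field "type_ring :: 'f ring" by (rule field_from_type_algebra)
  note s = subringE[OF subfieldE(1)[OF assms]]
  show "is_subring K"
    unfolding is_subring_def
  proof (intro conjI ballI)
    show "1 \<in> K" using s(3) by simp
    fix x y assume xy: "x \<in> K" "y \<in> K"
    show "x * y \<in> K" using s(6)[OF xy] by simp
    show "x - y \<in> K" using s(7)[OF xy(1) s(5)[OF xy(2)]] by (simp add: type_ring_uminus)
  qed
  show "x \<in> K \<Longrightarrow> x \<noteq> 0 \<Longrightarrow> 1 / x \<in> K"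
    using subfield_m_inv(1)[OF assms, of x] by (simp add: type_ring_inv)
qed

text \<open>Since \<open>t\<close> is transcendental, an element of \<open>K[t]\<close> is the value of exactly one polynomial, whose
  degree serves as the size. A non-unit coprime to \<open>D\<close> is \<open>1 + t D\<close>.\<close>

lemma euclidean_subring_polynomials:
  fixes K :: "'f::field set" and value_degree :: "'f \<Rightarrow> nat"
  assumes K: "subfield K type_ring"
    and t: "ring.transcendental type_ring K t"
    and alg: "\<And>x. \<not> ring.transcendental type_ring (generate_field type_ring (insert t K)) x"
  defines "value_degree \<equiv> \<lambda>x. Polynomial.degree (THE p. (\<forall>i. Polynomial.coeff p i \<in> K) \<and> poly p t = x)"
  shows "euclidean_subring (adjoin K t) value_degree"
proof -
  interpret field "type_ring :: 'f ring" by (rule field_from_type_algebra)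
  note KD = subfield_type_ringD[OF K]
  note B = is_subringD[OF KD(1)]
  let ?in = "\<lambda>p. \<forall>i. Polynomial.coeff p i \<in> K"
  have mult_in: "?in (p * q)" if "?in p" "?in q" for p q
    using that by (auto simp: coeff_mult intro!: subring_sum[OF KD(1)] B)
  have zero: "p = 0" if "?in p" "poly p t = 0" for p
  proof -
    have "rev (coeffs p) \<in> carrier (univ_poly type_ring K)"
    proof -
      have "set (coeffs p) \<subseteq> K"
        using that(1) by (auto simp: coeffs_def)
      moreover have "hd (rev (coeffs p)) \<noteq> 0" if "coeffs p \<noteq> []"
        using that last_coeffs_eq_coeff_degree[of p] by (auto simp: hd_rev)
      ultimately show ?thesis
        by (auto simp: polynomial_type_ring)
    qed
    moreover have "[] \<in> carrier (univ_poly (type_ring :: 'f ring) K)"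
      by (simp add: polynomial_type_ring)
    moreover have "eval (rev (coeffs p)) t = eval [] t"
      using that(2) by (simp add: eval_type_ring)
    ultimately have "rev (coeffs p) = []"
      using t unfolding transcendental_def by (blast dest: inj_onD)
    then show "p = 0" by simp
  qed
  have unique: "p = q" if "?in p" "?in q" "poly p t = poly q t" for p q
    using zero[of "p - q"] that B(2) by simp
  have size: "value_degree (poly p t) = Polynomial.degree p" if "?in p" for p
  proof -
    have "(THE q. ?in q \<and> poly q t = poly p t) = p"
      using that unique by (intro the_equality) auto
    then show ?thesis by (simp add: value_degree_def)
  qed
  note sub = subring_adjoin[OF KD(1), of t]
  show ?thesis
  proof
    fix a b assume "a \<in> adjoin K t" "b \<in> adjoin K t" "b \<noteq> 0"
    then obtain p q where p: "\<And>i. Polynomial.coeff p i \<in> K" "a = poly p t"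
        and q: "\<And>i. Polynomial.coeff q i \<in> K" "b = poly q t" "q \<noteq> 0"
      by (metis adjoinE poly_0)
    obtain s where s: "?in s" "p - s * q = 0 \<or> Polynomial.degree (p - s * q) < Polynomial.degree q"
      using division_with_coefficients_in[OF KD q(1,3) p(1)] by blast
    have "?in (p - s * q)" using p(1) mult_in[of s q] s(1) q(1) B(2) by simp
    then have "value_degree (poly (p - s * q) t) = Polynomial.degree (p - s * q)" by (rule size)
    moreover have "value_degree b = Polynomial.degree q" using size q by simp
    moreover have "a - poly s t * b = poly (p - s * q) t" by (simp add: p q)
    ultimately have "a - poly s t * b = 0 \<or> value_degree (a - poly s t * b) < value_degree b"
      using s(2) by auto
    then show "\<exists>r\<in>adjoin K t. a - r * b = 0 \<or> value_degree (a - r * b) < value_degree b"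
      using adjoinI[of s K t] s(1) by blast
  next
    fix a b assume *: "a \<in> adjoin K t" "b \<in> adjoin K t" "a \<noteq> 0" "b \<noteq> 0" "1 / a \<notin> adjoin K t"
    then obtain p q where p: "\<And>i. Polynomial.coeff p i \<in> K" "a = poly p t" "p \<noteq> 0"
        and q: "\<And>i. Polynomial.coeff q i \<in> K" "b = poly q t" "q \<noteq> 0"
      by (metis adjoinE poly_0)
    have "Polynomial.degree p \<noteq> 0"
    proof
      assume "Polynomial.degree p = 0"
      then have "a = Polynomial.coeff p 0" using p(2) by (simp add: poly_altdef)
      then have "1 / a \<in> K" using KD(2) p(1) *(3) by simp
      then show False using *(5) subset_adjoin[OF KD(1)] by blast
    qed
    then have "Polynomial.degree q < Polynomial.degree (p * q)"
      using p(3) q(3) by (simp add: degree_mult_eq)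
    then show "value_degree b < value_degree (a * b)"
      using size[of q] size[of "p * q"] mult_in[of p q] p q by simp
  next
    fix x :: 'f
    have "insert t K \<subseteq> adjoin K t"
      using subset_adjoin[OF KD(1)] mem_adjoin[OF KD(1)] by blast
    then show "\<exists>p. p \<noteq> 0 \<and> (\<forall>i. Polynomial.coeff p i \<in> fractions (adjoin K t)) \<and> poly p x = 0"
      using alg by (intro algebraic_imp_poly_root[OF sub generate_field_subset_fractions[OF sub]])
  next
    fix D assume "D \<in> adjoin K t" "D \<noteq> 0"
    then obtain d where d: "\<And>i. Polynomial.coeff d i \<in> K" "D = poly d t" "d \<noteq> 0"
      by (metis adjoinE poly_0)
    let ?w = "1 + pCons 0 d"
    have win: "?in ?w"
      using d(1) B by (auto simp: coeff_pCons split: nat.split)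
    have deg: "Polynomial.degree ?w = Suc (Polynomial.degree d)"
      using d(3) degree_add_eq_right[of 1 "pCons 0 d"] by simp
    have wt: "poly ?w t = 1 + t * D" by (simp add: d(2))
    have w0: "1 + t * D \<noteq> 0"
    proof
      assume "1 + t * D = 0"
      then have "?w = 0" using zero[OF win] wt by simp
      then show False using deg by simp
    qed
    have "1 / (1 + t * D) \<notin> adjoin K t"
    proof
      assume "1 / (1 + t * D) \<in> adjoin K t"
      then obtain m where m: "\<And>i. Polynomial.coeff m i \<in> K" "1 / (1 + t * D) = poly m t"
        by (metis adjoinE)
      have "poly (m * ?w) t = poly 1 t"
        using w0 wt by (simp flip: m(2))
      moreover have "?in 1" using B by (auto simp: coeff_1)
      ultimately have mw: "m * ?w = 1"
        using unique mult_in[of m ?w] m(1) win by blast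
      then have "m \<noteq> 0" "?w \<noteq> 0" by auto
      then have "Polynomial.degree (m * ?w) = Polynomial.degree m + Polynomial.degree ?w"
        by (rule degree_mult_eq)
      then show False using mw deg by simp
    qed
    moreover have "1 + t * D \<in> adjoin K t"
      using adjoinI[of ?w K t] win unfolding wt by blast
    moreover have "- t * D + 1 * (1 + t * D) = 1" by simp
    moreover have "- t \<in> adjoin K t" "1 \<in> adjoin K t"
      using sub mem_adjoin[OF KD(1)] by (auto intro: is_subringD)
    ultimately show "\<exists>\<omega>\<in>adjoin K t. \<omega> \<noteq> 0 \<and> 1 / \<omega> \<notin> adjoin K t \<and>
        (\<exists>a\<in>adjoin K t. \<exists>b\<in>adjoin K t. a * D + b * \<omega> = 1)"
      using w0 by blast
  qed (rule sub)
qed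

section \<open>Places\<close>

text \<open>The chosen representative need not be the constructed norm itself, but equivalent norms share
  the unit ball and the elements of norm one.\<close>

lemma (in euclidean_subring) exists_place_of_euclidean_subring:
  assumes C: "finite C" "0 \<notin> C"
    and K: "\<And>x. x \<in> K \<Longrightarrow> x \<noteq> 0 \<Longrightarrow> x \<in> R \<and> 1 / x \<in> R"
    and rep: "\<And>p. p \<in> places K \<Longrightarrow> rep p \<in> p"
  shows "\<exists>p\<in>places K. (\<forall>c\<in>C. rep p c = 1) \<and> (\<forall>n. rep p (of_nat n) \<le> 1)"
proof -
  obtain N where N: "field_norm type_ring N" "\<exists>x. x \<noteq> 0 \<and> N x \<noteq> 1"
      "\<And>x. x \<in> R \<Longrightarrow> N x \<le> 1" "\<And>x. x \<in> R \<Longrightarrow> x \<noteq> 0 \<Longrightarrow> 1 / x \<in> R \<Longrightarrow> N x = 1"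
      "\<And>c. c \<in> C \<Longrightarrow> N c = 1"
    using exists_norm_equal_one_on[OF C] by blast
  let ?p = "norm_equiv `` {N}"
  have p: "?p \<in> places K"
    unfolding places_def by (rule quotientI) (use N K in auto)
  then have e: "(N, rep ?p) \<in> norm_equiv" using rep by blast
  have "rep ?p c = 1" if "c \<in> C" for c
    using norm_equiv_eq_one[OF e] N(5)[OF that] by blast
  moreover have "rep ?p (of_nat n) \<le> 1" for n
    using norm_equiv_le_one[OF e] N(3)[OF subring_of_nat[OF subring_R]] by blast
  ultimately show ?thesis using p by blast
qed

lemma exists_place_equal_one_on:
  fixes S :: "('f::field \<Rightarrow> real) set set"
  assumes base: "(number_field TYPE('f) \<and> S = places {}) \<or>
      (\<exists>K. smooth_projective_curve_field K \<and> S = places K)"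
    and rep: "\<And>p. p \<in> S \<Longrightarrow> rep p \<in> p"
    and C: "finite C" "0 \<notin> C"
  shows "\<exists>p\<in>S. (\<forall>c\<in>C. rep p c = 1) \<and> (\<forall>n. rep p (of_nat n) \<le> 1)"
  using base
proof
  assume *: "number_field TYPE('f) \<and> S = places {}"
  then interpret euclidean_subring "range (of_int :: int \<Rightarrow> 'f)" "\<lambda>x. nat \<bar>inv_into UNIV of_int x\<bar>"
    by (intro euclidean_subring_integers) simp
  show ?thesis
    using exists_place_of_euclidean_subring[OF C, of "{}" rep] rep * by auto
next
  assume "\<exists>K. smooth_projective_curve_field K \<and> S = places K"
  then obtain K where K: "smooth_projective_curve_field K" "S = places K" by blast
  then have sf: "subfield K (type_ring :: 'f ring)" and td: "transcendence_degree_one K"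
    by (auto simp: smooth_projective_curve_field_def)
  note KD = subfield_type_ringD[OF sf]
  obtain t where t: "ring.transcendental type_ring K t"
      "\<And>x. \<not> ring.transcendental type_ring (generate_field type_ring (insert t K)) x"
    using td by (auto simp: transcendence_degree_one_def)
  interpret euclidean_subring "adjoin K t"
      "\<lambda>x. Polynomial.degree (THE p. (\<forall>i. Polynomial.coeff p i \<in> K) \<and> poly p t = x)"
    by (rule euclidean_subring_polynomials[OF sf t])
  show ?thesis
    using exists_place_of_euclidean_subring[OF C, of K rep] rep K(2) KD(2) subset_adjoin[OF KD(1), of t] by auto
qed

lemma place_norm:
  assumes "p \<in> places K" "N \<in> p"
  shows "field_norm type_ring N" "\<exists>x. N x > 1"
proof -
  obtain M where M: "(M, N) \<in> norm_equiv" "\<exists>x. x \<noteq> 0 \<and> M x \<noteq> 1"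
    using assms by (auto simp: places_def elim!: quotientE)
  show N: "field_norm type_ring N" by (rule norm_equiv_norms[OF M(1)])
  note Mn = norm_equiv_norms(1)[OF M(1)]
  obtain x where x: "x \<noteq> 0" "M x \<noteq> 1" using M(2) by blast
  have pos: "N y > 1" if "y \<noteq> 0" "M (1 / y) < 1" for y
  proof -
    have "N (1 / y) < 1" using that norm_equiv_less_one[OF M(1)] by blast
    then show ?thesis
      using field_norm_pos[OF N that(1)] that(1) by (simp add: field_norm_inverse[OF N])
  qed
  show "\<exists>x. N x > 1"
  proof (cases "M x < 1")
    case True
    then show ?thesis using pos[of "1 / x"] x by auto
  next
    case False
    then have "M (1 / x) < 1" using x by (simp add: field_norm_inverse[OF Mn])
    then show ?thesis using pos[of x] x by blast
  qed
qed

section \<open>Half-lines and the adelic amoeba\<close>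

text \<open>A Laurent polynomial with a single term is a unit.\<close>

lemma hypersurface_eq_two_terms:
  fixes f :: "('f::field, 'd::finite) laurent_poly"
  assumes "hypersurface_eq f"
  shows "Poly_Mapping.keys f \<noteq> {}" "\<exists>\<alpha>\<in>Poly_Mapping.keys f. \<alpha> \<noteq> \<gamma>"
proof -
  show ne: "Poly_Mapping.keys f \<noteq> {}"
    using assms by (auto simp: hypersurface_eq_def)
  show "\<exists>\<alpha>\<in>Poly_Mapping.keys f. \<alpha> \<noteq> \<gamma>"
  proof (rule ccontr)
    assume "\<not> ?thesis"
    then have all: "\<alpha> = \<gamma>" if "\<alpha> \<in> Poly_Mapping.keys f" for \<alpha>
      using that by auto
    obtain \<alpha> where \<alpha>: "\<alpha> \<in> Poly_Mapping.keys f"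
      using ne by (meson ex_in_conv)
    then have "\<gamma> \<in> Poly_Mapping.keys f"
      using all[OF \<alpha>] by simp
    then have keys: "Poly_Mapping.keys f = {\<gamma>}"
      by (intro equalityI subsetI) (auto dest: all)
    define c where "c = Poly_Mapping.lookup f \<gamma>"
    have c: "c \<noteq> 0" using keys by (simp add: c_def flip: in_keys_iff)
    have "f = Poly_Mapping.single \<gamma> c"
      using keys by (intro poly_mapping_eqI) (auto simp: c_def lookup_single when_def in_keys_iff[symmetric] not_in_keys_iff_lookup_eq_zero[symmetric])
    then have "f * Poly_Mapping.single (- \<gamma>) (1 / c) = 1"
      using c by (simp add: mult_single)
    then have "f dvd 1" by (metis dvd_triv_left)
    then show False using assms by (simp add: hypersurface_eq_def)
  qed
qed

lemma place_extension_of_completed_closure: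
  assumes N: "field_norm type_ring N" "\<exists>x. N x > 1"
    and c: "completed_closure N L k nrm emb"
  shows "place_extension L nrm emb" "nrm (emb x) = N x"
proof -
  interpret algebraic_closure L k
    using c by (simp add: completed_closure_def)
  have e: "emb \<in> ring_hom type_ring L" and ext: "\<And>x. nrm (emb x) = N x"
    using c by (auto simp: completed_closure_def)
  show "nrm (emb x) = N x" by (rule ext)
  obtain x where "N x > 1" using N(2) by blast
  then have "\<exists>x\<in>carrier L. nrm x > 1"
    using e ext by (intro bexI[of _ "emb x"]) (auto simp: ring_hom_def)
  then show "place_extension L nrm emb"
    using c e by unfold_locales (auto simp: completed_closure_def)
qed

theorem theorem2p3p4:
  fixes S :: "('f::field \<Rightarrow> real) set set"
    and rep :: "('f \<Rightarrow> real) set \<Rightarrow> 'f \<Rightarrow> real"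
    and L :: "('f \<Rightarrow> real) set \<Rightarrow> ('l, 'm) ring_scheme"
    and k :: "('f \<Rightarrow> real) set \<Rightarrow> 'l set"
    and nrm :: "('f \<Rightarrow> real) set \<Rightarrow> 'l \<Rightarrow> real"
    and emb :: "('f \<Rightarrow> real) set \<Rightarrow> 'f \<Rightarrow> 'l"
    and f :: "('f, 'd::finite) laurent_poly"
    and v :: "real ^ 'd"
  assumes base_field: "(number_field TYPE('f) \<and> S = places {}) \<or>
      (\<exists>K. smooth_projective_curve_field K \<and> S = places K)"
    and representatives: "\<And>p. p \<in> S \<Longrightarrow> rep p \<in> p"
    and product_formula: "product_formula S rep"
    and completions: "\<And>p. p \<in> S \<Longrightarrow> completed_closure (rep p) (L p) (k p) (nrm p) (emb p)"
    and hypersurface: "hypersurface_eq f"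
    and origin: "\<exists>p\<in>S. 0 \<notin> amoeba (L p) (nrm p) (emb p) f"
    and nonzero: "v \<noteq> 0"
  shows "{t *\<^sub>R v | t. t > 0} \<inter> adelic_amoeba S L nrm emb f \<noteq> {}"
proof
  assume disjoint: "{t *\<^sub>R v | t. t > 0} \<inter> adelic_amoeba S L nrm emb f = {}"
  let ?A = "Poly_Mapping.keys f"
  let ?c = "Poly_Mapping.lookup f"
  have avoid: "t *\<^sub>R v \<notin> amoeba (L p) (nrm p) (emb p) f" if "p \<in> S" "t > 0" for p t
    using disjoint that unfolding adelic_amoeba_def by blast
  have norm: "field_norm type_ring (rep p)" "\<exists>x. rep p x > 1" if "p \<in> S" for p
  proof -
    obtain K where "S = places K" using base_field by blast
    then show "field_norm type_ring (rep p)" "\<exists>x. rep p x > 1"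
      using place_norm[of p K "rep p"] representatives[OF that] that by blast+
  qed
  have place: "place_extension (L p) (nrm p) (emb p)" "\<And>x. nrm p (emb p x) = rep p x" if "p \<in> S" for p
    using place_extension_of_completed_closure[OF norm[OF that] completions[OF that]] by blast+

  \<comment> \<open>At an ultrametric place with all coefficients of norm one, a tie for the maximum along \<open>v\<close>
    would put \<open>v\<close> itself into the amoeba.\<close>
  obtain \<gamma> where \<gamma>: "\<gamma> \<in> ?A" and max: "\<And>\<alpha>. \<alpha> \<in> ?A \<Longrightarrow> \<alpha> \<noteq> \<gamma> \<Longrightarrow> real_vec \<alpha> \<bullet> v < real_vec \<gamma> \<bullet> v"
  proof -
    have "0 \<notin> ?c ` ?A"
      by (auto simp: in_keys_iff)
    then have "\<exists>p\<in>S. (\<forall>c\<in>?c ` ?A. rep p c = 1) \<and> (\<forall>n. rep p (of_nat n) \<le> 1)"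
      by (intro exists_place_equal_one_on base_field representatives) auto
    then obtain p where p: "p \<in> S" "\<And>c. c \<in> ?c ` ?A \<Longrightarrow> rep p c = 1" "\<And>n. rep p (of_nat n) \<le> 1"
      by blast
    interpret place_extension "L p" "nrm p" "emb p" by (rule place(1)[OF p(1)])
    have "[n] \<cdot>\<^bsub>L p\<^esub> \<one>\<^bsub>L p\<^esub> = emb p (of_nat n)" for n :: nat
      by (induction n) (auto simp: emb_zero emb_add emb_one a_comm emb_closed)
    then have "nrm p ([n] \<cdot>\<^bsub>L p\<^esub> \<one>\<^bsub>L p\<^esub>) \<le> 1" for n :: nat
      using p(3) place(2)[OF p(1)] by simp
    then have u: ultrametric
      by (rule ultrametric_if_integers_bounded)
    define M where "M = Max ((\<lambda>\<alpha>. real_vec \<alpha> \<bullet> v) ` ?A)"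
    have "M \<in> (\<lambda>\<alpha>. real_vec \<alpha> \<bullet> v) ` ?A"
      unfolding M_def using hypersurface_eq_two_terms(1)[OF hypersurface] by (intro Max_in) auto
    then obtain \<gamma> where \<gamma>: "\<gamma> \<in> ?A" "real_vec \<gamma> \<bullet> v = M" by auto
    have M: "real_vec \<alpha> \<bullet> v \<le> M" if "\<alpha> \<in> ?A" for \<alpha>
      unfolding M_def using that by (intro Max_ge) auto
    have "real_vec \<alpha> \<bullet> v < real_vec \<gamma> \<bullet> v" if \<alpha>: "\<alpha> \<in> ?A" "\<alpha> \<noteq> \<gamma>" for \<alpha>
    proof (rule ccontr)
      assume "\<not> ?thesis"
      then have "real_vec \<alpha> \<bullet> v = M" using M[OF \<alpha>(1)] \<gamma>(2) by linarith
      then have "v \<in> amoeba (L p) (nrm p) (emb p) f"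
        using p(2) place(2)[OF p(1)] \<gamma> \<alpha> M by (intro tie_in_amoeba[OF u _ \<alpha>(1) \<gamma>(1) \<alpha>(2)]) auto
      then show False using avoid[OF p(1), of 1] by simp
    qed
    then show ?thesis using that \<gamma>(1) by blast
  qed

  obtain \<beta> where \<beta>: "generically_minimal ?A v \<beta>"
    using exists_generically_minimal hypersurface_eq_two_terms(1)[OF hypersurface] finite_keys by metis
  have \<beta>A: "\<beta> \<in> ?A" using \<beta> by (simp add: generically_minimal_def)
  have "\<beta> \<noteq> \<gamma>"
  proof
    assume "\<beta> = \<gamma>"
    obtain \<alpha> where \<alpha>: "\<alpha> \<in> ?A" "\<alpha> \<noteq> \<gamma>"
      using hypersurface_eq_two_terms(2)[OF hypersurface] by blast
    have "open {w. real_vec \<alpha> \<bullet> w < real_vec \<gamma> \<bullet> w}"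
      by (intro open_Collect_less continuous_intros)
    moreover have "v \<in> {w. real_vec \<alpha> \<bullet> w < real_vec \<gamma> \<bullet> w}"
      using max[OF \<alpha>] by simp
    ultimately obtain W q where "q > 0" "(1 / real q) *\<^sub>R real_vec W \<in> {w. real_vec \<alpha> \<bullet> w < real_vec \<gamma> \<bullet> w}"
        "int_dot \<beta> W \<le> int_dot \<alpha> W"
      using \<beta> \<alpha>(1) unfolding generically_minimal_def by blast
    then show False
      by (simp add: inner_real_vec \<open>\<beta> = \<gamma>\<close> divide_less_cancel)
  qed
  then have \<beta>\<gamma>: "real_vec \<beta> \<bullet> v < real_vec \<gamma> \<bullet> v"
    using max \<beta>A by blast

  have shifted: "rep p (?c \<beta>) * exp (s * (real_vec \<beta> \<bullet> v)) \<le> rep p (?c \<gamma>) * exp (s * (real_vec \<gamma> \<bullet> v))"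
    if p: "p \<in> S" and s: "\<And>t. t \<ge> 0 \<Longrightarrow> (s + t) *\<^sub>R v \<notin> amoeba (L p) (nrm p) (emb p) f" for p s
  proof -
    interpret place_extension "L p" "nrm p" "emb p" by (rule place(1)[OF p])
    show ?thesis
      using generically_minimal_term_le[OF \<gamma> max, of "s *\<^sub>R v" \<beta>] s \<beta>
      by (simp add: place(2)[OF p] scaleR_add_left)
  qed
  \<comment> \<open>The open half-line gives the inequality from every starting point \<open>s v\<close> with \<open>s > 0\<close>, and the
    limit \<open>s \<rightarrow> 0\<close> removes the exponential factors.\<close>
  have le: "rep p (?c \<beta>) \<le> rep p (?c \<gamma>)" if p: "p \<in> S" for p
  proof -
    let ?g = "\<lambda>s. rep p (?c \<gamma>) * exp (s * (real_vec \<gamma> \<bullet> v)) - rep p (?c \<beta>) * exp (s * (real_vec \<beta> \<bullet> v))"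
    have "(?g \<longlongrightarrow> ?g 0) (at_right 0)"
      by (intro tendsto_intros)
    moreover have "\<forall>\<^sub>F s in at_right 0. 0 \<le> ?g s"
    proof (rule eventually_at_rightI[of 0 1])
      fix s :: real assume "s \<in> {0<..<1}"
      then show "0 \<le> ?g s"
        using shifted[OF p, of s] avoid[OF p] by simp
    qed simp
    ultimately have "0 \<le> ?g 0"
      by (rule tendsto_lowerbound) simp
    then show ?thesis by simp
  qed

  \<comment> \<open>The factors of the product formula for this quotient are all at most one.\<close>
  define x where "x = ?c \<beta> / ?c \<gamma>"
  have c0: "?c \<beta> \<noteq> 0" "?c \<gamma> \<noteq> 0" using \<beta>A \<gamma> by (simp_all add: in_keys_iff)
  then have x0: "x \<noteq> 0" by (simp add: x_def)
  have xc: "rep p x * rep p (?c \<gamma>) = rep p (?c \<beta>)" if "p \<in> S" for p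
    using field_norm_mult[OF norm(1)[OF that], of x "?c \<gamma>"] c0 by (simp add: x_def)
  have x1: "0 < rep p x" "rep p x \<le> 1" if p: "p \<in> S" for p
  proof -
    show "0 < rep p x" by (rule field_norm_pos[OF norm(1)[OF p] x0])
    have "rep p x * rep p (?c \<gamma>) \<le> 1 * rep p (?c \<gamma>)" using xc[OF p] le[OF p] by simp
    then show "rep p x \<le> 1"
      using field_norm_pos[OF norm(1)[OF p] c0(2)] by (simp only: mult_le_cancel_right_pos)
  qed
  define Q where "Q = {p\<in>S. rep p x \<noteq> 1}"
  have Q: "finite Q" "(\<Prod>p\<in>Q. rep p x) = 1"
    using product_formula x0 by (simp_all add: product_formula_def Q_def)
  have "Q = {}"
  proof (rule ccontr)
    assume "Q \<noteq> {}"
    then obtain q where q: "q \<in> Q" by blast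
    have "(\<Prod>p\<in>Q. rep p x) = rep q x * (\<Prod>p\<in>Q - {q}. rep p x)"
      using Q(1) q by (rule prod.remove)
    also have "\<dots> \<le> rep q x * 1"
      using q x1 by (intro mult_left_mono prod_le_1) (auto simp: Q_def less_imp_le)
    also have "\<dots> < 1"
      using q x1(2)[of q] by (simp add: Q_def)
    finally show False using Q(2) by simp
  qed
  then have equal: "rep p (?c \<beta>) = rep p (?c \<gamma>)" if "p \<in> S" for p
    using that xc[OF that] by (auto simp: Q_def)

  \<comment> \<open>Where the amoeba misses the origin the half-line can be prolonged backwards, so that the starting
    point \<open>- s v\<close> with \<open>s > 0\<close> is allowed; there the exponential factors compare the other way round.\<close>
  obtain p where p: "p \<in> S" "0 \<notin> amoeba (L p) (nrm p) (emb p) f"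
    using origin by blast
  have "open (- amoeba (L p) (nrm p) (emb p) f)"
    by (simp add: amoeba_def open_Compl)
  then obtain e where e: "e > 0" "ball 0 e \<subseteq> - amoeba (L p) (nrm p) (emb p) f"
    using p(2) by (meson ComplI open_contains_ball)
  define s where "s = e / (2 * norm v)"
  have s: "s > 0" "s * norm v < e"
    using e nonzero by (auto simp: s_def)
  have "(- s + t) *\<^sub>R v \<notin> amoeba (L p) (nrm p) (emb p) f" if t: "t \<ge> 0" for t
  proof (cases "t > s")
    case True
    then show ?thesis using avoid[OF p(1), of "- s + t"] by simp
  next
    case False
    then have "\<bar>- s + t\<bar> * norm v \<le> s * norm v"
      using t s by (intro mult_right_mono) auto
    then have "(- s + t) *\<^sub>R v \<in> ball 0 e" using s by simp
    then show ?thesis using e(2) by blast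
  qed
  then have "rep p (?c \<beta>) * exp (- s * (real_vec \<beta> \<bullet> v)) \<le> rep p (?c \<gamma>) * exp (- s * (real_vec \<gamma> \<bullet> v))"
    by (rule shifted[OF p(1)])
  then have "exp (- s * (real_vec \<beta> \<bullet> v)) \<le> exp (- s * (real_vec \<gamma> \<bullet> v))"
    using equal[OF p(1)] field_norm_pos[OF norm(1)[OF p(1)] c0(2)] by simp
  then show False
    using s(1) \<beta>\<gamma> by simp
qed

end
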